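(* Let $w_1,w_2\in\mathrm{ACol}(C_n)^*$. Then $w_1\equiv_\epsilon w_2$ (extended crystal congruence) if and only if $w_1$ and $w_2$ have the same image in $Pl^{\mathbb N}(C_n)$. In other words, $\mathrm{ACol}(C_n)^*/\!\equiv_\epsilon\;=Pl^{\mathbb N}(C_n)$.
   Context: Setting: $C_n=\{1<\cdots<n<\overline n<\cdots<\overline1\}$ with crystal graph $1\xrightarrow{1}2\xrightarrow{2}\cdots\xrightarrow{n-1}n\xrightarrow{n}\overline n\xrightarrow{n-1}\cdots\xrightarrow{1}\overline1$; Kashiwara operators $e_i,f_i$ ($1\le i\le n$) act on $C_n^*$ by the usual tensor product rule ($f_i(uv)=(f_iu)v$ if $\varphi_i(u)>\varepsilon_i(v)$, else $u(f_iv)$; $e_i(uv)=(e_iu)v$ if $\varphi_i(u)\ge\varepsilon_i(v)$, else $u(e_iv)$). Columns, admissible columns, $\preceq$, tableau words, $Pl(C_n)$ and column insertion are the standard type $C$ notions (Lecouvey). $\mathrm{ACol}(C_n)$ is the set of admissible columns together with an extra symbol $\epsilon$; $p:\mathrm{ACol}(C_n)^*\to C_n^*$ is the monoid morphism sending $\epsilon$ to the empty word and each admissible column to itself (as a word). $\preceq$ is extended by $c\preceq\epsilon$ for all $c$ and $\epsilon\not\preceq c$ for $c\ne\epsilon$; $(c_1\leftarrow c_2)\in\mathrm{ACol}(C_n)^2$ is $d_1d_2$, $\epsilon d$, or $\epsilon\epsilon$ according as the tableau word of $p(c_1)p(c_2)$ is $d_1d_2$, one column $d$, or empty. $Pl^{\mathbb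 N}(C_n)$ is $\mathrm{ACol}(C_n)^*$ modulo the congruence generated by $c_1c_2=(c_1\leftarrow c_2)$ for $c_2\not\preceq c_1$. Crystal structure on $\mathrm{ACol}(C_n)^*$: for $w\in\mathrm{ACol}(C_n)^*$, $f_iw$ (resp. $e_iw$) is defined iff $f_ip(w)$ (resp. $e_ip(w)$) is defined, and then it is obtained from $w$ by replacing the column containing the letter modified by $f_i$ (resp. $e_i$) in $p(w)$ by the modified column (which is again admissible), all other letters of $w$, including the $\epsilon$'s, being unchanged. $B(w)$ is the connected component of $w$ in the labelled graph on $\mathrm{ACol}(C_n)^*$ with edges $w\xrightarrow{i}f_iw$. The extended crystal congruence $\equiv_\epsilon$ is the congruence on $\mathrm{ACol}(C_n)^*$ generated by: $w_1\sim_\epsilon w_2$ if $w_1,w_2$ have the same length (number of letters of $\mathrm{ACol}(C_n)$) and there is a label-preserving graph isomorphism $B(w_1)\to B(w_2)$ sending $w_1$ to $w_2$. *)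

theory Defs
  imports Main
begin

text \<open>Letters of C_n are encoded as natural numbers 1..2n with their natural order:
  the unbarred letter i (1 <= i <= n) is i, the barred letter bar i is 2n+1-i.
  Thus 1 < ... < n < bar n < ... < bar 1.\<close>

definition bar :: "nat \<Rightarrow> nat \<Rightarrow> nat" where
  "bar n x = 2 * n + 1 - x"

definition letter :: "nat \<Rightarrow> nat \<Rightarrow> bool" where
  "letter n x \<longleftrightarrow> 1 \<le> x \<and> x \<le> 2 * n"

text \<open>Crystal graph 1 -1-> 2 ... n-1 -(n-1)-> n -n-> bar n -(n-1)-> ... -1-> bar 1.\<close>

definition fl :: "nat \<Rightarrow> nat \<Rightarrow> nat \<Rightarrow> nat option" where
  "fl n i x =
     (if 1 \<le> i \<and> i < n then
        (if x = i then Some (i + 1) else if x = 2 * n - i then Some (2 * n + 1 - i) else None)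
      else if i = n \<and> x = n then Some (n + 1) else None)"

definition el :: "nat \<Rightarrow> nat \<Rightarrow> nat \<Rightarrow> nat option" where
  "el n i x =
     (if 1 \<le> i \<and> i < n then
        (if x = i + 1 then Some i else if x = 2 * n + 1 - i then Some (2 * n - i) else None)
      else if i = n \<and> x = n + 1 then Some n else None)"

definition phil :: "nat \<Rightarrow> nat \<Rightarrow> nat \<Rightarrow> int" where
  "phil n i x = (if fl n i x \<noteq> None then 1 else 0)"

definition epsl :: "nat \<Rightarrow> nat \<Rightarrow> nat \<Rightarrow> int" where
  "epsl n i x = (if el n i x \<noteq> None then 1 else 0)"

text \<open>epsilon_i and phi_i of words, from the tensor product rule
  (w = x v regarded as x tensor v).\<close>

fun epsw :: "nat \<Rightarrow> nat \<Rightarrow> nat list \<Rightarrow> int" and phiw :: "nat \<Rightarrow> nat \<Rightarrow> nat list \<Rightarrow> int" where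
  "epsw n i [] = 0"
| "epsw n i (x # v) = max (epsl n i x) (epsw n i v - phil n i x + epsl n i x)"
| "phiw n i [] = 0"
| "phiw n i (x # v) = max (phiw n i v) (phil n i x + phiw n i v - epsw n i v)"

text \<open>f_i on words: f_i(x v) = (f_i x) v if phi_i(x) > eps_i(v), else x (f_i v).
  (By associativity of the tensor product this agrees with the rule for any splitting w = u v.)\<close>

fun fw :: "nat \<Rightarrow> nat \<Rightarrow> nat list \<Rightarrow> nat list option" where
  "fw n i [] = None"
| "fw n i (x # v) =
     (if phil n i x > epsw n i v then map_option (\<lambda>y. y # v) (fl n i x)
      else map_option (Cons x) (fw n i v))"

definition column :: "nat \<Rightarrow> nat list \<Rightarrow> bool" where
  "column n c \<longleftrightarrow> c \<noteq> [] \<and> sorted_wrt (<) c \<and> (\<forall>x\<in>set c. letter n x)"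

definition pairs :: "nat \<Rightarrow> nat list \<Rightarrow> nat list" where
  "pairs n c = rev (filter (\<lambda>z. z \<in> set c \<and> bar n z \<in> set c) [1..<n+1])"

primrec pickJ :: "nat \<Rightarrow> nat list \<Rightarrow> nat \<Rightarrow> nat list \<Rightarrow> nat list option" where
  "pickJ n c b [] = Some []"
| "pickJ n c b (z # zs) =
     (let S = {t. 1 \<le> t \<and> t < min b z \<and> t \<notin> set c \<and> bar n t \<notin> set c}
      in if S = {} then None else map_option (Cons (Max S)) (pickJ n c (Max S) zs))"

definition Jset :: "nat \<Rightarrow> nat list \<Rightarrow> nat list option" where
  "Jset n c = pickJ n c (n + 1) (pairs n c)"

text \<open>A column is admissible iff it can be split (Lecouvey).\<close>
definition admissible :: "nat \<Rightarrow> nat list \<Rightarrow> bool" where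
  "admissible n c \<longleftrightarrow> column n c \<and> Jset n c \<noteq> None"

definition lcol :: "nat \<Rightarrow> nat list \<Rightarrow> nat list" where
  "lcol n c = sort (map (\<lambda>x. case map_of (zip (pairs n c) (the (Jset n c))) x of
                               Some t \<Rightarrow> t | None \<Rightarrow> x) c)"

definition rcol :: "nat \<Rightarrow> nat list \<Rightarrow> nat list" where
  "rcol n c = sort (map (\<lambda>x. case map_of (zip (map (bar n) (pairs n c)) (map (bar n) (the (Jset n c)))) x of
                               Some t \<Rightarrow> t | None \<Rightarrow> x) c)"

definition prec :: "nat \<Rightarrow> nat list \<Rightarrow> nat list \<Rightarrow> bool" where
  "prec n a b \<longleftrightarrow> admissible n a \<and> admissible n b \<and> length b \<le> length a \<and>
     (\<forall>k < length b. rcol n a ! k \<le> lcol n b ! k)"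

inductive cong_cl :: "('a list \<Rightarrow> 'a list \<Rightarrow> bool) \<Rightarrow> 'a list \<Rightarrow> 'a list \<Rightarrow> bool"
  for R where
  base: "R a b \<Longrightarrow> cong_cl R a b"
| refl: "cong_cl R a a"
| sym: "cong_cl R a b \<Longrightarrow> cong_cl R b a"
| trans: "cong_cl R a b \<Longrightarrow> cong_cl R b c \<Longrightarrow> cong_cl R a c"
| ctxt: "cong_cl R a b \<Longrightarrow> cong_cl R (u @ a @ v) (u @ b @ v)"

definition Ncount :: "nat \<Rightarrow> nat list \<Rightarrow> nat \<Rightarrow> nat" where
  "Ncount n w m = length (filter (\<lambda>x. x \<le> m \<or> bar n m \<le> x) w)"

inductive plac_rel :: "nat \<Rightarrow> nat list \<Rightarrow> nat list \<Rightarrow> bool" for n where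
  R1a: "\<lbrakk>letter n x; letter n y; letter n z; x \<le> y; y < z; z \<noteq> bar n x\<rbrakk>
        \<Longrightarrow> plac_rel n [y, z, x] [y, x, z]"
| R1b: "\<lbrakk>letter n x; letter n y; letter n z; x < y; y \<le> z; z \<noteq> bar n x\<rbrakk>
        \<Longrightarrow> plac_rel n [x, z, y] [z, x, y]"
| R2a: "\<lbrakk>1 < x; x \<le> n; x \<le> y; y \<le> bar n x\<rbrakk>
        \<Longrightarrow> plac_rel n [y, bar n (x - 1), x - 1] [y, x, bar n x]"
| R2b: "\<lbrakk>1 < x; x \<le> n; x \<le> y; y \<le> bar n x\<rbrakk>
        \<Longrightarrow> plac_rel n [x, bar n x, y] [bar n (x - 1), x - 1, y]"
| R3: "\<lbrakk>column n w; \<not> admissible n w;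
         \<forall>a u b. w = a @ u @ b \<and> u \<noteq> [] \<and> u \<noteq> w \<longrightarrow> admissible n u;
         z \<le> n; z \<in> set w; bar n z \<in> set w; Ncount n w z > z;
         \<forall>z'. z' \<le> n \<and> z' \<in> set w \<and> bar n z' \<in> set w \<and> Ncount n w z' > z' \<longrightarrow> z \<le> z'\<rbrakk>
        \<Longrightarrow> plac_rel n w (filter (\<lambda>x. x \<noteq> z \<and> x \<noteq> bar n z) w)"

definition plactic :: "nat \<Rightarrow> nat list \<Rightarrow> nat list \<Rightarrow> bool" where
  "plactic n = cong_cl (plac_rel n)"

text \<open>Tableau words: w(T) = w(C_r) ... w(C_1) with admissible columns C_1 \<preceq> ... \<preceq> C_r.\<close>
definition is_tabword :: "nat \<Rightarrow> nat list \<Rightarrow> bool" where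
  "is_tabword n t \<longleftrightarrow> (\<exists>cs. t = concat cs \<and> (\<forall>c\<in>set cs. admissible n c) \<and>
      (\<forall>j. Suc j < length cs \<longrightarrow> prec n (cs ! Suc j) (cs ! j)))"

definition tabword :: "nat \<Rightarrow> nat list \<Rightarrow> nat list" where
  "tabword n w = (THE t. is_tabword n t \<and> plactic n t w)"

datatype acol = Eps | Col "nat list"

fun valid_acol :: "nat \<Rightarrow> acol \<Rightarrow> bool" where
  "valid_acol n Eps = True"
| "valid_acol n (Col c) = admissible n c"

definition acol_word :: "nat \<Rightarrow> acol list \<Rightarrow> bool" where
  "acol_word n w \<longleftrightarrow> (\<forall>a\<in>set w. valid_acol n a)"

fun pc :: "acol \<Rightarrow> nat list" where
  "pc Eps = []"
| "pc (Col c) = c"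

definition p :: "acol list \<Rightarrow> nat list" where
  "p w = concat (map pc w)"

fun ext_prec :: "nat \<Rightarrow> acol \<Rightarrow> acol \<Rightarrow> bool" where
  "ext_prec n c Eps = True"
| "ext_prec n Eps (Col c) = False"
| "ext_prec n (Col a) (Col b) = prec n a b"

definition ins_cols :: "nat \<Rightarrow> acol \<Rightarrow> acol \<Rightarrow> acol \<times> acol" where
  "ins_cols n c1 c2 = (let t = tabword n (p [c1, c2]) in
     THE xy. (\<exists>d1 d2. xy = (Col d1, Col d2) \<and> admissible n d1 \<and> admissible n d2 \<and>
                      prec n d2 d1 \<and> t = d1 @ d2)
           \<or> (\<exists>d. xy = (Eps, Col d) \<and> admissible n d \<and> t = d)
           \<or> (xy = (Eps, Eps) \<and> t = []))"

inductive plN_rel :: "nat \<Rightarrow> acol list \<Rightarrow> acol list \<Rightarrow> bool" for n where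
  "\<lbrakk>valid_acol n c1; valid_acol n c2; \<not> ext_prec n c2 c1\<rbrakk>
   \<Longrightarrow> plN_rel n [c1, c2] [fst (ins_cols n c1 c2), snd (ins_cols n c1 c2)]"

definition plN_cong :: "nat \<Rightarrow> acol list \<Rightarrow> acol list \<Rightarrow> bool" where
  "plN_cong n = cong_cl (plN_rel n)"

fun regroup :: "acol list \<Rightarrow> nat list \<Rightarrow> acol list" where
  "regroup [] u = []"
| "regroup (Eps # ws) u = Eps # regroup ws u"
| "regroup (Col c # ws) u = Col (take (length c) u) # regroup ws (drop (length c) u)"

definition fa :: "nat \<Rightarrow> nat \<Rightarrow> acol list \<Rightarrow> acol list option" where
  "fa n i w = map_option (regroup w) (fw n i (p w))"

definition edge :: "nat \<Rightarrow> nat \<Rightarrow> acol list \<Rightarrow> acol list \<Rightarrow> bool" where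
  "edge n i w w' \<longleftrightarrow> 1 \<le> i \<and> i \<le> n \<and> acol_word n w \<and> acol_word n w' \<and> fa n i w = Some w'"

definition adj :: "nat \<Rightarrow> acol list \<Rightarrow> acol list \<Rightarrow> bool" where
  "adj n u v \<longleftrightarrow> (\<exists>i. edge n i u v \<or> edge n i v u)"

definition Bcomp :: "nat \<Rightarrow> acol list \<Rightarrow> acol list set" where
  "Bcomp n w = {v. (adj n)\<^sup>*\<^sup>* w v}"

definition crystal_iso_at :: "nat \<Rightarrow> acol list \<Rightarrow> acol list \<Rightarrow> bool" where
  "crystal_iso_at n w1 w2 \<longleftrightarrow> (\<exists>\<phi>. bij_betw \<phi> (Bcomp n w1) (Bcomp n w2) \<and> \<phi> w1 = w2 \<and>
     (\<forall>u\<in>Bcomp n w1. \<forall>v\<in>Bcomp n w1. \<forall>i. edge n i u v \<longleftrightarrow> edge n i (\<phi> u) (\<phi> v)))"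

definition sim_eps :: "nat \<Rightarrow> acol list \<Rightarrow> acol list \<Rightarrow> bool" where
  "sim_eps n w1 w2 \<longleftrightarrow> acol_word n w1 \<and> acol_word n w2 \<and>
     length w1 = length w2 \<and> crystal_iso_at n w1 w2"

definition eps_cong :: "nat \<Rightarrow> acol list \<Rightarrow> acol list \<Rightarrow> bool" where
  "eps_cong n = cong_cl (sim_eps n)"

end

theory Submission
  imports Defs
begin

text \<open>Crystal operators are compatible with the plactic relations, and a normal form (a tableau
  padded on the left by empty columns) is determined by the isomorphism type of its pointed crystal
  component: raise it to highest weight, where the columns are of the form 1, ..., k and their
  lengths can be read off the weight. A rewriting step replaces a pair of columns by its
  tableau. Raising the pair to highest weight makes both pairs explicit; the tableau is then seen to
  have at most as many letters and a first column that is not longer, and to determine the pair once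
  the column lengths are known. So a rewriting step is an isomorphism of components and rewriting
  terminates. Conversely, words with isomorphic components have normal forms with isomorphic
  components, which are equal if the words have the same length.

  The crystal operators respect the column order because it is equivalent to linear inequalities
  between the letter counts of two columns, and f_i changes these counts only at the index i.\<close>

subsection \<open>Admissibility and the column order in terms of letter counts\<close>

text \<open>The obstacle is that admissibility and the split columns are defined by a greedy choice
  of partners, whose behaviour under the change of one letter is not visible. Scanned downwards from
  \<open>n\<close>, the greedy choice is a queue, and its length at \<open>v\<close> is the maximum
  of \<open>defect n c m - defect n c v\<close> over \<open>v \<le> m \<le> n\<close>. A bound on a
  maximum is one inequality per \<open>m\<close>, and the inequalities altered at the index
  \<open>i\<close> are controlled by their neighbours at \<open>i - 1\<close> and
  \<open>i + 1\<close>.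

  The weight is not part of the graph. It is recovered from the lengths of the
  \<open>i\<close>-strings, \<open>epsw\<close> and \<open>phiw\<close>, which every relation
  respected by all operators preserves. The plactic congruence and the relation given by an
  isomorphism of components are both of this kind, so one uniqueness proof for normal forms serves
  both, and also their composition.

  At highest weight the weight gives the multiplicity of every positive column length. It is blind
  to empty columns; their number comes from the length of the word, which is why words of equal
  length are compared.\<close>

definition cnt :: "nat list \<Rightarrow> nat \<Rightarrow> int" where
  "cnt c v = int (length (filter (\<lambda>x. x \<le> v) c))"

text \<open>The excess of \<open>Ncount n c m\<close> over \<open>m\<close>, as an integer so that
  negative values are kept. The letters counted are those in \<open>1..m\<close> together with those
  above \<open>2 * n - m\<close>, which are \<open>bar m\<close>, ..., \<open>bar 1\<close>.\<close>

definition defect :: "nat \<Rightarrow> nat list \<Rightarrow> nat \<Rightarrow> int" where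
  "defect n c m = cnt c m + int (length c) - cnt c (2 * n - m) - int m"

lemma cnt_simps [simp]: "cnt [] v = 0" "cnt (x # c) v = (if x \<le> v then 1 else 0) + cnt c v"
  "cnt (c @ d) v = cnt c v + cnt d v"
  by (simp_all add: cnt_def)

lemma cnt_card: "distinct c \<Longrightarrow> cnt c v = int (card {x \<in> set c. x \<le> v})"
  by (simp add: cnt_def distinct_length_filter Int_def conj_commute)

lemma columnD: "column n c \<Longrightarrow> distinct c" "column n c \<Longrightarrow> sorted_wrt (<) c"
  "column n c \<Longrightarrow> x \<in> set c \<Longrightarrow> 1 \<le> x \<and> x \<le> 2 * n"
  by (auto simp: column_def letter_def strict_sorted_iff)

lemma cnt_step:
  assumes "sorted_wrt (<) c"
  shows "cnt c (Suc v) = cnt c v + (if Suc v \<in> set c then 1 else 0)"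
  using assms by (induction c) auto

lemma cnt_0: "0 \<notin> set c \<Longrightarrow> cnt c 0 = 0"
  by (induction c) auto

lemma cnt_top: "(\<And>x. x \<in> set c \<Longrightarrow> x \<le> v) \<Longrightarrow> cnt c v = int (length c)"
  by (induction c) auto

lemma cnt_mono: "v \<le> w \<Longrightarrow> cnt c v \<le> cnt c w"
  by (induction c) auto

lemma Ncount_defect:
  assumes "m \<le> n" "\<forall>x\<in>set c. letter n x"
  shows "int (Ncount n c m) = defect n c m + int m"
proof -
  have "int (length (filter (\<lambda>x. x \<le> m \<or> bar n m \<le> x) c))
     = cnt c m + int (length c) - cnt c (2 * n - m)"
    using assms(2) by (induction c) (use assms(1) in \<open>auto simp: bar_def letter_def\<close>)
  then show ?thesis by (simp add: Ncount_def defect_def)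
qed

lemma defect_0: "column n c \<Longrightarrow> defect n c 0 = 0"
proof -
  assume a: "column n c"
  have "0 \<notin> set c" using columnD(3)[OF a, of 0] by auto
  then have "cnt c 0 = 0" by (rule cnt_0)
  moreover have "cnt c (2 * n) = int (length c)" using columnD(3)[OF a] by (intro cnt_top) blast
  ultimately show ?thesis by (simp add: defect_def)
qed

text \<open>The window grows by exactly \<open>v + 1\<close> and \<open>bar (v + 1)\<close>, so the
  defect is a walk with increments -1, 0 and 1. It rises exactly at the pairs and falls exactly at
  the free letters.\<close>

lemma defect_step:
  assumes "column n c" "v < n"
  shows "defect n c (Suc v) = defect n c v
    + (if Suc v \<in> set c then 1 else 0) + (if bar n (Suc v) \<in> set c then 1 else 0) - 1"
proof -
  have "2 * n - v = Suc (2 * n - Suc v)" "bar n (Suc v) = 2 * n - v" using assms(2) by (auto simp: bar_def)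
  then show ?thesis
    using cnt_step[OF columnD(2)[OF assms(1)], of v]
      cnt_step[OF columnD(2)[OF assms(1)], of "2 * n - Suc v"] assms(2)
    by (auto simp: defect_def)
qed

text \<open>A total variant of \<^const>\<open>pickJ\<close>, in which a failed choice is recorded as 0.\<close>

primrec pick :: "nat \<Rightarrow> nat list \<Rightarrow> nat \<Rightarrow> nat list \<Rightarrow> nat list" where
  "pick n c b [] = []"
| "pick n c b (z # zs) =
     (let t = Max (insert 0 {t. 1 \<le> t \<and> t < min b z \<and> t \<notin> set c \<and> bar n t \<notin> set c})
      in t # pick n c t zs)"

text \<open>Genuine choices are at least 1, so the default 0 marks precisely the failures.\<close>

lemma pickJ_pick: "pickJ n c b zs = (if 0 \<in> set (pick n c b zs) then None else Some (pick n c b zs))"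
proof (induction zs arbitrary: b)
  case (Cons z zs)
  let ?S = "{t. 1 \<le> t \<and> t < min b z \<and> t \<notin> set c \<and> bar n t \<notin> set c}"
  have fin: "finite ?S" by (rule finite_subset[of _ "{..<b}"]) auto
  show ?case
  proof (cases "?S = {}")
    case True
    then have "Max (insert 0 ?S) = 0" by (simp only: Max_singleton)
    then show ?thesis using True unfolding pickJ.simps pick.simps Let_def by (simp del: One_nat_def)
  next
    case False
    then have M: "Max (insert 0 ?S) = Max ?S" using fin by simp
    have "Max ?S \<in> ?S" using fin False by (rule Max_in)
    then have "Max ?S \<noteq> 0" by auto
    moreover have "pickJ n c b (z # zs) = map_option (Cons (Max ?S)) (pickJ n c (Max ?S) zs)"
      by (simp only: pickJ.simps Let_def False if_False)
    moreover have "pick n c b (z # zs) = Max ?S # pick n c (Max ?S) zs"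
      by (simp only: pick.simps Let_def M)
    ultimately show ?thesis using Cons.IH[of "Max ?S"] by (simp only:) auto
  qed
qed simp

lemma pick_head:
  assumes "t = Max (insert 0 {t. 1 \<le> t \<and> t < min b z \<and> t \<notin> set c \<and> bar n t \<notin> set c})"
  shows "t = 0 \<or> (1 \<le> t \<and> t < b \<and> t < z \<and> t \<notin> set c \<and> bar n t \<notin> set c)"
    "1 \<le> v \<Longrightarrow> v < b \<Longrightarrow> v < z \<Longrightarrow> v \<notin> set c \<Longrightarrow> bar n v \<notin> set c \<Longrightarrow> v \<le> t"
proof -
  let ?S = "{t. 1 \<le> t \<and> t < min b z \<and> t \<notin> set c \<and> bar n t \<notin> set c}"
  have fin: "finite (insert 0 ?S)" by (rule finite_subset[of _ "insert 0 {..<b}"]) auto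
  have "t \<in> insert 0 ?S" unfolding assms using fin by (rule Max_in) simp
  then show "t = 0 \<or> (1 \<le> t \<and> t < b \<and> t < z \<and> t \<notin> set c \<and> bar n t \<notin> set c)" by auto
  show "v \<le> t" if "1 \<le> v" "v < b" "v < z" "v \<notin> set c" "bar n v \<notin> set c"
    unfolding assms using fin that by (intro Max_ge) auto
qed

lemma length_pk [simp]: "length (pick n c b zs) = length zs"
  by (induction zs arbitrary: b) (auto simp: Let_def)

lemma pick_Cons: obtains t where "pick n c b (z # zs) = t # pick n c t zs"
  "t = 0 \<or> (1 \<le> t \<and> t < b \<and> t < z \<and> t \<notin> set c \<and> bar n t \<notin> set c)"
  "\<And>v. 1 \<le> v \<Longrightarrow> v < b \<Longrightarrow> v < z \<Longrightarrow> v \<notin> set c \<Longrightarrow> bar n v \<notin> set c \<Longrightarrow> v \<le> t"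
proof -
  define t where "t = Max (insert 0 {t. 1 \<le> t \<and> t < min b z \<and> t \<notin> set c \<and> bar n t \<notin> set c})"
  show ?thesis
    by (rule that[of t]) (use pick_head[OF t_def] in \<open>auto simp: t_def Let_def\<close>)
qed

lemma pick_less:
  "\<forall>z\<in>set zs. 1 \<le> z \<Longrightarrow> (z, t) \<in> set (zip zs (pick n c b zs)) \<Longrightarrow> t < z"
proof (induction zs arbitrary: b)
  case (Cons z' zs)
  obtain t' where "pick n c b (z' # zs) = t' # pick n c t' zs"
    "t' = 0 \<or> (1 \<le> t' \<and> t' < b \<and> t' < z' \<and> t' \<notin> set c \<and> bar n t' \<notin> set c)" by (rule pick_Cons)
  with Cons show ?case by auto
qed simp

lemma pick_empty: "t \<in> set (pick n c b zs) \<Longrightarrow> t = 0 \<or> (1 \<le> t \<and> t < b \<and> t \<notin> set c \<and> bar n t \<notin> set c)"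
proof (induction zs arbitrary: b)
  case (Cons z' zs)
  obtain t' where "pick n c b (z' # zs) = t' # pick n c t' zs"
    "t' = 0 \<or> (1 \<le> t' \<and> t' < b \<and> t' < z' \<and> t' \<notin> set c \<and> bar n t' \<notin> set c)" by (rule pick_Cons)
  with Cons.prems Cons.IH[of t'] show ?case by auto
qed simp

text \<open>Every choice is a strict upper bound for the later ones as long as it is positive; only
  the marker 0 can repeat.\<close>

lemma pick_count: "v \<ge> 1 \<Longrightarrow> count_list (pick n c b zs) v = (if v \<in> set (pick n c b zs) then 1 else 0)"
proof (induction zs arbitrary: b)
  case (Cons z' zs)
  obtain t' where t': "pick n c b (z' # zs) = t' # pick n c t' zs" by (rule pick_Cons)
  have "v \<notin> set (pick n c v zs)" using pick_empty[of v n c v zs] Cons.prems by auto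
  then show ?case using t' Cons by auto
qed simp

text \<open>Greediness. All pairs up to \<open>z\<close> exceed \<open>v\<close>, so the choices
  made for them cannot skip the free letter \<open>v\<close>: they stay above it until one of them
  equals \<open>v\<close>.\<close>

lemma pick_maximal:
  assumes "sorted_wrt (>) zs" "1 \<le> v" "v < b" "v \<notin> set c" "bar n v \<notin> set c"
    "(z, t) \<in> set (zip zs (pick n c b zs))" "t \<le> v" "v < z"
  shows "v \<in> set (pick n c b zs)"
  using assms
proof (induction zs arbitrary: b)
  case (Cons z' zs)
  obtain t' where t': "pick n c b (z' # zs) = t' # pick n c t' zs"
    "\<And>v. 1 \<le> v \<Longrightarrow> v < b \<Longrightarrow> v < z' \<Longrightarrow> v \<notin> set c \<Longrightarrow> bar n v \<notin> set c \<Longrightarrow> v \<le> t'" by (rule pick_Cons) blast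
  have "z \<in> set (z' # zs)" using Cons.prems(6) by (auto dest: set_zip_leftD)
  then have "z \<le> z'" using Cons.prems(1) by auto
  then have "v \<le> t'" using t'(2)[of v] Cons.prems by auto
  show ?case
  proof (cases "v = t'")
    case False
    then have "v < t'" using \<open>v \<le> t'\<close> by simp
    then have "(z, t) \<in> set (zip zs (pick n c t' zs))" using Cons.prems(6,7) t'(1) by auto
    with Cons.IH[of t'] Cons.prems \<open>v < t'\<close> t'(1) show ?thesis by auto
  qed (use t' in simp)
qed simp

section \<open>The queue of pairs waiting for a partner\<close>

definition pend :: "nat list \<Rightarrow> nat list \<Rightarrow> nat \<Rightarrow> int" where
  "pend zs ts v = int (length (filter (\<lambda>(z, t). t \<le> v \<and> v < z) (zip zs ts)))"

lemma pend_step: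
  assumes "length zs = length ts" "\<forall>(z, t)\<in>set (zip zs ts). t < z"
  shows "pend zs ts v = pend zs ts (Suc v) + int (count_list zs (Suc v)) - int (count_list ts (Suc v))"
  using assms by (induction zs ts rule: list_induct2) (auto simp: pend_def)

lemma pairs_props: "set (pairs n c) = {z. 1 \<le> z \<and> z \<le> n \<and> z \<in> set c \<and> bar n z \<in> set c}"
  "sorted_wrt (>) (pairs n c)" "distinct (pairs n c)"
  unfolding pairs_def by (auto simp: sorted_wrt_rev simp del: upt_Suc intro!: sorted_wrt_filter)

lemma count_list_distinct: "distinct xs \<Longrightarrow> count_list xs x = (if x \<in> set xs then 1 else 0)"
  by (induction xs) auto

abbreviation "picked n c \<equiv> pick n c (Suc n) (pairs n c)"

abbreviation "queue n c \<equiv> pend (pairs n c) (picked n c)"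

lemma pairs_less: "(z, t) \<in> set (zip (pairs n c) (picked n c)) \<Longrightarrow> t < z"
  by (rule pick_less) (auto simp: pairs_props)

text \<open>Read from n downwards, the pairs waiting for a partner form a queue with reflection at 0,
  so its length is a running maximum of the defect.\<close>

lemma queue_step:
  assumes "column n c" "v < n"
  shows "queue n c v = max 0 (queue n c (Suc v) + (defect n c (Suc v) - defect n c v))"
proof -
  have q0: "queue n c (Suc v) \<ge> 0" by (simp add: pend_def)
  have less: "\<forall>(z, t)\<in>set (zip (pairs n c) (picked n c)). t < z" using pairs_less[of _ _ n c] by auto
  have st: "queue n c v = queue n c (Suc v) + (if Suc v \<in> set (pairs n c) then 1 else 0)
      - (if Suc v \<in> set (picked n c) then 1 else 0)"
    using pend_step[of "pairs n c" "picked n c" v, OF length_pk[symmetric] less]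
      pick_count[of "Suc v" n c "Suc n" "pairs n c"]
      count_list_distinct[OF pairs_props(3), of n c "Suc v"] by auto
  show ?thesis
  proof (cases "Suc v \<in> set c \<or> bar n (Suc v) \<in> set c")
    case True
    then have "Suc v \<notin> set (picked n c)" using pick_empty[of "Suc v"] by blast
    with st defect_step[OF assms] True q0 assms(2) show ?thesis by (auto simp: pairs_props)
  next
    case False
    then have np: "Suc v \<notin> set (pairs n c)" by (auto simp: pairs_props)
    show ?thesis
    \<comment> \<open>Here \<open>v + 1\<close> is free and the increment is -1. With nobody waiting
      the queue stays empty, which is the reflection at 0; otherwise greediness makes
      \<open>v + 1\<close> a chosen partner and the queue shrinks by one.\<close>
    proof (cases "queue n c (Suc v) = 0")
      case True
      then show ?thesis using st defect_step[OF assms] False np by (auto simp: pend_def)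
    next
      case nz: False
      then have "filter (\<lambda>(z, t). t \<le> Suc v \<and> Suc v < z) (zip (pairs n c) (picked n c)) \<noteq> []"
        by (auto simp: pend_def simp del: filter_empty_conv)
      then obtain z t where "(z, t) \<in> set (zip (pairs n c) (picked n c))" "t \<le> Suc v" "Suc v < z"
        by (auto simp: filter_empty_conv)
      then have "Suc v \<in> set (picked n c)"
        using pick_maximal[OF pairs_props(2), of "Suc v" "Suc n" c n z t] False assms(2) by auto
      then show ?thesis using st defect_step[OF assms] False np nz q0 by auto
    qed
  qed
qed

text \<open>The running maximum is stated as an attained upper bound. Comparing it with a number
  then gives one inequality for each \<open>m\<close>.\<close>

lemma queue_defect:
  assumes "column n c" "v \<le> n"
  shows "(\<forall>m. v \<le> m \<and> m \<le> n \<longrightarrow> defect n c m - defect n c v \<le> queue n c v)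
    \<and> (\<exists>m. v \<le> m \<and> m \<le> n \<and> queue n c v = defect n c m - defect n c v)"
  using assms(2)
proof (induction rule: inc_induct)
  case base
  have "queue n c n = 0" using pairs_props(1)[of n c]
    by (auto simp: pend_def filter_empty_conv dest: set_zip_leftD)
  then show ?case by auto
next
  case (step v)
  note qs = queue_step[OF assms(1) step.hyps(2)]
  show ?case
  proof (intro conjI allI impI)
    fix m assume m: "v \<le> m \<and> m \<le> n"
    show "defect n c m - defect n c v \<le> queue n c v"
    proof (cases "m = v")
      case False
      then have "defect n c m - defect n c (Suc v) \<le> queue n c (Suc v)" using step.IH m by simp
      then show ?thesis using qs by linarith
    qed (use qs in simp)
  next
    obtain m where m: "Suc v \<le> m" "m \<le> n" "queue n c (Suc v) = defect n c m - defect n c (Suc v)"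
      using step.IH by blast
    show "\<exists>m\<ge>v. m \<le> n \<and> queue n c v = defect n c m - defect n c v"
    proof (cases "queue n c v = 0")
      case True
      then show ?thesis using step.hyps by (intro exI[of _ v]) auto
    next
      case False
      then show ?thesis using qs m by (intro exI[of _ m]) auto
    qed
  qed
qed

lemma Jset_picked: "Jset n c = (if 0 \<in> set (picked n c) then None else Some (picked n c))"
  by (simp add: Jset_def pickJ_pick)

text \<open>At 0 every pair has been passed, and the ones still waiting are those whose partner is
  the marker 0.\<close>

lemma queue_0: "queue n c 0 = 0 \<longleftrightarrow> 0 \<notin> set (picked n c)"
proof
  assume q: "queue n c 0 = 0"
  show "0 \<notin> set (picked n c)"
  proof
    assume "0 \<in> set (picked n c)"
    then obtain z where "(z, 0) \<in> set (zip (pairs n c) (picked n c))"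
      by (metis in_set_impl_in_set_zip2 length_pk)
    moreover from this have "0 < z" by (rule pairs_less)
    ultimately show False using q by (auto simp: pend_def filter_empty_conv)
  qed
next
  assume "0 \<notin> set (picked n c)"
  then show "queue n c 0 = 0" by (auto simp: pend_def filter_empty_conv dest: set_zip_rightD)
qed

text \<open>The queue at 0 is the maximum of all defects, because the defect at 0 vanishes. This is
  the counting criterion for admissibility, required at every index and not merely at the
  pairs.\<close>

lemma admissible_defect:
  "admissible n c \<longleftrightarrow> column n c \<and> (\<forall>m\<le>n. defect n c m \<le> 0)"
proof (cases "column n c")
  case True
  have "queue n c 0 \<ge> 0" by (simp add: pend_def)
  then have "queue n c 0 = 0 \<longleftrightarrow> (\<forall>m\<le>n. defect n c m \<le> 0)"
    using queue_defect[OF True, of 0] defect_0[OF True] by auto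
  then show ?thesis using True by (auto simp: admissible_def Jset_picked queue_0)
qed (simp add: admissible_def)

section \<open>Counting functions of the split columns\<close>

lemma length_filter_sort: "length (filter P (sort xs)) = length (filter P (xs :: nat list))"
  by (simp add: filter_sort)

lemma card_pend:
  "int (card {z. \<exists>t. (z, t) \<in> set (zip (pairs n c) (picked n c)) \<and> t \<le> v \<and> v < z}) = queue n c v"
proof -
  let ?F = "filter (\<lambda>(z, t). t \<le> v \<and> v < z) (zip (pairs n c) (picked n c))"
  have "distinct (map fst (zip (pairs n c) (picked n c)))" using pairs_props(3) by (simp add: map_fst_zip)
  then have "distinct (map fst ?F)" by (rule distinct_map_filter)
  then have "card (set (map fst ?F)) = length ?F" by (metis distinct_card length_map)
  moreover have "set (map fst ?F) = {z. \<exists>t. (z, t) \<in> set (zip (pairs n c) (picked n c)) \<and> t \<le> v \<and> v < z}"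
    by force
  ultimately show ?thesis by (simp add: pend_def)
qed

text \<open>Replacing \<open>z\<close> by \<open>t\<close> carries a letter down across the
  threshold \<open>v\<close> exactly if \<open>t \<le> v < z\<close>, that is, while the pair is in
  the queue. Only letters up to \<open>n\<close> move, so thresholds from \<open>n\<close> on see no
  change.\<close>

lemma cnt_lcol:
  assumes "admissible n c"
  shows "v \<le> n \<Longrightarrow> cnt (lcol n c) v = cnt c v + queue n c v"
    and "n \<le> v \<Longrightarrow> cnt (lcol n c) v = cnt c v"
proof -
  have col: "column n c" using assms by (simp add: admissible_def)
  have J: "the (Jset n c) = picked n c" using assms by (auto simp: admissible_def Jset_picked split: if_splits)
  let ?Z = "zip (pairs n c) (picked n c)"
  define g where "g x = (case map_of ?Z x of Some t \<Rightarrow> t | None \<Rightarrow> x)" for x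
  have d: "distinct (map fst ?Z)" using pairs_props(3) by (simp add: map_fst_zip)
  have g1: "g x = t" if "(x, t) \<in> set ?Z" for x t
    using that d by (simp add: g_def)
  have g2: "g x = x" if "x \<notin> set (pairs n c)" for x
    using that by (auto simp: g_def split: option.splits dest!: map_of_SomeD set_zip_leftD)
  have ex: "\<exists>t. (x, t) \<in> set ?Z" if "x \<in> set (pairs n c)" for x
    using that by (metis in_set_impl_in_set_zip1 length_pk)
  have cl: "cnt (lcol n c) v = int (card {x \<in> set c. g x \<le> v})" for v
    unfolding lcol_def J cnt_def length_filter_sort
    using columnD(1)[OF col]
    by (simp add: filter_map o_def g_def[symmetric] distinct_length_filter Int_def conj_commute)
  show "cnt (lcol n c) v = cnt c v + queue n c v" if "v \<le> n"
  proof -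
    let ?B = "{z. \<exists>t. (z, t) \<in> set ?Z \<and> t \<le> v \<and> v < z}"
    have "{x \<in> set c. g x \<le> v} = {x \<in> set c. x \<le> v} \<union> ?B" (is "?L = ?R")
    proof (intro set_eqI iffI)
      fix x assume x: "x \<in> ?L"
      show "x \<in> ?R"
      proof (cases "x \<in> set (pairs n c)")
        case True
        then obtain t where "(x, t) \<in> set ?Z" using ex by blast
        with g1[OF this] x show ?thesis by auto
      qed (use x g2 in auto)
    next
      fix x assume x: "x \<in> ?R"
      show "x \<in> ?L"
      proof (cases "x \<in> set (pairs n c)")
        case True
        then obtain t where t: "(x, t) \<in> set ?Z" using ex by blast
        from x t g1 g1[OF t] pairs_less[OF t] True show ?thesis by (auto simp: pairs_props)
      qed (use x g2 in \<open>auto dest: set_zip_leftD\<close>)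
    qed
    moreover have "finite ?B" by (rule finite_subset[of _ "set (pairs n c)"]) (auto dest: set_zip_leftD)
    ultimately have "card {x \<in> set c. g x \<le> v} = card {x \<in> set c. x \<le> v} + card ?B"
      by (simp add: card_Un_disjoint disjoint_iff)
    then show ?thesis using cl card_pend[of n c v] cnt_card[OF columnD(1)[OF col], of v] by simp
  qed
  show "cnt (lcol n c) v = cnt c v" if "n \<le> v"
  proof -
    have "g x \<le> v \<longleftrightarrow> x \<le> v" if "x \<in> set c" for x
    proof (cases "x \<in> set (pairs n c)")
      case True
      then obtain t where t: "(x, t) \<in> set ?Z" using ex by blast
      then show ?thesis using g1[OF t] pairs_less[OF t] True \<open>n \<le> v\<close> by (auto simp: pairs_props)
    qed (use g2 in auto)
    then have "{x \<in> set c. g x \<le> v} = {x \<in> set c. x \<le> v}" by auto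
    then show ?thesis using cl cnt_card[OF columnD(1)[OF col], of v] by simp
  qed
qed

text \<open>The mirror image: \<open>bar z\<close> is replaced by the larger letter
  \<open>bar t\<close>, and the threshold \<open>2 * n - v\<close> is crossed under the same
  condition \<open>t \<le> v < z\<close>. Hence the same queue length appears, with the opposite
  sign.\<close>

lemma cnt_rcol:
  assumes "admissible n c"
  shows "v \<le> n \<Longrightarrow> cnt (rcol n c) (2 * n - v) = cnt c (2 * n - v) - queue n c v"
    and "v \<le> n \<Longrightarrow> cnt (rcol n c) v = cnt c v"
proof -
  have col: "column n c" using assms by (simp add: admissible_def)
  have J: "the (Jset n c) = picked n c" and J0: "0 \<notin> set (picked n c)"
    using assms by (auto simp: admissible_def Jset_picked split: if_splits)
  let ?Z = "zip (pairs n c) (picked n c)"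
  let ?Y = "zip (map (bar n) (pairs n c)) (map (bar n) (picked n c))"
  have Y: "?Y = map (\<lambda>(z, t). (bar n z, bar n t)) ?Z"
    by (simp add: zip_map_map)
  define g where "g x = (case map_of ?Y x of Some t \<Rightarrow> t | None \<Rightarrow> x)" for x
  have "inj_on (bar n) (set (pairs n c))" by (auto simp: inj_on_def bar_def pairs_props)
  then have "distinct (map (bar n) (pairs n c))" using pairs_props(3) by (simp add: distinct_map)
  then have d: "distinct (map fst ?Y)" by simp
  have g1: "g (bar n z) = bar n t" if "(z, t) \<in> set ?Z" for z t
  proof -
    have "(bar n z, bar n t) \<in> set ?Y" using that unfolding Y by force
    then show ?thesis using d by (simp add: g_def)
  qed
  have g2: "g x = x" if "x \<notin> bar n ` set (pairs n c)" for x
    using that by (auto simp: g_def split: option.splits dest!: map_of_SomeD set_zip_leftD)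
  have ex: "\<exists>t. (x, t) \<in> set ?Z" if "x \<in> set (pairs n c)" for x
    using that by (metis in_set_impl_in_set_zip1 length_pk)
  have Zb: "1 \<le> t \<and> t < z \<and> z \<le> n" if "(z, t) \<in> set ?Z" for z t
  proof -
    have "t \<in> set (picked n c)" using that by (rule set_zip_rightD)
    then have "t \<noteq> 0" using J0 by metis
    moreover have "z \<in> set (pairs n c)" using that by (rule set_zip_leftD)
    ultimately show ?thesis using pairs_less[OF that] by (auto simp: pairs_props)
  qed
  have cl: "cnt (rcol n c) v = int (card {x \<in> set c. g x \<le> v})" for v
    unfolding rcol_def J cnt_def length_filter_sort
    using columnD(1)[OF col]
    by (simp add: filter_map o_def g_def[symmetric] distinct_length_filter Int_def conj_commute)
  show "cnt (rcol n c) (2 * n - v) = cnt c (2 * n - v) - queue n c v" if "v \<le> n"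
  proof -
    let ?B = "{z. \<exists>t. (z, t) \<in> set ?Z \<and> t \<le> v \<and> v < z}"
    let ?v = "2 * n - v"
    have "{x \<in> set c. x \<le> ?v} = {x \<in> set c. g x \<le> ?v} \<union> bar n ` ?B" (is "?L = ?R")
    proof (intro set_eqI iffI)
      fix x assume x: "x \<in> ?L"
      show "x \<in> ?R"
      proof (cases "x \<in> bar n ` set (pairs n c)")
        case True
        then obtain z t where t: "x = bar n z" "(z, t) \<in> set ?Z" using ex by blast
        show ?thesis
        proof (cases "t \<le> v")
          case True
          then have "z \<in> ?B" using t x Zb[OF t(2)] by (auto simp: bar_def)
          then show ?thesis using t(1) by blast
        next
          case False
          then have "bar n t \<le> ?v" using Zb[OF t(2)] by (auto simp: bar_def)
          then show ?thesis using g1[OF t(2)] x t by auto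
        qed
      qed (use x g2 in auto)
    next
      fix x assume x: "x \<in> ?R"
      show "x \<in> ?L"
      proof (cases "x \<in> bar n ` set (pairs n c)")
        case True
        then obtain z t where t: "x = bar n z" "(z, t) \<in> set ?Z" using ex by blast
        have xc: "x \<in> set c" using True by (auto simp: pairs_props)
        have "x \<le> ?v" 
        proof (cases "x \<in> bar n ` ?B")
          case True
          then show ?thesis by (auto simp: bar_def)
        next
          case False
          then have "g x \<le> ?v" using x by auto
          then show ?thesis using g1[OF t(2)] t Zb[OF t(2)] by (auto simp: bar_def)
        qed
        then show ?thesis using xc by auto
      next
        case False
        then have "x \<notin> bar n ` ?B" by (auto dest: set_zip_leftD)
        then show ?thesis using x g2[OF False] by auto
      qed
    qed
    moreover have fB: "finite ?B" by (rule finite_subset[of _ "set (pairs n c)"]) (auto dest: set_zip_leftD)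
    moreover have "{x \<in> set c. g x \<le> ?v} \<inter> bar n ` ?B = {}"
      using g1 Zb by (fastforce simp: bar_def)
    ultimately have "card {x \<in> set c. x \<le> ?v} = card {x \<in> set c. g x \<le> ?v} + card (bar n ` ?B)"
      by (simp add: card_Un_disjoint)
    moreover have "card (bar n ` ?B) = card ?B"
      by (rule card_image) (auto simp: inj_on_def bar_def dest!: Zb)
    ultimately show ?thesis using cl card_pend[of n c v] cnt_card[OF columnD(1)[OF col], of ?v] by simp
  qed
  show "cnt (rcol n c) v = cnt c v" if "v \<le> n"
  proof -
    have "g x \<le> v \<longleftrightarrow> x \<le> v" if "x \<in> set c" for x
    proof (cases "x \<in> bar n ` set (pairs n c)")
      case True
      then obtain z t where t: "x = bar n z" "(z, t) \<in> set ?Z" using ex by blast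
      then show ?thesis using g1[OF t(2)] Zb[OF t(2)] \<open>v \<le> n\<close> by (auto simp: bar_def)
    qed (use g2 in auto)
    then have "{x \<in> set c. g x \<le> v} = {x \<in> set c. x \<le> v}" by auto
    then show ?thesis using cl cnt_card[OF columnD(1)[OF col], of v] by simp
  qed
qed

section \<open>The column order as a family of inequalities\<close>

lemma sorted_nth_le_iff:
  assumes "sorted xs"
  shows "int k < cnt xs v \<longleftrightarrow> k < length xs \<and> xs ! k \<le> v"
  using assms
proof (induction xs arbitrary: k)
  case (Cons x xs)
  show ?case
  proof (cases k)
    case 0
    have "cnt xs v \<ge> 0" by (simp add: cnt_def)
    moreover have "cnt xs v = 0" if "\<not> x \<le> v"
      using that Cons.prems by (force simp: cnt_def filter_empty_conv)
    ultimately show ?thesis using 0 by auto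
  next
    case (Suc j)
    show ?thesis
    proof (cases "x \<le> v")
      case False
      then have "cnt xs v = 0" using Cons.prems by (force simp: cnt_def filter_empty_conv)
      moreover have "\<not> (x # xs) ! k \<le> v" if "k < length (x # xs)"
        using False Cons.prems that Suc by (auto simp: not_le dest!: nth_mem)
      ultimately show ?thesis using False by auto
    qed (use Cons Suc in auto)
  qed
qed simp

text \<open>Trades entries for counts, since the split columns are known only through their counting
  functions.\<close>

lemma pointwise_iff_cnt:
  assumes "sorted xs" "sorted ys" "length ys \<le> length xs"
  shows "(\<forall>k<length ys. xs ! k \<le> ys ! k) \<longleftrightarrow> (\<forall>v. cnt ys v \<le> cnt xs v)"
proof
  assume a: "\<forall>k<length ys. xs ! k \<le> ys ! k"
  show "\<forall>v. cnt ys v \<le> cnt xs v"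
  proof (rule allI, rule ccontr)
    fix v assume "\<not> cnt ys v \<le> cnt xs v"
    then have lt: "cnt xs v < cnt ys v" by simp
    define k where "k = nat (cnt xs v)"
    have k: "int k = cnt xs v" by (simp add: k_def cnt_def)
    have "k < length ys" "ys ! k \<le> v" using sorted_nth_le_iff[OF assms(2), of k v] k lt by auto
    then have "int k < cnt xs v" using sorted_nth_le_iff[OF assms(1), of k v] a assms(3) by auto
    then show False using k by simp
  qed
next
  assume a: "\<forall>v. cnt ys v \<le> cnt xs v"
  show "\<forall>k<length ys. xs ! k \<le> ys ! k"
  proof (intro allI impI)
    fix k assume "k < length ys"
    then have "int k < cnt ys (ys ! k)" using sorted_nth_le_iff[OF assms(2), of k "ys ! k"] by simp
    then have "int k < cnt xs (ys ! k)" using a by (meson less_le_trans)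
    then show "xs ! k \<le> ys ! k" using sorted_nth_le_iff[OF assms(1), of k] by auto
  qed
qed

text \<open>At a threshold \<open>v \<le> n\<close> the comparison of counts involves the queue of
  \<open>a\<close>, at \<open>2 * n - v\<close> the queue of \<open>b\<close>. Written as maxima,
  both give inequalities with the same right-hand side up to the difference of the lengths. The
  condition on the lengths is the second inequality at \<open>v = m = 0\<close>.\<close>

lemma prec_defect:
  assumes "admissible n b" "admissible n a"
  shows "prec n b a \<longleftrightarrow> (\<forall>v m. v \<le> m \<and> m \<le> n \<longrightarrow>
     defect n a m \<le> cnt b v + int (length a) - cnt a (2 * n - v) - int v \<and>
     defect n b m \<le> cnt b v + int (length b) - cnt a (2 * n - v) - int v)" (is "_ = ?R")
proof -
  have ca: "column n a" and cb: "column n b" using assms by (auto simp: admissible_def)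
  have lens: "length (lcol n a) = length a" "length (rcol n b) = length b"
    by (simp_all add: lcol_def rcol_def)
  have qa: "queue n a v \<le> x \<longleftrightarrow> (\<forall>m. v \<le> m \<and> m \<le> n \<longrightarrow> defect n a m - defect n a v \<le> x)" if "v \<le> n" for v x
    using queue_defect[OF ca that] by fastforce
  have qb: "queue n b v \<le> x \<longleftrightarrow> (\<forall>m. v \<le> m \<and> m \<le> n \<longrightarrow> defect n b m - defect n b v \<le> x)" if "v \<le> n" for v x
    using queue_defect[OF cb that] by fastforce
  have tops: "cnt a (2 * n) = int (length a)" "cnt b (2 * n) = int (length b)"
    using columnD(3)[OF ca] columnD(3)[OF cb] by (auto intro!: cnt_top)
  have b0: "cnt b 0 = 0" using columnD(3)[OF cb, of 0] by (intro cnt_0) auto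
  have low: "cnt (lcol n a) v \<le> cnt (rcol n b) v \<longleftrightarrow> (\<forall>m. v \<le> m \<and> m \<le> n \<longrightarrow>
     defect n a m \<le> cnt b v + int (length a) - cnt a (2 * n - v) - int v)" if "v \<le> n" for v
  proof -
    have "cnt (lcol n a) v \<le> cnt (rcol n b) v \<longleftrightarrow> queue n a v \<le> cnt b v - cnt a v"
      using cnt_lcol(1)[OF assms(2) that] cnt_rcol(2)[OF assms(1) that] by auto
    moreover have "defect n a m - defect n a v \<le> cnt b v - cnt a v \<longleftrightarrow>
        defect n a m \<le> cnt b v + int (length a) - cnt a (2 * n - v) - int v" for m
      using defect_def[of n a v] by linarith
    ultimately show ?thesis unfolding qa[OF that] by simp
  qed
  have high: "cnt (lcol n a) (2 * n - v) \<le> cnt (rcol n b) (2 * n - v) \<longleftrightarrow> (\<forall>m. v \<le> m \<and> m \<le> n \<longrightarrow>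
     defect n b m \<le> cnt b v + int (length b) - cnt a (2 * n - v) - int v)" if "v \<le> n" for v
  proof -
    have "cnt (lcol n a) (2 * n - v) \<le> cnt (rcol n b) (2 * n - v) \<longleftrightarrow>
        queue n b v \<le> cnt b (2 * n - v) - cnt a (2 * n - v)"
      using cnt_lcol(2)[OF assms(2), of "2 * n - v"] cnt_rcol(1)[OF assms(1) that] that by auto
    moreover have "defect n b m - defect n b v \<le> cnt b (2 * n - v) - cnt a (2 * n - v) \<longleftrightarrow>
        defect n b m \<le> cnt b v + int (length b) - cnt a (2 * n - v) - int v" for m
      using defect_def[of n b v] by linarith
    ultimately show ?thesis unfolding qb[OF that] by simp
  qed
  show ?thesis
  proof
    assume p: "prec n b a"
    then have "\<forall>v. cnt (lcol n a) v \<le> cnt (rcol n b) v"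
      using pointwise_iff_cnt[of "rcol n b" "lcol n a"] lens
      by (auto simp: prec_def lcol_def rcol_def)
    then show ?R using low high by (meson order_trans)
  next
    assume r: ?R
    have len: "length a \<le> length b"
      using r[rule_format, of 0 0] defect_0[OF cb] tops b0 by simp
    have "cnt (lcol n a) v \<le> cnt (rcol n b) v" for v
    proof -
      consider "v \<le> n" | "n < v" "v \<le> 2 * n" | "2 * n < v" by linarith
      then show ?thesis
      proof cases
        case 1
        then show ?thesis using low r by blast
      next
        case 2
        then have v: "2 * n - (2 * n - v) = v" "2 * n - v \<le> n" by auto
        from r have "\<forall>m. 2 * n - v \<le> m \<and> m \<le> n \<longrightarrow> defect n b m
          \<le> cnt b (2 * n - v) + int (length b) - cnt a (2 * n - (2 * n - v)) - int (2 * n - v)" by blast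
        then show ?thesis using high[OF v(2)] unfolding v(1) by blast
      next
        case 3
        have "cnt (lcol n a) v = cnt a v" using 3 cnt_lcol(2)[OF assms(2), of v] by simp
        also have "\<dots> = int (length a)" using columnD(3)[OF ca] 3 by (intro cnt_top) force
        finally have A: "cnt (lcol n a) v = int (length a)" .
        have "int (length b) = cnt (rcol n b) (2 * n)"
          using cnt_rcol(1)[OF assms(1), of 0] tops queue_0[of n b] assms(1)
          by (auto simp: admissible_def Jset_picked split: if_splits)
        also have "\<dots> \<le> cnt (rcol n b) v" using 3 by (intro cnt_mono) simp
        finally show ?thesis using A len by simp
      qed
    qed
    then show "prec n b a"
      using pointwise_iff_cnt[of "rcol n b" "lcol n a"] lens assms len
      by (auto simp: prec_def lcol_def rcol_def)
  qed
qed

subsection \<open>The tensor product rule\<close>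

text \<open>In contrast to \<open>fw\<close>, equality of \<open>phil\<close> and
  \<open>epsw\<close> sends the operator to the left factor.\<close>

fun ew :: "nat \<Rightarrow> nat \<Rightarrow> nat list \<Rightarrow> nat list option" where
  "ew n i [] = None"
| "ew n i (x # v) =
     (if phil n i x \<ge> epsw n i v \<and> epsl n i x > 0 then map_option (\<lambda>y. y # v) (el n i x)
      else if phil n i x \<ge> epsw n i v then None
      else map_option (Cons x) (ew n i v))"

text \<open>The pairing of the weight with the \<open>i\<close>-th simple coroot. Unlike
  \<open>epsw\<close> and \<open>phiw\<close> it is additive under concatenation.\<close>

definition net :: "nat \<Rightarrow> nat \<Rightarrow> nat list \<Rightarrow> int" where
  "net n i w = (\<Sum>x\<leftarrow>w. phil n i x - epsl n i x)"

lemma net_simps [simp]: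
  "net n i [] = 0" "net n i (x # v) = phil n i x - epsl n i x + net n i v"
  "net n i (u @ v) = net n i u + net n i v"
  by (simp_all add: net_def)

lemma phil_cases: "phil n i x = 0 \<or> phil n i x = 1"
  and epsl_cases: "epsl n i x = 0 \<or> epsl n i x = 1"
  and phil_epsl: "phil n i x = 0 \<or> epsl n i x = 0"
  unfolding phil_def epsl_def fl_def el_def by (auto split: if_splits) 

lemma epsw_nonneg: "epsw n i w \<ge> 0"
proof (cases w)
  case (Cons x v)
  then show ?thesis using epsl_cases[of n i x] by auto
qed simp

lemma phiw_nonneg: "phiw n i w \<ge> 0"
  by (induction w) auto

lemma phiw_epsw: "phiw n i w = epsw n i w + net n i w"
  by (induction w) auto

lemma epsw_append:
  "epsw n i (u @ v) = max (epsw n i u) (epsw n i v - net n i u)"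
proof (induction u)
  case Nil show ?case using epsw_nonneg[of n i v] by simp
next
  case (Cons x u) then show ?case by auto
qed

lemma phiw_append:
  "phiw n i (u @ v) = max (phiw n i v) (phiw n i u + net n i v)"
  using phiw_epsw[of n i "u @ v"] phiw_epsw[of n i v] phiw_epsw[of n i u] by (auto simp: epsw_append)

lemma fl_None_iff: "fl n i x = None \<longleftrightarrow> phil n i x = 0"
  by (simp add: phil_def)

lemma el_None_iff: "el n i x = None \<longleftrightarrow> epsl n i x = 0"
  by (simp add: epsl_def)

lemma fw_None_iff: "fw n i w = None \<longleftrightarrow> phiw n i w = 0"
proof (induction w)
  case (Cons x v)
  show ?case
    using Cons phil_cases[of n i x] epsw_nonneg[of n i v] phiw_nonneg[of n i v]
    by (auto simp: fl_None_iff)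
qed simp

lemma ew_None_iff: "ew n i w = None \<longleftrightarrow> epsw n i w = 0"
proof (induction w)
  case (Cons x v)
  show ?case
    using Cons phil_cases[of n i x] epsl_cases[of n i x] epsw_nonneg[of n i v]
    by (auto simp: el_None_iff)
qed simp

text \<open>Associativity of the tensor product: the rule, given for splitting off one letter, holds
  for every splitting.\<close>

lemma fw_append:
  "fw n i (u @ v) = (if phiw n i u > epsw n i v then map_option (\<lambda>u'. u' @ v) (fw n i u)
                     else map_option (\<lambda>v'. u @ v') (fw n i v))"
proof (induction u)
  case Nil
  show ?case using epsw_nonneg[of n i v] by (cases "fw n i v") auto
next
  case (Cons x u)
  show ?case
    using Cons phil_cases[of n i x] epsw_nonneg[of n i v] epsw_nonneg[of n i u] phiw_epsw[of n i u]
      phiw_nonneg[of n i u]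
    by (auto simp: epsw_append option.map_comp o_def)
qed

lemma ew_append:
  "ew n i (u @ v) = (if phiw n i u \<ge> epsw n i v then map_option (\<lambda>u'. u' @ v) (ew n i u)
                     else map_option (\<lambda>v'. u @ v') (ew n i v))"
proof (induction u)
  case Nil
  show ?case using epsw_nonneg[of n i v] ew_None_iff[of n i v]
    by (cases "ew n i v") auto
next
  case (Cons x u)
  show ?case
    using Cons phil_cases[of n i x] epsl_cases[of n i x] phil_epsl[of n i x]
      epsw_nonneg[of n i v] epsw_nonneg[of n i u] phiw_epsw[of n i u] phiw_nonneg[of n i u]
    by (auto simp: epsw_append option.map_comp o_def)
qed

lemma fl_el: "fl n i x = Some y \<longleftrightarrow> el n i y = Some x"
  unfolding fl_def el_def by (auto split: if_splits)

lemma fl_Some: "fl n i x = Some y \<Longrightarrow> y = Suc x \<and> phil n i x = 1 \<and> epsl n i x = 0 \<and> phil n i y = 0 \<and> epsl n i y = 1"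
proof -
  assume a: "fl n i x = Some y"
  then have "el n i y = Some x" by (simp add: fl_el)
  with a have "phil n i x = 1" "epsl n i y = 1" by (auto simp: phil_def epsl_def)
  with phil_epsl[of n i x] phil_epsl[of n i y] have "epsl n i x = 0" "phil n i y = 0" by auto
  moreover have "y = Suc x" using a unfolding fl_def by (auto split: if_splits)
  ultimately show ?thesis using \<open>phil n i x = 1\<close> \<open>epsl n i y = 1\<close> by simp
qed

text \<open>In the picture of cancelling signs, the changed letter is the leftmost uncancelled plus:
  no plus survives to its left and no minus to its right.\<close>

lemma fw_position:
  assumes "fw n i w = Some w'"
  obtains u x v where "w = u @ x # v" "w' = u @ Suc x # v" "fl n i x = Some (Suc x)"
    "phiw n i u = 0" "epsw n i v = 0"
proof -
  have "\<exists>u x v. w = u @ x # v \<and> w' = u @ Suc x # v \<and> fl n i x = Some (Suc x)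
      \<and> phiw n i u = 0 \<and> epsw n i v = 0"
    using assms
  proof (induction w arbitrary: w')
    case (Cons x v)
    show ?case
    proof (cases "phil n i x > epsw n i v")
      case True
      then have "epsw n i v = 0" using phil_cases[of n i x] epsw_nonneg[of n i v] by auto
      moreover obtain y where y: "fl n i x = Some y" "w' = y # v" using True Cons.prems by auto
      moreover have "y = Suc x" using fl_Some[OF y(1)] by simp
      ultimately show ?thesis by (intro exI[of _ "[]"]) auto
    next
      case False
      with Cons.prems obtain v' where v': "fw n i v = Some v'" "w' = x # v'" by auto
      from Cons.IH[OF v'(1)] obtain u z w where h: "v = u @ z # w" "v' = u @ Suc z # w"
        "fl n i z = Some (Suc z)" "phiw n i u = 0" "epsw n i w = 0" by blast
      have "epsw n i v = epsw n i u"
        using h fl_Some[OF h(3)] phiw_epsw[of n i u] epsw_nonneg[of n i u] by (simp add: epsw_append)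
      then have "phiw n i (x # u) = 0" using False h(4) by simp
      then show ?thesis using h v' by (intro exI[of _ "x # u"]) auto
    qed
  qed simp
  then show thesis using that by blast
qed

lemma fw_Some:
  assumes "fw n i w = Some w'"
  shows "epsw n i w' = epsw n i w + 1" "net n i w' = net n i w - 2" "ew n i w' = Some w"
proof -
  obtain u x v where h: "w = u @ x # v" "w' = u @ Suc x # v" "fl n i x = Some (Suc x)"
    "phiw n i u = 0" "epsw n i v = 0" by (rule fw_position[OF assms])
  note x = fl_Some[OF h(3)]
  have u: "net n i u = - epsw n i u" using h(4) phiw_epsw[of n i u] by simp
  show "epsw n i w' = epsw n i w + 1" "net n i w' = net n i w - 2"
    using h x u by (simp_all add: epsw_append)
  show "ew n i w' = Some w"
    using h(3) x unfolding h(1,2) ew_append by (simp add: h(4,5) fl_el)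
qed

lemma ew_Some_fw: "ew n i w' = Some w \<Longrightarrow> fw n i w = Some w'"
proof (induction w' arbitrary: w)
  case (Cons y v')
  show ?case
  proof (cases "phil n i y \<ge> epsw n i v'")
    case True
    with Cons.prems obtain x where x: "el n i y = Some x" "w = x # v'" by (auto split: if_splits)
    then have "fl n i x = Some y" by (simp add: fl_el)
    with fl_Some[OF this] x True show ?thesis by auto
  next
    case False
    with Cons.prems obtain v where v: "ew n i v' = Some v" "w = y # v" by (auto split: if_splits)
    note f = Cons.IH[OF v(1)]
    from fw_Some(1)[OF f] False f v show ?thesis by auto
  qed
qed simp

lemma fw_ew: "fw n i w = Some w' \<longleftrightarrow> ew n i w' = Some w"
  using fw_Some(3) ew_Some_fw by blast

lemma fw_inj: "fw n i u = Some w \<Longrightarrow> fw n i v = Some w \<Longrightarrow> u = v"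
  by (simp add: fw_ew)

subsection \<open>Crystal operators on columns\<close>

text \<open>The shape of the inequalities that characterise the column order. A crystal operator f_i changes
  the three functions at the index i only.\<close>

definition fits :: "nat \<Rightarrow> (nat \<Rightarrow> int) \<Rightarrow> (nat \<Rightarrow> int) \<Rightarrow> (nat \<Rightarrow> int) \<Rightarrow> int \<Rightarrow> bool" where
  "fits n DA DB K s \<longleftrightarrow> (\<forall>v m. v \<le> m \<and> m \<le> n \<longrightarrow> DA m \<le> K v \<and> DB m \<le> K v + s)"

lemma fitsD: "fits n DA DB K s \<Longrightarrow> v \<le> m \<Longrightarrow> m \<le> n \<Longrightarrow> DA m \<le> K v \<and> DB m \<le> K v + s"
  by (simp add: fits_def)

text \<open>The flags \<open>a\<close>, \<open>b\<close>, \<open>g\<close>, \<open>d\<close> tell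
  whether \<open>i\<close>, \<open>i + 1\<close>, \<open>bar (i + 1)\<close>, \<open>bar i\<close>
  occur, in the left column for \<open>A\<close> and in the right one for \<open>B\<close>;
  \<open>phi\<close> belongs to the left column and \<open>eps\<close> to the right. The flags
  determine the increments between \<open>i - 1\<close>, \<open>i\<close> and \<open>i + 1\<close>,
  and the tensor product rule restricts them so that every inequality altered at \<open>i\<close>
  follows from inequalities at these three indices. The four cases say which column changes, and
  whether in \<open>i\<close> or in \<open>bar (i + 1)\<close>.\<close>

lemma fits_transfer:
  fixes DA DB K DA' DB' K' :: "nat \<Rightarrow> int" and phi eps :: int
  assumes i: "i = Suc j" "i < n"
    and DA: "DA i = DA j + (if aA then 1 else 0) + (if dA then 1 else 0) - 1" "DA (Suc i) = DA i + (if bA then 1 else 0) + (if gA then 1 else 0) - 1"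
    and DB: "DB i = DB j + (if aB then 1 else 0) + (if dB then 1 else 0) - 1" "DB (Suc i) = DB i + (if bB then 1 else 0) + (if gB then 1 else 0) - 1"
    and K: "K i = K j + (if aB then 1 else 0) + (if dA then 1 else 0) - 1" "K (Suc i) = K i + (if bB then 1 else 0) + (if gA then 1 else 0) - 1"
    and off: "\<And>m. m \<noteq> i \<Longrightarrow> m \<le> n \<Longrightarrow> DA' m = DA m \<and> DB' m = DB m \<and> K' m = K m"
    and phi: "phi = (if aA \<and> \<not> bA \<and> (gA \<or> \<not> dA) then 1 else 0) + (if gA \<and> \<not> dA then 1 else 0)"
    and eps: "eps = (if bB \<and> \<not> aB then 1 else 0) + (if dB \<and> \<not> gB \<and> \<not> (aB \<and> \<not> bB) then 1 else 0)"
    and cases: "(phi > eps \<and> aA \<and> \<not> bA \<and> (gA \<or> \<not> dA)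
          \<and> DA' i = DA i - 1 \<and> DB' i = DB i \<and> K' i = K i)
        \<or> (phi > eps \<and> gA \<and> \<not> dA \<and> (aA \<longrightarrow> bA)
          \<and> DA' i = DA i + 1 \<and> DB' i = DB i \<and> K' i = K i + 1)
        \<or> (phi \<le> eps \<and> aB \<and> \<not> bB \<and> (gB \<or> \<not> dB)
          \<and> DA' i = DA i \<and> DB' i = DB i - 1 \<and> K' i = K i - 1)
        \<or> (phi \<le> eps \<and> gB \<and> \<not> dB \<and> (aB \<longrightarrow> bB)
          \<and> DA' i = DA i \<and> DB' i = DB i + 1 \<and> K' i = K i)"
  shows "fits n DA DB K s \<longleftrightarrow> fits n DA' DB' K' s"
proof
  assume f: "fits n DA DB K s"
  show "fits n DA' DB' K' s" unfolding fits_def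
  proof (intro allI impI)
    fix v m assume vm: "v \<le> m \<and> m \<le> n"
    note g = fitsD[OF f]
    show "DA' m \<le> K' v \<and> DB' m \<le> K' v + s"
    proof (cases "v = i"; cases "m = i")
      assume vi: "v = i" "m = i"
      have "DA i \<le> K i \<and> DB i \<le> K i + s" "DA j \<le> K j \<and> DB j \<le> K j + s"
        "DA i \<le> K j \<and> DB i \<le> K j + s" "DA (Suc i) \<le> K i \<and> DB (Suc i) \<le> K i + s"
        "DA (Suc i) \<le> K (Suc i) \<and> DB (Suc i) \<le> K (Suc i) + s"
        using i g[of i i] g[of j j] g[of j i] g[of i "Suc i"] g[of "Suc i" "Suc i"] by auto
      moreover have "DA' j = DA j \<and> DB' j = DB j \<and> K' j = K j"
        "DA' (Suc i) = DA (Suc i) \<and> DB' (Suc i) = DB (Suc i) \<and> K' (Suc i) = K (Suc i)"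
        using i by (auto intro!: off)
      ultimately show ?thesis using cases phi eps DA DB K unfolding vi by (smt (verit))
    next
      assume v: "v = i" and m: "m \<noteq> i"
      have "DA m \<le> K i \<and> DB m \<le> K i + s" "DA m \<le> K j \<and> DB m \<le> K j + s"
        "DA m \<le> K (Suc i) \<and> DB m \<le> K (Suc i) + s"
        using i v m vm g[of i m] g[of j m] g[of "Suc i" m] by auto
      moreover have "DA' m = DA m \<and> DB' m = DB m" "K' j = K j" "K' (Suc i) = K (Suc i)"
        using i m vm off[of m] off[of j] off[of "Suc i"] by auto
      ultimately show ?thesis using cases phi eps K unfolding v by (smt (verit))
    next
      assume v: "v \<noteq> i" and m: "m = i"
      have "DA i \<le> K v \<and> DB i \<le> K v + s" "DA j \<le> K v \<and> DB j \<le> K v + s"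
        "DA (Suc i) \<le> K v \<and> DB (Suc i) \<le> K v + s"
        using i v m vm g[of v i] g[of v j] g[of v "Suc i"] by auto
      moreover have "K' v = K v" "DA' j = DA j \<and> DB' j = DB j"
        "DA' (Suc i) = DA (Suc i) \<and> DB' (Suc i) = DB (Suc i)"
        using i v vm off[of v] off[of j] off[of "Suc i"] by auto
      ultimately show ?thesis using cases phi eps DA DB unfolding m by (smt (verit))
    next
      assume "v \<noteq> i" "m \<noteq> i"
      then show ?thesis using off[of v] off[of m] g[of v m] vm by simp
    qed
  qed
next
  assume f: "fits n DA' DB' K' s"
  show "fits n DA DB K s" unfolding fits_def
  proof (intro allI impI)
    fix v m assume vm: "v \<le> m \<and> m \<le> n"
    note g = fitsD[OF f]
    show "DA m \<le> K v \<and> DB m \<le> K v + s"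
    proof (cases "v = i"; cases "m = i")
      assume vi: "v = i" "m = i"
      have "DA' i \<le> K' i \<and> DB' i \<le> K' i + s" "DA' j \<le> K' j \<and> DB' j \<le> K' j + s"
        "DA' i \<le> K' j \<and> DB' i \<le> K' j + s" "DA' (Suc i) \<le> K' i \<and> DB' (Suc i) \<le> K' i + s"
        "DA' (Suc i) \<le> K' (Suc i) \<and> DB' (Suc i) \<le> K' (Suc i) + s"
        using i g[of i i] g[of j j] g[of j i] g[of i "Suc i"] g[of "Suc i" "Suc i"] by auto
      moreover have "DA' j = DA j \<and> DB' j = DB j \<and> K' j = K j"
        "DA' (Suc i) = DA (Suc i) \<and> DB' (Suc i) = DB (Suc i) \<and> K' (Suc i) = K (Suc i)"
        using i by (auto intro!: off)
      ultimately show ?thesis using cases phi eps DA DB K unfolding vi by (smt (z3))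
    next
      assume v: "v = i" and m: "m \<noteq> i"
      have "DA' m \<le> K' i \<and> DB' m \<le> K' i + s" "DA' m \<le> K' j \<and> DB' m \<le> K' j + s"
        "DA' m \<le> K' (Suc i) \<and> DB' m \<le> K' (Suc i) + s"
        using i v m vm g[of i m] g[of j m] g[of "Suc i" m] by auto
      moreover have "DA' m = DA m \<and> DB' m = DB m" "K' j = K j" "K' (Suc i) = K (Suc i)"
        using i m vm off[of m] off[of j] off[of "Suc i"] by auto
      ultimately show ?thesis using cases phi eps K unfolding v by (smt (verit))
    next
      assume v: "v \<noteq> i" and m: "m = i"
      have "DA' i \<le> K' v \<and> DB' i \<le> K' v + s" "DA' j \<le> K' v \<and> DB' j \<le> K' v + s"
        "DA' (Suc i) \<le> K' v \<and> DB' (Suc i) \<le> K' v + s"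
        using i v m vm g[of v i] g[of v j] g[of v "Suc i"] by auto
      moreover have "K' v = K v" "DA' j = DA j \<and> DB' j = DB j"
        "DA' (Suc i) = DA (Suc i) \<and> DB' (Suc i) = DB (Suc i)"
        using i v vm off[of v] off[of j] off[of "Suc i"] by auto
      ultimately show ?thesis using cases phi eps DA DB unfolding m by (smt (verit))
    next
      assume "v \<noteq> i" "m \<noteq> i"
      then show ?thesis using off[of v] off[of m] g[of v m] vm by simp
    qed
  qed
qed

text \<open>For \<open>i = n\<close> the letter \<open>n\<close> becomes \<open>bar n\<close>. Both
  lie in the window of the defect at \<open>n\<close>, so only \<open>K\<close> changes, and only
  the inequalities with \<open>v = m = n\<close> are concerned. By \<open>DAB\<close> these two are
  equivalent.\<close>

lemma fits_transfer_top:
  fixes DA DB K DA' DB' K' :: "nat \<Rightarrow> int"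
  assumes i: "n = Suc j"
    and DA: "DA n = DA j + (if aA then 1 else 0) + (if dA then 1 else 0) - 1"
    and DB: "DB n = DB j + (if aB then 1 else 0) + (if dB then 1 else 0) - 1"
    and K: "K n = K j + (if aB then 1 else 0) + (if dA then 1 else 0) - 1"
    and off: "\<And>m. m \<noteq> n \<Longrightarrow> m \<le> n \<Longrightarrow> DA' m = DA m \<and> DB' m = DB m \<and> K' m = K m"
    and D': "DA' n = DA n" "DB' n = DB n"
    and DAB: "DB n = DA n + s"
    and cases: "(aA \<and> \<not> dA \<and> \<not> (dB \<and> \<not> aB) \<and> K' n = K n + 1)
        \<or> (\<not> (aA \<and> \<not> dA) \<and> aB \<and> \<not> dB \<and> K' n = K n - 1)"
  shows "fits n DA DB K s \<longleftrightarrow> fits n DA' DB' K' s"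
proof
  assume f: "fits n DA DB K s"
  show "fits n DA' DB' K' s" unfolding fits_def
  proof (intro allI impI)
    fix v m assume vm: "v \<le> m \<and> m \<le> n"
    note g = fitsD[OF f]
    show "DA' m \<le> K' v \<and> DB' m \<le> K' v + s"
    proof (cases "v = n")
      case True
      then have "m = n" using vm by simp
      then have vm': "v = n" "m = n" using vm True by auto
      have "DA n \<le> K n" "DA n \<le> K j" "DA j \<le> K j"
        "DB n \<le> K n + s" "DB n \<le> K j + s" "DB j \<le> K j + s"
        using i g[of n n] g[of j n] g[of j j] by auto
      moreover have "DA' j = DA j" "DB' j = DB j" "K' j = K j"
        using i off[of j] by auto
      ultimately show ?thesis using cases D' DAB DA DB K unfolding vm' by (smt (verit))
    next
      case False
      then show ?thesis using off[of v] off[of m] g[of v m] vm D' by (cases "m = n") auto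
    qed
  qed
next
  assume f: "fits n DA' DB' K' s"
  show "fits n DA DB K s" unfolding fits_def
  proof (intro allI impI)
    fix v m assume vm: "v \<le> m \<and> m \<le> n"
    note g = fitsD[OF f]
    show "DA m \<le> K v \<and> DB m \<le> K v + s"
    proof (cases "v = n")
      case True
      then have "m = n" using vm by simp
      then have vm': "v = n" "m = n" using vm True by auto
      have "DA' n \<le> K' n" "DA' n \<le> K' j" "DA' j \<le> K' j"
        "DB' n \<le> K' n + s" "DB' n \<le> K' j + s" "DB' j \<le> K' j + s"
        using i g[of n n] g[of j n] g[of j j] by auto
      moreover have "DA' j = DA j" "DB' j = DB j" "K' j = K j"
        using i off[of j] by auto
      ultimately show ?thesis using cases D' DAB DA DB K unfolding vm' by (smt (verit))
    next
      case False
      then show ?thesis using off[of v] off[of m] g[of v m] vm D' by (cases "m = n") auto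
    qed
  qed
qed

section \<open>Signatures of a single column\<close>

lemma phil_eq: "1 \<le> i \<Longrightarrow> i < n \<Longrightarrow> phil n i x = (if x = i \<or> x = 2 * n - i then 1 else 0)"
  and epsl_eq: "1 \<le> i \<Longrightarrow> i < n \<Longrightarrow> epsl n i x = (if x = Suc i \<or> x = 2 * n + 1 - i then 1 else 0)"
  by (auto simp: phil_def fl_def epsl_def el_def)

lemma phil_top: "1 \<le> n \<Longrightarrow> phil n n x = (if x = n then 1 else 0)"
  and epsl_top: "1 \<le> n \<Longrightarrow> epsl n n x = (if x = Suc n then 1 else 0)"
  by (auto simp: phil_def fl_def epsl_def el_def)

definition neutral :: "nat \<Rightarrow> nat \<Rightarrow> nat list \<Rightarrow> bool" where
  "neutral n i w \<longleftrightarrow> (\<forall>x\<in>set w. phil n i x = 0 \<and> epsl n i x = 0)"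

lemma neutral_word: "neutral n i w \<Longrightarrow> epsw n i w = 0 \<and> net n i w = 0 \<and> phiw n i w = 0 \<and> fw n i w = None"
  unfolding neutral_def by (induction w) (auto simp: fl_None_iff)

lemma sorted_split:
  assumes "sorted_wrt (<) c"
  obtains P R where "c = P @ ((if a \<in> set c then [a] else []) @ (if Suc a \<in> set c then [Suc a] else [])) @ R"
    "\<forall>x\<in>set P. x < a" "\<forall>x\<in>set R. Suc a < x" "sorted_wrt (<) R"
proof -
  have e: "c = filter (\<lambda>x. x < a) c @ filter (\<lambda>x. a \<le> x \<and> x \<le> Suc a) c @ filter (\<lambda>x. Suc a < x) c"
    using assms
  proof (induction c)
    case (Cons x c)
    have e1: "filter (\<lambda>x. x < a) c = []" if "a \<le> x" using Cons.prems that by (auto simp: filter_empty_conv)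
    have e2: "filter (\<lambda>x. a \<le> x \<and> x \<le> Suc a) c = []" if "Suc a < x"
      using Cons.prems that by (auto simp: filter_empty_conv)
    consider "x < a" | "a \<le> x" "x \<le> Suc a" | "Suc a < x" by linarith
    then show ?case using Cons e1 e2 by cases auto
  qed simp
  have f: "filter (\<lambda>x. a \<le> x \<and> x \<le> Suc a) c
      = (if a \<in> set c then [a] else []) @ (if Suc a \<in> set c then [Suc a] else [])"
    using assms
  proof (induction c)
    case (Cons x c)
    have "filter (\<lambda>x. a \<le> x \<and> x \<le> Suc a) c = []" if "Suc a \<le> x"
      using Cons.prems that by (auto simp: filter_empty_conv)
    moreover have "a \<notin> set c" if "a \<le> x" using Cons.prems that by auto
    moreover have "Suc a \<notin> set c" if "Suc a \<le> x" using Cons.prems that by auto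
    ultimately show ?case using Cons by (auto simp: le_Suc_eq)
  qed simp
  show thesis
    by (rule that[OF e[unfolded f]]) (use assms in \<open>auto intro: sorted_wrt_filter\<close>)
qed

lemma column_split:
  assumes "sorted_wrt (<) c" "1 \<le> i" "i < n"
  obtains P Q R where
    "c = P @ ((if i \<in> set c then [i] else []) @ (if Suc i \<in> set c then [Suc i] else [])) @ Q
       @ ((if 2 * n - i \<in> set c then [2 * n - i] else []) @ (if 2 * n + 1 - i \<in> set c then [2 * n + 1 - i] else [])) @ R"
    "\<forall>x\<in>set P. x < i" "\<forall>x\<in>set Q. Suc i < x \<and> x < 2 * n - i" "\<forall>x\<in>set R. 2 * n + 1 - i < x"
proof -
  obtain P R where 1: "c = P @ ((if i \<in> set c then [i] else []) @ (if Suc i \<in> set c then [Suc i] else [])) @ R"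
    "\<forall>x\<in>set P. x < i" "\<forall>x\<in>set R. Suc i < x" "sorted_wrt (<) R" by (rule sorted_split[OF assms(1)])
  obtain Q S where 2: "R = Q @ ((if 2 * n - i \<in> set R then [2 * n - i] else [])
      @ (if Suc (2 * n - i) \<in> set R then [Suc (2 * n - i)] else [])) @ S"
    "\<forall>x\<in>set Q. x < 2 * n - i" "\<forall>x\<in>set S. Suc (2 * n - i) < x"
    by (rule sorted_split[OF 1(4)]) blast
  have s: "Suc (2 * n - i) = 2 * n + 1 - i" using assms by simp
  have in1: "x \<in> set c \<longleftrightarrow> x \<in> set R" if "Suc i < x" for x
  proof -
    have "set c \<subseteq> set P \<union> {i, Suc i} \<union> set R" by (subst 1(1)) auto
    then have "x \<in> set c \<Longrightarrow> x \<in> set R" using that 1(2) by fastforce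
    moreover have "x \<in> set (P @ ((if i \<in> set c then [i] else []) @ (if Suc i \<in> set c then [Suc i] else [])) @ R)"
      if "x \<in> set R" using that by simp
    then have "x \<in> set R \<Longrightarrow> x \<in> set c" unfolding 1(1)[symmetric] .
    ultimately show ?thesis by blast
  qed
  have m: "2 * n - i \<in> set R \<longleftrightarrow> 2 * n - i \<in> set c" "2 * n + 1 - i \<in> set R \<longleftrightarrow> 2 * n + 1 - i \<in> set c"
    using in1[of "2 * n - i"] in1[of "2 * n + 1 - i"] assms by auto
  note R = 2(1)[unfolded s m]
  have "x \<in> set R" if "x \<in> set Q" for x using that by (subst R) simp
  then have "\<forall>x\<in>set Q. Suc i < x \<and> x < 2 * n - i" using 1(3) 2(2) by blast
  moreover have "\<forall>x\<in>set S. 2 * n + 1 - i < x" using 2(3) unfolding s .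
  moreover note c = 1(1)[unfolded R]
  ultimately show thesis by (intro that[OF c]) (use 1(2) in auto)
qed

text \<open>The operator f_i changes the letter i of a column to i + 1 in the first case, and the letter
  bar (i + 1) to bar i in the second one.\<close>

abbreviation acts_low :: "nat \<Rightarrow> nat \<Rightarrow> nat list \<Rightarrow> bool" where
  "acts_low n i c \<equiv> i \<in> set c \<and> Suc i \<notin> set c \<and> (2 * n - i \<in> set c \<or> 2 * n + 1 - i \<notin> set c)"

abbreviation acts_high :: "nat \<Rightarrow> nat \<Rightarrow> nat list \<Rightarrow> bool" where
  "acts_high n i c \<equiv> 2 * n - i \<in> set c \<and> 2 * n + 1 - i \<notin> set c \<and> (i \<in> set c \<longrightarrow> Suc i \<in> set c)"

text \<open>Only \<open>i\<close>, \<open>i + 1\<close>, \<open>bar (i + 1)\<close>,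
  \<open>bar i\<close> carry signs, namely plus, minus, plus, minus in this order, so sixteen cases
  cover everything. The words are only assumed strictly increasing, so that the result applies also
  to the word left by R3, which may be empty.\<close>

lemma sorted_eps:
  assumes "sorted_wrt (<) c" "1 \<le> i" "i < n"
  shows "epsw n i c = (if Suc i \<in> set c \<and> i \<notin> set c then 1 else 0) +
      (if 2 * n + 1 - i \<in> set c \<and> 2 * n - i \<notin> set c \<and> \<not> (i \<in> set c \<and> Suc i \<notin> set c) then 1 else 0)"
    and "phiw n i c = (if acts_low n i c then 1 else 0) +
      (if 2 * n - i \<in> set c \<and> 2 * n + 1 - i \<notin> set c then 1 else 0)"
    and "fw n i c = Some c' \<Longrightarrow> \<exists>x u v. c = u @ x # v \<and> c' = u @ Suc x # v \<and> Suc x \<notin> set c \<and>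
       ((x = i \<and> acts_low n i c)
      \<or> (x = 2 * n - i \<and> acts_high n i c))"
proof -
  obtain P Q R where d:
    "c = P @ ((if i \<in> set c then [i] else []) @ (if Suc i \<in> set c then [Suc i] else [])) @ Q
       @ ((if 2 * n - i \<in> set c then [2 * n - i] else []) @ (if 2 * n + 1 - i \<in> set c then [2 * n + 1 - i] else [])) @ R"
    "\<forall>x\<in>set P. x < i" "\<forall>x\<in>set Q. Suc i < x \<and> x < 2 * n - i" "\<forall>x\<in>set R. 2 * n + 1 - i < x"
    by (rule column_split[OF assms(1) assms(2,3)])
  define A where "A \<longleftrightarrow> i \<in> set c"
  define B where "B \<longleftrightarrow> Suc i \<in> set c"
  define G where "G \<longleftrightarrow> 2 * n - i \<in> set c"
  define D where "D \<longleftrightarrow> 2 * n + 1 - i \<in> set c"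
  note AB = A_def[symmetric] B_def[symmetric] G_def[symmetric] D_def[symmetric]
  have neu: "neutral n i P" "neutral n i Q" "neutral n i R"
    unfolding neutral_def using d(2-4) assms(2,3) by (auto simp: phil_eq epsl_eq)
  note nn = neu[THEN neutral_word]
  have f: "fl n i i = Some (Suc i)" "fl n i (2 * n - i) = Some (Suc (2 * n - i))"
    "fl n i (Suc i) = None" "fl n i (Suc (2 * n - i)) = None"
    using assms(2,3) by (auto simp: fl_def)
  have s: "2 * n + 1 - i = Suc (2 * n - i)" using assms by simp
  have pe: "phil n i i = 1" "phil n i (2 * n - i) = 1" "phil n i (Suc i) = 0" "phil n i (Suc (2 * n - i)) = 0"
    "epsl n i i = 0" "epsl n i (2 * n - i) = 0" "epsl n i (Suc i) = 1" "epsl n i (Suc (2 * n - i)) = 1"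
    using assms(2,3) by (auto simp: phil_eq epsl_eq)
  have dd: "c = P @ ((if A then [i] else []) @ (if B then [Suc i] else [])) @ Q
       @ ((if G then [2 * n - i] else []) @ (if D then [Suc (2 * n - i)] else [])) @ R"
    using d(1) unfolding AB unfolding s .
  show "epsw n i c = (if Suc i \<in> set c \<and> i \<notin> set c then 1 else 0) +
      (if 2 * n + 1 - i \<in> set c \<and> 2 * n - i \<notin> set c \<and> \<not> (i \<in> set c \<and> Suc i \<notin> set c) then 1 else 0)"
    unfolding AB by (subst dd) (cases A; cases B; cases G; cases D; simp_all add: epsw_append nn pe)
  show "phiw n i c = (if acts_low n i c then 1 else 0) +
      (if 2 * n - i \<in> set c \<and> 2 * n + 1 - i \<notin> set c then 1 else 0)"
    unfolding AB by (subst dd) (cases A; cases B; cases G; cases D; simp_all add: phiw_append epsw_append nn pe)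
  have fwc: "fw n i c = (if A \<and> \<not> B \<and> (G \<or> \<not> D)
      then Some (P @ Suc i # Q @ ((if G then [2 * n - i] else []) @ (if D then [Suc (2 * n - i)] else [])) @ R)
      else if G \<and> \<not> D
      then Some (P @ ((if A then [i] else []) @ (if B then [Suc i] else [])) @ Q @ Suc (2 * n - i) # R)
      else None)"
    by (subst dd) (cases A; cases B; cases G; cases D; simp_all add: fw_append epsw_append phiw_append nn pe f)
  assume c': "fw n i c = Some c'"
  show "\<exists>x u v. c = u @ x # v \<and> c' = u @ Suc x # v \<and> Suc x \<notin> set c \<and>
       ((x = i \<and> acts_low n i c)
      \<or> (x = 2 * n - i \<and> acts_high n i c))"
  proof (cases "A \<and> \<not> B \<and> (G \<or> \<not> D)")
    case True
    let ?v = "Q @ ((if G then [2 * n - i] else []) @ (if D then [Suc (2 * n - i)] else [])) @ R"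
    have "c = P @ i # ?v" "c' = P @ Suc i # ?v" using dd c' fwc True by auto
    then show ?thesis using True unfolding A_def B_def G_def D_def by blast
  next
    case False
    let ?u = "P @ ((if A then [i] else []) @ (if B then [Suc i] else [])) @ Q"
    have GD: "G \<and> \<not> D" using c' fwc False by (auto split: if_splits)
    have "c = ?u @ (2 * n - i) # R" "c' = ?u @ Suc (2 * n - i) # R" using dd c' fwc False GD by auto
    moreover have "A \<longrightarrow> B" using False GD by blast
    ultimately show ?thesis using GD unfolding A_def B_def G_def D_def s by blast
  qed
qed

lemma sorted_eps_top:
  assumes "sorted_wrt (<) c" "1 \<le> n"
  shows "epsw n n c = (if Suc n \<in> set c \<and> n \<notin> set c then 1 else 0)"
    and "phiw n n c = (if n \<in> set c \<and> Suc n \<notin> set c then 1 else 0)"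
    and "fw n n c = Some c' \<Longrightarrow> \<exists>u v. c = u @ n # v \<and> c' = u @ Suc n # v \<and> n \<in> set c \<and> Suc n \<notin> set c"
proof -
  obtain P R where d: "c = P @ ((if n \<in> set c then [n] else []) @ (if Suc n \<in> set c then [Suc n] else [])) @ R"
    "\<forall>x\<in>set P. x < n" "\<forall>x\<in>set R. Suc n < x" by (rule sorted_split[OF assms(1)])
  define A where "A \<longleftrightarrow> n \<in> set c"
  define B where "B \<longleftrightarrow> Suc n \<in> set c"
  note AB = A_def[symmetric] B_def[symmetric]
  have neu: "neutral n n P" "neutral n n R"
    unfolding neutral_def using d(2-3) assms(2) by (auto simp: phil_top epsl_top)
  note nn = neu[THEN neutral_word]
  have f: "fl n n n = Some (Suc n)" "fl n n (Suc n) = None"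
    using assms(2) by (auto simp: fl_def)
  have pe: "phil n n n = 1" "phil n n (Suc n) = 0" "epsl n n n = 0" "epsl n n (Suc n) = 1"
    using assms(2) by (auto simp: phil_top epsl_top)
  have dd: "c = P @ ((if A then [n] else []) @ (if B then [Suc n] else [])) @ R"
    using d(1) unfolding AB .
  show "epsw n n c = (if Suc n \<in> set c \<and> n \<notin> set c then 1 else 0)"
    unfolding AB by (subst dd) (cases A; cases B; simp_all add: epsw_append nn pe)
  show "phiw n n c = (if n \<in> set c \<and> Suc n \<notin> set c then 1 else 0)"
    unfolding AB by (subst dd) (cases A; cases B; simp_all add: phiw_append epsw_append nn pe)
  assume c': "fw n n c = Some c'"
  have fwc: "fw n n c = (if A \<and> \<not> B then Some (P @ Suc n # R) else None)"
    by (subst dd) (cases A; cases B; simp_all add: fw_append epsw_append phiw_append nn pe f)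
  then have ab: "A \<and> \<not> B" and "c' = P @ Suc n # R" using c' by (auto split: if_splits)
  moreover have "c = P @ n # R" using dd ab by simp
  ultimately show "\<exists>u v. c = u @ n # v \<and> c' = u @ Suc n # v \<and> n \<in> set c \<and> Suc n \<notin> set c"
    using ab unfolding A_def B_def by blast
qed

lemmas column_eps = sorted_eps[of c i n, OF columnD(2)[of n c]] for n c i
lemmas column_eps_top = sorted_eps_top[of c n, OF columnD(2)[of n c]] for n c

lemma cnt_replace: "cnt (u @ Suc x # v) w = cnt (u @ x # v) w - (if w = x then 1 else 0)"
  by auto

lemma defect_replace:
  assumes "c = u @ x # v" "c' = u @ Suc x # v" "m \<le> n"
  shows "defect n c' m = defect n c m - (if m = x then 1 else 0) + (if 2 * n - m = x then 1 else 0)"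
  using assms by (auto simp: defect_def cnt_replace)

lemma column_replace:
  assumes "column n (u @ x # v)" "Suc x \<notin> set (u @ x # v)" "x < 2 * n"
  shows "column n (u @ Suc x # v)"
proof -
  have s: "sorted_wrt (<) u" "sorted_wrt (<) v" "\<forall>y\<in>set u. y < x" "\<forall>y\<in>set v. x < y" "\<forall>y\<in>set u. \<forall>z\<in>set v. y < z"
    using assms(1) by (auto simp: column_def sorted_wrt_append)
  have "Suc x < y" if "y \<in> set v" for y
  proof -
    have "x < y" "y \<noteq> Suc x" using s(4) that assms(2) by auto
    then show ?thesis by simp
  qed
  moreover have "y < Suc x" if "y \<in> set u" for y using s(3) that by (simp add: less_SucI)
  moreover have "\<forall>y\<in>set (u @ Suc x # v). letter n y"
    using assms(1,3) by (auto simp: column_def letter_def)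
  ultimately show ?thesis using s by (auto simp: column_def sorted_wrt_append)
qed

lemma fl_bounds: "fl n i x = Some y \<Longrightarrow> 1 \<le> i \<Longrightarrow> 1 \<le> x \<and> x < 2 * n"
  unfolding fl_def by (auto split: if_splits)

lemma column_fw:
  assumes "column n c" "1 \<le> i" "i \<le> n" "fw n i c = Some c'"
  shows "column n c'"
proof (cases "i = n")
  case True
  then obtain u v where "c = u @ n # v \<and> c' = u @ Suc n # v \<and> n \<in> set c \<and> Suc n \<notin> set c"
    using column_eps_top(3)[of n c c'] assms by auto
  then show ?thesis using column_replace[of n u n v] assms by auto
next
  case False
  then have i: "i < n" using assms by simp
  from column_eps(3)[OF assms(1,2) i assms(4)] obtain x u v where
    h: "c = u @ x # v" "c' = u @ Suc x # v" "Suc x \<notin> set c" "x = i \<or> x = 2 * n - i" by blast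
  then show ?thesis using column_replace[of n u x v] assms i by auto
qed

text \<open>The order could only fail if the restored letter \<open>x\<close> already stood
  immediately before its place. There it would be an uncancelled plus at the end of
  \<open>u\<close>, against \<open>phiw n i u = 0\<close>.\<close>

lemma column_fw_inv:
  assumes "column n c'" "1 \<le> i" "fw n i c = Some c'"
  shows "column n c"
proof -
  obtain u x v where h: "c = u @ x # v" "c' = u @ Suc x # v" "fl n i x = Some (Suc x)"
    "phiw n i u = 0" by (rule fw_position[OF assms(3)])
  have "x \<notin> set u"
  proof
    assume "x \<in> set u"
    then obtain y z where u: "u = y @ x # z" by (metis split_list)
    have "z = []"
    proof (rule ccontr)
      assume "z \<noteq> []"
      then obtain a z' where z: "z = a # z'" by (cases z) auto
      then have "x < a" "a < Suc x" using assms(1) h u by (auto simp: column_def sorted_wrt_append)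
      then show False by simp
    qed
    then have "phiw n i u \<ge> 1" using u fl_Some[OF h(3)] by (simp add: phiw_append)
    then show False using h by simp
  qed
  then have "\<forall>y\<in>set u. y < x" using assms(1) h
    by (auto simp: column_def sorted_wrt_append less_Suc_eq)
  then show ?thesis using assms(1) h fl_bounds[OF h(3) assms(2)]
    by (auto simp: column_def sorted_wrt_append letter_def)
qed

section \<open>Preservation of admissibility and of the column order\<close>

lemma column_step:
  assumes "column n c" "1 \<le> i" "i < n"
  obtains j where "i = Suc j"
    "defect n c i = defect n c j + (if i \<in> set c then 1 else 0) + (if 2 * n + 1 - i \<in> set c then 1 else 0) - 1"
    "defect n c (Suc i) = defect n c i + (if Suc i \<in> set c then 1 else 0) + (if 2 * n - i \<in> set c then 1 else 0) - 1"
proof -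
  obtain j where "i = Suc j" using assms(2) by (cases i) auto
  then show thesis using that[of j] defect_step[OF assms(1), of j] defect_step[OF assms(1), of i] assms(3)
    by (simp add: bar_def)
qed

text \<open>Raising \<open>i\<close> takes a letter out of the window at \<open>i\<close>, and
  raising \<open>bar (i + 1)\<close> to \<open>bar i\<close> brings one in; no other window
  notices.\<close>

lemma fw_defect:
  assumes "column n c" "1 \<le> i" "i < n" "fw n i c = Some c'"
  shows "(acts_low n i c \<and>
       (\<forall>w. cnt c' w = cnt c w - (if w = i then 1 else 0)) \<and>
       (\<forall>m\<le>n. defect n c' m = defect n c m - (if m = i then 1 else 0)))
      \<or> (acts_high n i c \<and>
       (\<forall>w. cnt c' w = cnt c w - (if w = 2 * n - i then 1 else 0)) \<and>
       (\<forall>m\<le>n. defect n c' m = defect n c m + (if m = i then 1 else 0)))"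
proof -
  from column_eps(3)[OF assms] obtain x u v where h: "c = u @ x # v" "c' = u @ Suc x # v" and
    c: "(x = i \<and> acts_low n i c)
      \<or> (x = 2 * n - i \<and> acts_high n i c)"
    by blast
  have e: "cnt c' w = cnt c w - (if w = x then 1 else 0)" for w using h by (simp add: cnt_replace)
  have f: "defect n c' m = defect n c m - (if m = x then 1 else 0) + (if 2 * n - m = x then 1 else 0)"
    if "m \<le> n" for m using defect_replace[OF h that] .
  from c show ?thesis
  proof
    assume x: "x = i \<and> acts_low n i c"
    have "2 * n - m \<noteq> i" if "m \<le> n" for m using that assms(3) by simp
    then show ?thesis using x e f by (intro disjI1) simp
  next
    assume x: "x = 2 * n - i \<and> acts_high n i c"
    have "m \<noteq> 2 * n - i" "2 * n - m = 2 * n - i \<longleftrightarrow> m = i" if "m \<le> n" for m using that assms(3) by auto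
    then show ?thesis using x e f by (intro disjI2) simp
  qed
qed

lemma fw_defect_top:
  assumes "column n c" "1 \<le> n" "fw n n c = Some c'"
  shows "n \<in> set c \<and> Suc n \<notin> set c \<and> (\<forall>w. cnt c' w = cnt c w - (if w = n then 1 else 0)) \<and>
       (\<forall>m\<le>n. defect n c' m = defect n c m)"
proof -
  from column_eps_top(3)[OF assms] obtain u v where h: "c = u @ n # v" "c' = u @ Suc n # v" and
    c: "n \<in> set c \<and> Suc n \<notin> set c" by blast
  have "defect n c' m = defect n c m" if "m \<le> n" for m
    using defect_replace[OF h that] that by auto
  then show ?thesis using c h by (simp add: cnt_replace)
qed

text \<open>Of the old and the new defect at \<open>i\<close>, the larger one always equals the
  unchanged defect at \<open>i - 1\<close> or at \<open>i + 1\<close>. This is what the side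
  conditions in \<open>acts_low\<close> and \<open>acts_high\<close> provide through the increments
  of the walk.\<close>

lemma admissible_fw:
  assumes "column n c" "1 \<le> i" "i \<le> n" "fw n i c = Some c'"
  shows "admissible n c' \<longleftrightarrow> admissible n c"
proof -
  note col' = column_fw[OF assms]
  show ?thesis
  proof (cases "i = n")
    case True
    then show ?thesis using fw_defect_top[of n c c'] assms col' by (simp add: admissible_defect)
  next
    case False
    then have i: "i < n" using assms by simp
    from assms(1,2) i obtain j where j: "i = Suc j"
      "defect n c i = defect n c j + (if i \<in> set c then 1 else 0) + (if 2 * n + 1 - i \<in> set c then 1 else 0) - 1"
      "defect n c (Suc i) = defect n c i + (if Suc i \<in> set c then 1 else 0) + (if 2 * n - i \<in> set c then 1 else 0) - 1"
      by (rule column_step)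
    note d = fw_defect[OF assms(1,2) i assms(4)]
    have "(\<forall>m\<le>n. defect n c' m \<le> 0) \<longleftrightarrow> (\<forall>m\<le>n. defect n c m \<le> 0)"
    proof (intro iffI allI impI)
      fix m assume a: "\<forall>m\<le>n. defect n c' m \<le> 0" and m: "m \<le> n"
      have "defect n c' m \<le> 0" "defect n c' i \<le> 0" "defect n c' j \<le> 0" "defect n c' (Suc i) \<le> 0"
        using a m i j(1) by auto
      then show "defect n c m \<le> 0" using d m j i by (cases "m = i") (auto split: if_splits)
    next
      fix m assume a: "\<forall>m\<le>n. defect n c m \<le> 0" and m: "m \<le> n"
      have "defect n c m \<le> 0" "defect n c i \<le> 0" "defect n c j \<le> 0" "defect n c (Suc i) \<le> 0"
        using a m i j(1) by auto
      then show "defect n c' m \<le> 0" using d m j i by (cases "m = i") (auto split: if_splits)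
    qed
    then show ?thesis using assms(1) col' by (simp add: admissible_defect)
  qed
qed

lemma fw_length: "fw n i w = Some w' \<Longrightarrow> length w' = length w"
  by (erule fw_position) simp

abbreviation overlap :: "nat \<Rightarrow> nat list \<Rightarrow> nat list \<Rightarrow> nat \<Rightarrow> int" where
  "overlap n a b v \<equiv> cnt b v + int (length a) - cnt a (2 * n - v) - int v"

lemma prec_fits:
  assumes "admissible n b" "admissible n a"
  shows "prec n b a \<longleftrightarrow> fits n (defect n a) (defect n b) (overlap n a b) (int (length b) - int (length a))"
  unfolding prec_defect[OF assms] fits_def by (simp add: algebra_simps)

lemma overlap_step:
  assumes "column n a" "column n b" "Suc v \<le> n"
  shows "overlap n a b (Suc v) = overlap n a b v + (if Suc v \<in> set b then 1 else 0)
    + (if 2 * n - v \<in> set a then 1 else 0) - 1"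
proof -
  have e: "2 * n - v = Suc (2 * n - Suc v)" using assms(3) by simp
  show ?thesis
    using cnt_step[OF columnD(2)[OF assms(2)], of v] cnt_step[OF columnD(2)[OF assms(1)], of "2 * n - Suc v"]
    unfolding e[symmetric] by auto
qed

lemma defect_top: "defect n c n = int (length c) - int n"
  by (simp add: defect_def)

lemma prec_fw_lt:
  assumes adm: "admissible n a" "admissible n b" and i: "1 \<le> i" "i < n"
    and cs: "(phiw n i a > epsw n i b \<and> fw n i a = Some a' \<and> b' = b)
      \<or> (phiw n i a \<le> epsw n i b \<and> fw n i b = Some b' \<and> a' = a)"
  shows "prec n b' a' \<longleftrightarrow> prec n b a"
proof -
  have cols: "column n a" "column n b" using adm by (auto simp: admissible_def)
  have adm': "admissible n a'" "admissible n b'"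
    using cs adm cols admissible_fw i by auto
  have len: "length a' = length a" "length b' = length b" using cs fw_length by auto
  from cols(1) i obtain j where j: "i = Suc j"
    "defect n a i = defect n a j + (if i \<in> set a then 1 else 0) + (if 2 * n + 1 - i \<in> set a then 1 else 0) - 1"
    "defect n a (Suc i) = defect n a i + (if Suc i \<in> set a then 1 else 0) + (if 2 * n - i \<in> set a then 1 else 0) - 1"
    by (rule column_step)
  from cols(2) i obtain j' where j': "i = Suc j'"
    "defect n b i = defect n b j' + (if i \<in> set b then 1 else 0) + (if 2 * n + 1 - i \<in> set b then 1 else 0) - 1"
    "defect n b (Suc i) = defect n b i + (if Suc i \<in> set b then 1 else 0) + (if 2 * n - i \<in> set b then 1 else 0) - 1"
    by (rule column_step)
  have jj: "j' = j" using j(1) j'(1) by simp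
  have K: "overlap n a b i = overlap n a b j + (if i \<in> set b then 1 else 0) + (if 2 * n + 1 - i \<in> set a then 1 else 0) - 1"
    "overlap n a b (Suc i) = overlap n a b i + (if Suc i \<in> set b then 1 else 0) + (if 2 * n - i \<in> set a then 1 else 0) - 1"
    using overlap_step[OF cols, of j] overlap_step[OF cols, of i] i j(1) by auto
  have "fits n (defect n a) (defect n b) (overlap n a b) (int (length b) - int (length a)) \<longleftrightarrow>
      fits n (defect n a') (defect n b') (overlap n a' b') (int (length b) - int (length a))"
  proof (rule fits_transfer[OF j(1) i(2) j(2,3) j'(2,3)[unfolded jj] K _ column_eps(2)[OF cols(1) i] column_eps(1)[OF cols(2) i]])
    have ne: "2 * n - m = 2 * n - i \<longleftrightarrow> m = i" "2 * n - m \<noteq> i" if "m \<le> n" for m using that i by auto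
    show "defect n a' m = defect n a m \<and> defect n b' m = defect n b m \<and> overlap n a' b' m = overlap n a b m"
      if "m \<noteq> i" "m \<le> n" for m
      using cs
    proof
      assume "epsw n i b < phiw n i a \<and> fw n i a = Some a' \<and> b' = b"
      then show ?thesis using fw_defect[OF cols(1) i, of a'] that ne[OF that(2)] len by auto
    next
      assume "phiw n i a \<le> epsw n i b \<and> fw n i b = Some b' \<and> a' = a"
      then show ?thesis using fw_defect[OF cols(2) i, of b'] that i len by auto
    qed
    have ni: "2 * n - i \<noteq> i" using i by simp
    show "(phiw n i a > epsw n i b \<and> i \<in> set a \<and> Suc i \<notin> set a \<and> (2 * n - i \<in> set a \<or> 2 * n + 1 - i \<notin> set a)
          \<and> defect n a' i = defect n a i - 1 \<and> defect n b' i = defect n b i \<and> overlap n a' b' i = overlap n a b i)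
        \<or> (phiw n i a > epsw n i b \<and> 2 * n - i \<in> set a \<and> 2 * n + 1 - i \<notin> set a \<and> (i \<in> set a \<longrightarrow> Suc i \<in> set a)
          \<and> defect n a' i = defect n a i + 1 \<and> defect n b' i = defect n b i \<and> overlap n a' b' i = overlap n a b i + 1)
        \<or> (phiw n i a \<le> epsw n i b \<and> i \<in> set b \<and> Suc i \<notin> set b \<and> (2 * n - i \<in> set b \<or> 2 * n + 1 - i \<notin> set b)
          \<and> defect n a' i = defect n a i \<and> defect n b' i = defect n b i - 1 \<and> overlap n a' b' i = overlap n a b i - 1)
        \<or> (phiw n i a \<le> epsw n i b \<and> 2 * n - i \<in> set b \<and> 2 * n + 1 - i \<notin> set b \<and> (i \<in> set b \<longrightarrow> Suc i \<in> set b)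
          \<and> defect n a' i = defect n a i \<and> defect n b' i = defect n b i + 1 \<and> overlap n a' b' i = overlap n a b i)"
      using cs
    proof
      assume h: "epsw n i b < phiw n i a \<and> fw n i a = Some a' \<and> b' = b"
      then show ?thesis using fw_defect[OF cols(1) i, of a'] i ni len by (elim disjE conjE) auto
    next
      assume h: "phiw n i a \<le> epsw n i b \<and> fw n i b = Some b' \<and> a' = a"
      then show ?thesis using fw_defect[OF cols(2) i, of b'] i ni len by (elim disjE conjE) auto
    qed
  qed
  then show ?thesis using prec_fits adm adm' len by simp
qed

lemma prec_fw_top:
  assumes adm: "admissible n a" "admissible n b" and n: "1 \<le> n"
    and cs: "(phiw n n a > epsw n n b \<and> fw n n a = Some a' \<and> b' = b)
      \<or> (phiw n n a \<le> epsw n n b \<and> fw n n b = Some b' \<and> a' = a)"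
  shows "prec n b' a' \<longleftrightarrow> prec n b a"
proof -
  have cols: "column n a" "column n b" using adm by (auto simp: admissible_def)
  have adm': "admissible n a'" "admissible n b'"
    using cs adm cols admissible_fw n by auto
  have len: "length a' = length a" "length b' = length b" using cs fw_length by auto
  obtain j where j: "n = Suc j" using n by (cases n) auto
  have st: "defect n c n = defect n c j + (if n \<in> set c then 1 else 0) + (if Suc n \<in> set c then 1 else 0) - 1"
    if "column n c" for c using defect_step[OF that, of j] j by (simp add: bar_def)
  have K: "overlap n a b n = overlap n a b j + (if n \<in> set b then 1 else 0) + (if Suc n \<in> set a then 1 else 0) - 1"
    using overlap_step[OF cols, of j] j by simp
  have "fits n (defect n a) (defect n b) (overlap n a b) (int (length b) - int (length a)) \<longleftrightarrow>
      fits n (defect n a') (defect n b') (overlap n a' b') (int (length b) - int (length a))"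
  proof (rule fits_transfer_top[OF j st[OF cols(1)] st[OF cols(2)] K])
    have ne: "2 * n - m = n \<longleftrightarrow> m = n" if "m \<le> n" for m using that by auto
    have all: "defect n a' m = defect n a m" "defect n b' m = defect n b m" if "m \<le> n" for m
      using cs fw_defect_top[OF cols(1) n, of a'] fw_defect_top[OF cols(2) n, of b'] that by auto
    show "defect n a' m = defect n a m \<and> defect n b' m = defect n b m \<and> overlap n a' b' m = overlap n a b m"
      if "m \<noteq> n" "m \<le> n" for m
      using cs all[OF that(2)] fw_defect_top[OF cols(1) n, of a'] fw_defect_top[OF cols(2) n, of b']
        that(1) ne[OF that(2)] len by auto
    show "defect n a' n = defect n a n" "defect n b' n = defect n b n" using all by auto
    show "defect n b n = defect n a n + (int (length b) - int (length a))" by (simp add: defect_top)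
    show "(n \<in> set a \<and> Suc n \<notin> set a \<and> \<not> (Suc n \<in> set b \<and> n \<notin> set b) \<and> overlap n a' b' n = overlap n a b n + 1)
        \<or> (\<not> (n \<in> set a \<and> Suc n \<notin> set a) \<and> n \<in> set b \<and> Suc n \<notin> set b \<and> overlap n a' b' n = overlap n a b n - 1)"
      using cs
    proof
      assume h: "epsw n n b < phiw n n a \<and> fw n n a = Some a' \<and> b' = b"
      then show ?thesis
        using fw_defect_top[OF cols(1) n, of a'] column_eps_top[OF cols(1) n] column_eps_top[OF cols(2) n] len
        by (auto split: if_splits)
    next
      assume h: "phiw n n a \<le> epsw n n b \<and> fw n n b = Some b' \<and> a' = a"
      then show ?thesis
        using fw_defect_top[OF cols(2) n, of b'] column_eps_top[OF cols(1) n] column_eps_top[OF cols(2) n] len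
        by (auto split: if_splits)
    qed
  qed
  then show ?thesis using prec_fits adm adm' len by simp
qed

text \<open>The last hypothesis is the tensor product rule for the word \<open>a @ b\<close>: the
  operator acts in exactly one of the two columns.\<close>

lemma prec_fw:
  assumes "admissible n a" "admissible n b" "1 \<le> i" "i \<le> n"
    and "(phiw n i a > epsw n i b \<and> fw n i a = Some a' \<and> b' = b)
      \<or> (phiw n i a \<le> epsw n i b \<and> fw n i b = Some b' \<and> a' = a)"
  shows "prec n b' a' \<longleftrightarrow> prec n b a"
  using prec_fw_lt[of n a b i a' b'] prec_fw_top[of n a b a' b'] assms by (cases "i = n") auto

subsection \<open>Compatibility of the plactic relations with the operators f\<close>

text \<open>Relations R1 and R2. In the last two rules, Suc t is bar w and t is bar (Suc w).\<close>

inductive knuth :: "nat \<Rightarrow> nat list \<Rightarrow> nat list \<Rightarrow> bool" for n where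
  knuth_refl: "knuth n [a, b, c] [a, b, c]"
| knuth_1a: "\<lbrakk>1 \<le> x; x \<le> y; y < z; z \<le> 2 * n; x + z \<noteq> 2 * n + 1\<rbrakk> \<Longrightarrow> knuth n [y, z, x] [y, x, z]"
| knuth_1b: "\<lbrakk>1 \<le> x; x < y; y \<le> z; z \<le> 2 * n; x + z \<noteq> 2 * n + 1\<rbrakk> \<Longrightarrow> knuth n [x, z, y] [z, x, y]"
| knuth_2a: "\<lbrakk>1 \<le> w; w < n; w < y; y \<le> t; t = 2 * n - w\<rbrakk> \<Longrightarrow> knuth n [y, Suc t, w] [y, Suc w, t]"
| knuth_2b: "\<lbrakk>1 \<le> w; w < n; w < y; y \<le> t; t = 2 * n - w\<rbrakk> \<Longrightarrow> knuth n [Suc w, t, y] [Suc t, w, y]"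

text \<open>All rules as one arithmetic condition on six letters, so that after the case analysis
  only linear arithmetic remains.\<close>

lemma knuth_iff: "knuth n [a, b, c] [a', b', c'] \<longleftrightarrow>
     (a = a' \<and> b = b' \<and> c = c'
     \<or> a = a' \<and> b = c' \<and> c = b' \<and> 1 \<le> c \<and> c \<le> a \<and> a < b \<and> b \<le> 2 * n \<and> b + c \<noteq> 2 * n + 1
     \<or> a = b' \<and> b = a' \<and> c = c' \<and> 1 \<le> a \<and> a < c \<and> c \<le> b \<and> b \<le> 2 * n \<and> a + b \<noteq> 2 * n + 1
     \<or> a = a' \<and> b + c = 2 * n + 1 \<and> b' + c' = 2 * n + 1 \<and> b' = Suc c \<and> 1 \<le> c \<and> b' \<le> n \<and> b' \<le> a \<and> a \<le> c'
     \<or> c = c' \<and> a + b = 2 * n + 1 \<and> a' + b' = 2 * n + 1 \<and> a = Suc b' \<and> 1 \<le> b' \<and> a \<le> n \<and> a \<le> c \<and> c \<le> b)"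
  by (subst knuth.simps) (simp, intro iffI; elim disjE exE conjE; simp; linarith?)

lemma knuth_refl_length:
  assumes "length u = 3"
  shows "knuth n u u"
proof -
  obtain a b c where "u = [a, b, c]" using assms by (auto simp: numeral_3_eq_3 length_Suc_conv)
  then show ?thesis by (simp add: knuth_refl)
qed

text \<open>R1 and R2 have to be treated together, because an operator can lead from one to the
  other. If \<open>y\<close> carries no sign, \<open>f_i\<close> takes the R1 pair
  \<open>[y, bar (i + 1), i]\<close>, \<open>[y, i, bar (i + 1)]\<close> to the R2 pair
  \<open>[y, bar i, i]\<close>, \<open>[y, i + 1, bar (i + 1)]\<close>.\<close>

definition knuth_sync :: "nat \<Rightarrow> nat \<Rightarrow> nat list \<Rightarrow> nat list \<Rightarrow> bool" where
  "knuth_sync n i u v \<longleftrightarrow> epsw n i u = epsw n i v \<and> net n i u = net n i v \<and> rel_option (knuth n) (fw n i u) (fw n i v)"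


lemma rel_option_if:
  "rel_option R (if c then Some x else y) z \<longleftrightarrow> (c \<longrightarrow> rel_option R (Some x) z) \<and> (\<not> c \<longrightarrow> rel_option R y z)"
  "rel_option R z (if c then Some x else y) \<longleftrightarrow> (c \<longrightarrow> rel_option R z (Some x)) \<and> (\<not> c \<longrightarrow> rel_option R z y)"
  by auto

lemma fw_three_letters:
  assumes "\<And>x. phil n i x = (if ph x then 1 else 0)" "\<And>x. epsl n i x = (if ep x then 1 else 0)"
  shows "fw n i [a, b, c] = (if ph a \<and> \<not> ep b \<and> (ep c \<longrightarrow> ph b) then Some [Suc a, b, c]
      else if ph b \<and> \<not> ep c then Some [a, Suc b, c] else if ph c then Some [a, b, Suc c] else None)"
    and "epsw n i [a, b, c] = (if ep a then 1 else 0) + (if ep b \<and> \<not> ph a then 1 else 0)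
      + (if ep c \<and> \<not> ph b \<and> (ph a \<longrightarrow> ep b) then 1 else 0)"
    and "net n i [a, b, c] = (if ph a then 1 else 0) - (if ep a then 1 else 0) + (if ph b then 1 else 0)
       - (if ep b then 1 else 0) + (if ph c then 1 else 0) - (if ep c then 1 else 0)"
proof -
  have f: "fl n i x = (if ph x then Some (Suc x) else None)" for x
    using fl_None_iff[of n i x] fl_Some[of n i x] assms(1)[of x] by (cases "fl n i x") (auto split: if_splits)
  have pe: "\<not> (ph x \<and> ep x)" for x using phil_epsl[of n i x] assms(1,2)[of x] by auto
  show "fw n i [a, b, c] = (if ph a \<and> \<not> ep b \<and> (ep c \<longrightarrow> ph b) then Some [Suc a, b, c]
      else if ph b \<and> \<not> ep c then Some [a, Suc b, c] else if ph c then Some [a, b, Suc c] else None)"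
    using pe[of a] pe[of b] pe[of c]
    by (cases "ph a"; cases "ep a"; cases "ph b"; cases "ep b"; cases "ph c"; cases "ep c"; simp add: assms f)
  show "epsw n i [a, b, c] = (if ep a then 1 else 0) + (if ep b \<and> \<not> ph a then 1 else 0)
      + (if ep c \<and> \<not> ph b \<and> (ph a \<longrightarrow> ep b) then 1 else 0)"
    using pe[of a] pe[of b] pe[of c]
    by (cases "ph a"; cases "ep a"; cases "ph b"; cases "ep b"; cases "ph c"; cases "ep c"; simp add: assms)
  show "net n i [a, b, c] = (if ph a then 1 else 0) - (if ep a then 1 else 0) + (if ph b then 1 else 0)
       - (if ep b then 1 else 0) + (if ph c then 1 else 0) - (if ep c then 1 else 0)"
    by (simp add: assms)
qed

definition plus_at :: "nat \<Rightarrow> nat \<Rightarrow> nat \<Rightarrow> bool" where "plus_at i b x \<longleftrightarrow> x = i \<or> x = b"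
definition minus_at :: "nat \<Rightarrow> nat \<Rightarrow> nat \<Rightarrow> bool" where "minus_at i b x \<longleftrightarrow> x = Suc i \<or> x = Suc b"

text \<open>With \<open>b\<close> for \<open>bar (i + 1)\<close>, these are the positions of a
  letter relative to the four signed letters. Distinguishing positions and not just signs keeps the
  order information that the side conditions of the relations need.\<close>

lemma kind_cases:
  assumes "i + 2 \<le> b"
  obtains "x < i" "\<not> plus_at i b x" "\<not> minus_at i b x"
  | "x = i" "plus_at i b x" "\<not> minus_at i b x"
  | "x = Suc i" "\<not> plus_at i b x" "minus_at i b x"
  | "Suc i < x" "x < b" "\<not> plus_at i b x" "\<not> minus_at i b x"
  | "x = b" "plus_at i b x" "\<not> minus_at i b x"
  | "x = Suc b" "\<not> plus_at i b x" "minus_at i b x"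
  | "Suc b < x" "\<not> plus_at i b x" "\<not> minus_at i b x"
proof -
  consider "x < i" | "x = i" | "i < x" by linarith
  then show thesis
  proof cases
    case 1 then show thesis using assms by (intro that(1)) (auto simp: plus_at_def minus_at_def)
  next
    case 2 then show thesis using assms by (intro that(2)) (auto simp: plus_at_def minus_at_def)
  next
    case 3
    consider "x = Suc i" | "Suc i < x" "x < b" | "x = b" | "b < x" using 3 by linarith
    then show thesis
    proof cases
      case 1 then show thesis using assms by (intro that(3)) (auto simp: plus_at_def minus_at_def)
    next
      case 2 then show thesis using assms by (intro that(4)) (auto simp: plus_at_def minus_at_def)
    next
      case 3 then show thesis using assms by (intro that(5)) (auto simp: plus_at_def minus_at_def)
    next
      case 4
      show thesis
      proof (cases "x = Suc b")
        case True then show thesis using assms by (intro that(6)) (auto simp: plus_at_def minus_at_def)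
      next
        case False then show thesis using assms 4 by (intro that(7)) (auto simp: plus_at_def minus_at_def)
      qed
    qed
  qed
qed

lemma knuth_sync_lt:
  assumes I: "1 \<le> i" "i < n" and "knuth n u v"
  shows "knuth_sync n i u v"
proof -
  define b where "b = 2 * n - i"
  have B: "2 * n = i + b" "i + 2 \<le> b" using I by (auto simp: b_def)
  have P: "phil n i x = (if plus_at i b x then 1 else 0)" "epsl n i x = (if minus_at i b x then 1 else 0)" for x
    using I by (auto simp: phil_eq epsl_eq plus_at_def minus_at_def b_def)
  note f = fw_three_letters[of n i "plus_at i b" "minus_at i b", OF P]
  note K = kind_cases[OF B(2)]
  show ?thesis
    using assms(3)
  proof (induction rule: knuth.induct)
    case (knuth_refl a b c)
    have "knuth n w w" if "fw n i [a, b, c] = Some w" for w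
      using fw_length[OF that] by (intro knuth_refl_length) simp
    then show ?case
      unfolding knuth_sync_def by (cases "fw n i [a, b, c]") (simp_all only: option.rel_inject simp_thms)
  next
    case (knuth_1a x y z)
    note that = knuth_1a
    show ?case
      \<comment> \<open>Combinations of positions that contradict the order of the letters are
        discarded as soon as they arise, which keeps the case analysis small.\<close>
      apply (rule K[of x]; rule K[of y]; (insert that(2); linarith)?;
        rule K[of z]; (insert that(3) B; linarith)?)
      apply (simp_all only: knuth_sync_def f if_True if_False option.rel_inject knuth_iff option.rel_distinct simp_thms add_0_right)
      apply (insert that B I)
      apply simp_all
      done
  next
    case (knuth_1b x y z)
    note that = knuth_1b
    show ?case
      apply (rule K[of x]; rule K[of y]; (insert that(2); linarith)?;
        rule K[of z]; (insert that(3) B; linarith)?)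
      apply (simp_all only: knuth_sync_def f if_True if_False option.rel_inject knuth_iff option.rel_distinct simp_thms add_0_right)
      apply (insert that B I)
      apply simp_all
      done
  next
    case (knuth_2a w y t)
    note that = knuth_2a
    show ?case
      apply (rule K[of w]; (insert that(2) B; linarith)?;
        rule K[of "Suc w"]; (insert B; linarith)?;
        rule K[of t]; (insert that(2,5) B; linarith)?;
        rule K[of "Suc t"]; (insert B; linarith)?;
        rule K[of y]; (insert that(3,4); linarith)?)
      apply (simp_all only: knuth_sync_def f if_True if_False option.rel_inject knuth_iff option.rel_distinct simp_thms add_0_right)
      apply (insert that B I)
      apply simp_all
      done
  next
    case (knuth_2b w y t)
    note that = knuth_2b
    show ?case
      apply (rule K[of w]; (insert that(2) B; linarith)?;
        rule K[of "Suc w"]; (insert B; linarith)?;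
        rule K[of t]; (insert that(2,5) B; linarith)?;
        rule K[of "Suc t"]; (insert B; linarith)?;
        rule K[of y]; (insert that(3,4); linarith)?)
      apply (simp_all only: knuth_sync_def f if_True if_False option.rel_inject knuth_iff option.rel_distinct simp_thms add_0_right)
      apply (insert that B I)
      apply simp_all
      done
  qed
qed

lemma kind_cases_top:
  obtains "x < n" "x \<noteq> n" "x \<noteq> Suc n" | "x = n" "x \<noteq> Suc n"
  | "x = Suc n" "x \<noteq> n" | "Suc n < x" "x \<noteq> n" "x \<noteq> Suc n"
  by (cases x n rule: linorder_cases; cases "x = Suc n") auto

lemma knuth_sync_top:
  assumes I: "1 \<le> n" and "knuth n u v"
  shows "knuth_sync n n u v"
proof -
  have P: "phil n n x = (if x = n then 1 else 0)" "epsl n n x = (if x = Suc n then 1 else 0)" for x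
    using I by (auto simp: phil_top epsl_top)
  note f = fw_three_letters[of n n "\<lambda>x. x = n" "\<lambda>x. x = Suc n", OF P]
  note K = kind_cases_top[where n = n]
  show ?thesis
    using assms(2)
  proof (induction rule: knuth.induct)
    case (knuth_refl a b c)
    have "knuth n w w" if "fw n n [a, b, c] = Some w" for w
      using fw_length[OF that] by (intro knuth_refl_length) simp
    then show ?case
      unfolding knuth_sync_def by (cases "fw n n [a, b, c]") (simp_all only: option.rel_inject simp_thms)
  next
    case (knuth_1a x y z)
    note that = knuth_1a
    show ?case
      apply (rule K[of x]; rule K[of y]; (insert that(2); linarith)?;
        rule K[of z]; (insert that(3); linarith)?)
      apply (simp_all only: knuth_sync_def f if_True if_False option.rel_inject knuth_iff option.rel_distinct simp_thms add_0_right n_not_Suc_n Suc_n_not_n)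
      apply (insert that I)
      apply simp_all
      done
  next
    case (knuth_1b x y z)
    note that = knuth_1b
    show ?case
      apply (rule K[of x]; rule K[of y]; (insert that(2); linarith)?;
        rule K[of z]; (insert that(3); linarith)?)
      apply (simp_all only: knuth_sync_def f if_True if_False option.rel_inject knuth_iff option.rel_distinct simp_thms add_0_right n_not_Suc_n Suc_n_not_n)
      apply (insert that I)
      apply simp_all
      done
  next
    case (knuth_2a w y t)
    note that = knuth_2a
    show ?case
      apply (rule K[of w]; (insert that(2); linarith)?;
        rule K[of "Suc w"]; (insert I; linarith)?;
        rule K[of t]; (insert that(2,5); linarith)?;
        rule K[of "Suc t"]; (insert I; linarith)?;
        rule K[of y]; (insert that(3,4); linarith)?)
      apply (simp_all only: knuth_sync_def f if_True if_False option.rel_inject knuth_iff option.rel_distinct simp_thms add_0_right n_not_Suc_n Suc_n_not_n)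
      apply (insert that I)
      apply simp_all
      done
  next
    case (knuth_2b w y t)
    note that = knuth_2b
    show ?case
      apply (rule K[of w]; (insert that(2); linarith)?;
        rule K[of "Suc w"]; (insert I; linarith)?;
        rule K[of t]; (insert that(2,5); linarith)?;
        rule K[of "Suc t"]; (insert I; linarith)?;
        rule K[of y]; (insert that(3,4); linarith)?)
      apply (simp_all only: knuth_sync_def f if_True if_False option.rel_inject knuth_iff option.rel_distinct simp_thms add_0_right n_not_Suc_n Suc_n_not_n)
      apply (insert that I)
      apply simp_all
      done
  qed
qed

lemma plactic_sym: "plactic n u v \<Longrightarrow> plactic n v u"
  unfolding plactic_def by (rule cong_cl.sym)

lemma plactic_refl [simp]: "plactic n u u"
  unfolding plactic_def by (rule cong_cl.refl)

lemma plactic_trans: "plactic n u v \<Longrightarrow> plactic n v w \<Longrightarrow> plactic n u w"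
  unfolding plactic_def by (rule cong_cl.trans)

lemma plactic_ctxt: "plactic n u v \<Longrightarrow> plactic n (a @ u @ b) (a @ v @ b)"
  unfolding plactic_def by (rule cong_cl.ctxt)

lemma plactic_rel: "plac_rel n u v \<Longrightarrow> plactic n u v"
  unfolding plactic_def by (rule cong_cl.base)

lemma knuth_plactic:
  assumes "knuth n u v"
  shows "plactic n u v"
  using assms
proof (induction rule: knuth.induct)
  case (knuth_1a x y z)
  then show ?case using plac_rel.R1a[of n x y z] by (intro plactic_rel) (auto simp: letter_def bar_def)
next
  case (knuth_1b x y z)
  then show ?case using plac_rel.R1b[of n x y z] by (intro plactic_rel) (auto simp: letter_def bar_def)
next
  case (knuth_2a w y t)
  then have "bar n w = Suc t" "bar n (Suc w) = t" by (auto simp: bar_def)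
  then show ?case using plac_rel.R2a[of "Suc w" n y] knuth_2a by (intro plactic_rel) auto
next
  case (knuth_2b w y t)
  then have "bar n w = Suc t" "bar n (Suc w) = t" by (auto simp: bar_def)
  then show ?case using plac_rel.R2b[of "Suc w" n y] knuth_2b by (intro plactic_rel) auto
qed simp

definition fsync :: "nat \<Rightarrow> nat \<Rightarrow> nat list \<Rightarrow> nat list \<Rightarrow> bool" where
  "fsync n i u v \<longleftrightarrow> epsw n i u = epsw n i v \<and> net n i u = net n i v \<and> rel_option (plactic n) (fw n i u) (fw n i v)"

lemma knuth_fsync:
  assumes "knuth n u v" "1 \<le> i" "i \<le> n"
  shows "fsync n i u v"
proof -
  have "knuth_sync n i u v"
    using knuth_sync_lt[of i n u v] knuth_sync_top[of n u v] assms by (cases "i = n") auto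
  then show ?thesis
    unfolding knuth_sync_def fsync_def by (auto elim: option.rel_mono_strong intro: knuth_plactic)
qed

section \<open>Relation R3: contraction of columns\<close>

abbreviation letters :: "nat \<Rightarrow> nat list \<Rightarrow> bool" where
  "letters n w \<equiv> \<forall>x\<in>set w. letter n x"

text \<open>The defect without the subtracted \<open>m\<close>, which makes it additive under
  concatenation.\<close>

definition class_count :: "nat \<Rightarrow> nat list \<Rightarrow> nat \<Rightarrow> int" where
  "class_count n c m = cnt c m + int (length c) - cnt c (2 * n - m)"

lemma defect_class_count: "defect n c m = class_count n c m - int m"
  by (simp add: defect_def class_count_def)

lemma class_count_simps [simp]:
  "class_count n [] m = 0"
  "m \<le> n \<Longrightarrow> class_count n (x # c) m = (if x \<le> m \<or> 2 * n - m < x then 1 else 0) + class_count n c m"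
  "class_count n (c @ d) m = class_count n c m + class_count n d m"
  by (auto simp: class_count_def)

lemma class_count_nonneg: "m \<le> n \<Longrightarrow> class_count n c m \<ge> 0"
  by (induction c) auto

text \<open>If the first letter exceeds \<open>m\<close>, only letters above
  \<open>2 * n - m\<close> are counted. There are at most \<open>m\<close> of them, too few for
  defect 1.\<close>

lemma column_hd_le:
  assumes "column n (x # c)" "m \<le> n" "defect n (x # c) m = 1"
  shows "x \<le> m"
proof (rule ccontr)
  assume "\<not> x \<le> m"
  then have "\<forall>y\<in>set (x # c). m < y" using assms(1) by (fastforce simp: column_def)
  then have "cnt (x # c) m = 0" by (auto simp: cnt_def filter_empty_conv simp del: cnt_simps)
  moreover have "int (length (x # c)) - cnt (x # c) (2 * n - m) \<le> int m"
  proof -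
    let ?c = "x # c"
    have "length ?c = card (set ?c)" using columnD(1)[OF assms(1)] by (simp add: distinct_card)
    also have "set ?c = {y \<in> set ?c. y \<le> 2 * n - m} \<union> {y \<in> set ?c. 2 * n - m < y}" by auto
    also have "card \<dots> \<le> card {y \<in> set ?c. y \<le> 2 * n - m} + card {y \<in> set ?c. 2 * n - m < y}"
      by (rule card_Un_le)
    also have "card {y \<in> set ?c. 2 * n - m < y} \<le> card {2 * n - m<..2 * n}"
      using columnD(3)[OF assms(1)] by (intro card_mono) auto
    finally show ?thesis using cnt_card[OF columnD(1)[OF assms(1)], of "2 * n - m"] assms(2) by simp
  qed
  ultimately show False using assms(3) by (simp add: defect_def)
qed

text \<open>The mirror argument: otherwise only letters up to \<open>m\<close> are counted, again at
  most \<open>m\<close> of them.\<close>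

lemma column_last_ge:
  assumes "column n (c @ [x])" "m \<le> n" "defect n (c @ [x]) m = 1"
  shows "2 * n - m < x"
proof (rule ccontr)
  assume "\<not> 2 * n - m < x"
  then have "\<forall>y\<in>set (c @ [x]). y \<le> 2 * n - m" using assms(1) by (fastforce simp: column_def sorted_wrt_append)
  then have "cnt (c @ [x]) (2 * n - m) = int (length (c @ [x]))" by (intro cnt_top) blast
  moreover have "cnt (c @ [x]) m \<le> int m"
  proof -
    let ?c = "c @ [x]"
    have "card {y \<in> set ?c. y \<le> m} \<le> card {1..m}"
      using columnD(3)[OF assms(1)] by (intro card_mono) auto
    then show ?thesis using cnt_card[OF columnD(1)[OF assms(1)], of m] by simp
  qed
  ultimately show False using assms(3) by (simp add: defect_def)
qed

lemma letter_bar: "letter n x \<Longrightarrow> letter n (bar n x)"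
  by (auto simp: letter_def bar_def)

lemma bar_bar: "letter n x \<Longrightarrow> bar n (bar n x) = x"
  by (auto simp: letter_def bar_def)

lemma fl_bar:
  assumes "letter n x" "1 \<le> i"
  shows "el n i x = map_option (bar n) (fl n i (bar n x))"
  using assms by (auto simp: el_def fl_def bar_def letter_def)

lemma phil_bar:
  assumes "letter n x" "1 \<le> i"
  shows "phil n i (bar n x) = epsl n i x" "epsl n i (bar n x) = phil n i x"
proof -
  have *: "phil n i (bar n y) = epsl n i y" if "letter n y" for y
    using fl_bar[OF that assms(2)] by (auto simp: epsl_def phil_def)
  show "phil n i (bar n x) = epsl n i x" using *[OF assms(1)] .
  show "epsl n i (bar n x) = phil n i x"
    using *[OF letter_bar[OF assms(1)]] bar_bar[OF assms(1)] by simp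
qed

text \<open>The left-hand sides of relation R3, together with the letter that is removed.\<close>

definition contractible :: "nat \<Rightarrow> nat list \<Rightarrow> nat \<Rightarrow> bool" where
  "contractible n w z \<longleftrightarrow> column n w \<and> z \<le> n \<and> defect n w z = 1
     \<and> (\<forall>m\<le>n. defect n w m \<le> 1) \<and> (\<forall>m<z. defect n w m \<le> 0)"

text \<open>The defect rises from at most 0 to 1 at \<open>z\<close>, and it can rise only where
  both \<open>z\<close> and \<open>bar z\<close> are present.\<close>

lemma contractible_pair:
  assumes "contractible n w z"
  shows "1 \<le> z" "z \<in> set w" "bar n z \<in> set w"
proof -
  have c: "column n w" "z \<le> n" "defect n w z = 1" "\<forall>m<z. defect n w m \<le> 0"
    using assms by (auto simp: contractible_def)
  have "z \<noteq> 0" using defect_0[OF c(1)] c(3) by (intro notI) simp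
  then obtain j where j: "z = Suc j" by (cases z) auto
  have "defect n w j \<le> 0" using c(4) j by simp
  then show "1 \<le> z" "z \<in> set w" "bar n z \<in> set w"
    using defect_step[OF c(1), of j] c(2,3) j by (auto split: if_splits)
qed

lemma Ncount_gt_iff:
  assumes "column n w" "m \<le> n"
  shows "Ncount n w m > m \<longleftrightarrow> defect n w m > 0"
  using Ncount_defect[OF assms(2), of w] assms(1) by (auto simp: column_def)

text \<open>The column without its first letter is admissible, and one letter adds at most 1 to each
  defect; this bounds the defects by 1. Minimality of \<open>z\<close> among the pairs is minimality
  among all indices, since the first positive defect always occurs at a pair.\<close>

lemma contractibleI:
  assumes "column n w" "\<not> admissible n w"
    "\<forall>a u b. w = a @ u @ b \<and> u \<noteq> [] \<and> u \<noteq> w \<longrightarrow> admissible n u"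
    "z \<le> n" "z \<in> set w" "bar n z \<in> set w" "Ncount n w z > z"
    "\<forall>z'. z' \<le> n \<and> z' \<in> set w \<and> bar n z' \<in> set w \<and> Ncount n w z' > z' \<longrightarrow> z \<le> z'"
  shows "contractible n w z"
proof -
  obtain x w' where w: "w = x # w'" using assms(5) by (cases w) auto
  have "z \<noteq> bar n z" using assms(4) by (auto simp: bar_def)
  then have "w' \<noteq> []" using w assms(5,6) by auto
  then have "admissible n w'" using assms(3)[rule_format, of "[x]" w' "[]"] w by auto
  then have tl: "defect n w' m \<le> 0" if "m \<le> n" for m using that by (auto simp: admissible_defect)
  have le1: "defect n w m \<le> 1" if "m \<le> n" for m
    using tl[OF that] that w by (simp add: defect_class_count)
  have pos: "defect n w z > 0" using Ncount_gt_iff[OF assms(1,4)] assms(7) by simp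
  have "defect n w m \<le> 0" if "m < z" for m
    using that
  proof (induction m)
    case 0
    then show ?case using defect_0[OF assms(1)] by simp
  next
    case (Suc m)
    show ?case
    proof (rule ccontr)
      assume p: "\<not> defect n w (Suc m) \<le> 0"
      have m: "Suc m \<le> n" using Suc.prems assms(4) by simp
      have "defect n w m \<le> 0" using Suc by simp
      then have "Suc m \<in> set w" "bar n (Suc m) \<in> set w"
        using p defect_step[OF assms(1), of m] m by (auto split: if_splits)
      moreover have "Ncount n w (Suc m) > Suc m" using Ncount_gt_iff[OF assms(1) m] p by simp
      ultimately have "z \<le> Suc m" using assms(8) m by blast
      then show False using Suc.prems by simp
    qed
  qed
  moreover have "defect n w z = 1" using pos le1[OF assms(4)] by linarith
  ultimately show ?thesis using assms(1,4) le1 by (simp add: contractible_def)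
qed

text \<open>A proper factor misses the first or the last letter of the column. Either of them is
  counted at every index of defect 1, so no positive defect survives in the factor.\<close>

lemma contractible_plac_rel:
  assumes "contractible n w z"
  shows "plac_rel n w (filter (\<lambda>x. x \<noteq> z \<and> x \<noteq> bar n z) w)"
proof (rule plac_rel.R3)
  have c: "column n w" "z \<le> n" "defect n w z = 1" "\<forall>m\<le>n. defect n w m \<le> 1" "\<forall>m<z. defect n w m \<le> 0"
    using assms by (auto simp: contractible_def)
  show "column n w" "z \<le> n" by fact+
  show "z \<in> set w" "bar n z \<in> set w" using contractible_pair[OF assms] by auto
  show "\<not> admissible n w" using c by (force simp: admissible_defect)
  show "Ncount n w z > z" using Ncount_gt_iff[OF c(1,2)] c(3) by simp
  show "\<forall>z'. z' \<le> n \<and> z' \<in> set w \<and> bar n z' \<in> set w \<and> Ncount n w z' > z' \<longrightarrow> z \<le> z'"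
    using Ncount_gt_iff[OF c(1)] c(5) by (meson leI not_le)
  show "\<forall>a u b. w = a @ u @ b \<and> u \<noteq> [] \<and> u \<noteq> w \<longrightarrow> admissible n u"
  proof (intro allI impI)
    fix a u b assume h: "w = a @ u @ b \<and> u \<noteq> [] \<and> u \<noteq> w"
    have "column n u" using c(1) h by (auto simp: column_def sorted_wrt_append)
    moreover have "defect n u m \<le> 0" if m: "m \<le> n" for m
    proof (cases "defect n w m = 1")
      case False
      then have "defect n w m \<le> 0" using c(4) m by force
      then show ?thesis using h m class_count_nonneg[OF m, of a] class_count_nonneg[OF m, of b] by (simp add: defect_class_count)
    next
      case True
      show ?thesis
      proof (cases a)
        case (Cons x a')
        then have "x \<le> m" using column_hd_le[of n x "a' @ u @ b" m] c(1) h True m by simp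
        then show ?thesis
          using True h Cons m class_count_nonneg[OF m, of a'] class_count_nonneg[OF m, of b] by (simp add: defect_class_count)
      next
        case Nil
        then have "b \<noteq> []" using h by auto
        then obtain b' x where b: "b = b' @ [x]" by (metis rev_exhaust)
        then have "2 * n - m < x" using column_last_ge[of n "u @ b'" x m] c(1) h Nil True m by simp
        then show ?thesis
          using True h Nil b m class_count_nonneg[OF m, of b'] by (simp add: defect_class_count)
      qed
    qed
    ultimately show "admissible n u" by (simp add: admissible_defect)
  qed
qed

lemma strict_sorted_unique:
  "sorted_wrt (<) xs \<Longrightarrow> sorted_wrt (<) ys \<Longrightarrow> set xs = set (ys :: nat list) \<Longrightarrow> xs = ys"
  by (simp add: sorted_distinct_set_unique strict_sorted_iff)

lemma sorted_replace:
  assumes "sorted_wrt (<) (u @ x # v)" "Suc x \<notin> set (u @ x # v)"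
  shows "sorted_wrt (<) (u @ Suc x # v)" "set (u @ Suc x # v) = insert (Suc x) (set (u @ x # v) - {x})"
proof -
  have s: "sorted_wrt (<) u" "sorted_wrt (<) v" "\<forall>y\<in>set u. y < x" "\<forall>y\<in>set v. x < y" "\<forall>y\<in>set u. \<forall>z\<in>set v. y < z"
    using assms(1) by (auto simp: sorted_wrt_append)
  have "Suc x < y" if "y \<in> set v" for y
  proof -
    have "x < y" "y \<noteq> Suc x" using s(4) that assms(2) by auto
    then show ?thesis by simp
  qed
  moreover have "y < Suc x" if "y \<in> set u" for y using s(3) that by (simp add: less_SucI)
  ultimately show "sorted_wrt (<) (u @ Suc x # v)" using s by (auto simp: sorted_wrt_append)
  show "set (u @ Suc x # v) = insert (Suc x) (set (u @ x # v) - {x})" using s(3,4) by auto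
qed

lemma sorted_fw:
  assumes "sorted_wrt (<) c" "1 \<le> i" "i < n" "fw n i c = Some c'"
  obtains x where "sorted_wrt (<) c'" "set c' = insert (Suc x) (set c - {x})"
     "(x = i \<and> acts_low n i c)
      \<or> (x = 2 * n - i \<and> acts_high n i c)"
proof -
  from sorted_eps(3)[OF assms] obtain x u v where h: "c = u @ x # v" "c' = u @ Suc x # v" "Suc x \<notin> set c"
     "(x = i \<and> acts_low n i c)
      \<or> (x = 2 * n - i \<and> acts_high n i c)"
    by blast
  then show thesis using that[of x] sorted_replace[of u x v] assms(1) by blast
qed

lemma sorted_fw_top:
  assumes "sorted_wrt (<) c" "1 \<le> n" "fw n n c = Some c'"
  shows "sorted_wrt (<) c' \<and> set c' = insert (Suc n) (set c - {n}) \<and> n \<in> set c \<and> Suc n \<notin> set c"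
proof -
  from sorted_eps_top(3)[OF assms] obtain u v where h: "c = u @ n # v" "c' = u @ Suc n # v" 
     "n \<in> set c \<and> Suc n \<notin> set c" by blast
  then show ?thesis using sorted_replace[of u n v] assms(1) by blast
qed

definition contract :: "nat \<Rightarrow> nat \<Rightarrow> nat list \<Rightarrow> nat list" where
  "contract n z w = filter (\<lambda>x. x \<noteq> z \<and> x \<noteq> bar n z) w"

lemma contract_sorted: "sorted_wrt (<) w \<Longrightarrow> sorted_wrt (<) (contract n z w)"
  by (simp add: contract_def sorted_wrt_filter)

lemma set_contract: "set (contract n z w) = set w - {z, bar n z}"
  by (auto simp: contract_def)

lemma net_contract:
  assumes "distinct w" "z \<in> set w" "bar n z \<in> set w" "1 \<le> z" "z \<le> n" "1 \<le> i" "i \<le> n"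
  shows "net n i (contract n z w) = net n i w"
proof -
  have s: "net n i c = (\<Sum>x\<in>set c. phil n i x - epsl n i x)" if "distinct c" for c
    using that by (simp add: net_def sum_list_distinct_conv_sum_set)
  have "set w = (set w - {z, bar n z}) \<union> {z, bar n z}" using assms(2,3) by auto
  moreover have "(\<Sum>x\<in>(set w - {z, bar n z}) \<union> {z, bar n z}. phil n i x - epsl n i x)
      = (\<Sum>x\<in>set w - {z, bar n z}. phil n i x - epsl n i x) + (\<Sum>x\<in>{z, bar n z}. phil n i x - epsl n i x)"
    by (rule sum.union_disjoint) auto
  moreover have "(\<Sum>x\<in>{z, bar n z}. phil n i x - epsl n i x) = 0"
  proof -
    have "z \<noteq> bar n z" using assms(5) by (auto simp: bar_def)
    then have "(\<Sum>x\<in>{z, bar n z}. phil n i x - epsl n i x)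
        = phil n i z - epsl n i z + (phil n i (bar n z) - epsl n i (bar n z))" by simp
    also have "\<dots> = 0"
      using phil_bar[of n z i] assms(4-6) by (simp add: letter_def)
    finally show ?thesis .
  qed
  moreover have "distinct (contract n z w)" using assms(1) by (simp add: contract_def)
  ultimately show ?thesis using s[of w] s[of "contract n z w"] assms(1) unfolding set_contract by simp
qed

text \<open>The contracted pair need not stay in place: if \<open>f_i\<close> is defined, a pair at
  \<open>i\<close> moves to \<open>i + 1\<close> and a pair at \<open>i + 1\<close> moves to
  \<open>i\<close>. In these cases the operator changes different letters in \<open>w\<close> and in
  the contracted word, and the results again differ by one pair. All other pairs stay where they
  are.\<close>

lemma contractible_sync_lt:
  assumes c: "contractible n w z" and i: "1 \<le> i" "i < n"
  shows "epsw n i (contract n z w) = epsw n i w"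
    and "fw n i w = Some w' \<Longrightarrow> fw n i (contract n z w) = Some v \<Longrightarrow> \<exists>z'. contractible n w' z' \<and> v = contract n z' w'"
proof -
  have col: "column n w" and zn: "z \<le> n" and dz: "defect n w z = 1" and
    d1: "\<And>m. m \<le> n \<Longrightarrow> defect n w m \<le> 1" and d0: "\<And>m. m < z \<Longrightarrow> defect n w m \<le> 0"
    using c by (auto simp: contractible_def)
  note pr = contractible_pair[OF c]
  have bz: "bar n z = 2 * n + 1 - z" by (simp add: bar_def)
  have so: "sorted_wrt (<) w" using columnD(2)[OF col] .
  obtain j where j: "i = Suc j"
    "defect n w i = defect n w j + (if i \<in> set w then 1 else 0) + (if 2 * n + 1 - i \<in> set w then 1 else 0) - 1"
    "defect n w (Suc i) = defect n w i + (if Suc i \<in> set w then 1 else 0) + (if 2 * n - i \<in> set w then 1 else 0) - 1"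
    by (rule column_step[OF col i])
  have Di: "defect n w i \<le> 1" "defect n w j \<le> 1" "defect n w (Suc i) \<le> 1" using d1 i j(1) by auto
  \<comment> \<open>Otherwise the defect at \<open>i + 1\<close> would be 2.\<close>
  have zi: "\<not> (Suc i \<in> set w \<and> 2 * n - i \<in> set w)" if "z = i" using j(3) Di dz that by auto
  \<comment> \<open>Otherwise the defect would be negative at \<open>i\<close>, hence not positive
    at \<open>z = i + 1\<close>.\<close>
  have zi': "i \<in> set w \<or> 2 * n + 1 - i \<in> set w" if "z = Suc i"
  proof (rule ccontr)
    assume n: "\<not> ?thesis"
    have "defect n w j \<le> 0" using d0 that j(1) by simp
    then have "defect n w i < 0" using j(2) n by simp
    then show False using j(3) dz that by (auto split: if_splits)
  qed
  have mem: "x \<in> set (contract n z w) \<longleftrightarrow> x \<in> set w \<and> x \<noteq> z \<and> x \<noteq> 2 * n + 1 - z" for x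
    by (auto simp: set_contract bz)
  have ar: "i \<noteq> 2 * n + 1 - z" "Suc i \<noteq> 2 * n + 1 - z" "2 * n - i \<noteq> z" "2 * n + 1 - i \<noteq> z"
    "2 * n - i = 2 * n + 1 - z \<longleftrightarrow> z = Suc i" "2 * n + 1 - i = 2 * n + 1 - z \<longleftrightarrow> z = i"
    using zn i pr(1) by auto
  note mm = mem[of i] mem[of "Suc i"] mem[of "2 * n - i"] mem[of "2 * n + 1 - i"]
  have pz: "z = i \<Longrightarrow> i \<in> set w \<and> 2 * n + 1 - i \<in> set w" "z = Suc i \<Longrightarrow> Suc i \<in> set w \<and> 2 * n - i \<in> set w"
    using pr unfolding bz by auto
  show "epsw n i (contract n z w) = epsw n i w"
    unfolding sorted_eps(1)[OF so i] sorted_eps(1)[OF contract_sorted[OF so] i] mm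
    using zi zi' ar pz by (cases "z = i"; cases "z = Suc i") auto
  assume f: "fw n i w = Some w'" and f': "fw n i (contract n z w) = Some v"
  have col': "column n w'" using column_fw[OF col i(1) _ f] i by simp
  obtain x where x: "sorted_wrt (<) w'" "set w' = insert (Suc x) (set w - {x})" and
     xc: "(x = i \<and> acts_low n i w)
      \<or> (x = 2 * n - i \<and> acts_high n i w)"
    by (rule sorted_fw[OF so i f])
  obtain y where y: "sorted_wrt (<) v" "set v = insert (Suc y) (set (contract n z w) - {y})" and
     yc: "(y = i \<and> acts_low n i (contract n z w))
      \<or> (y = 2 * n - i \<and> acts_high n i (contract n z w))"
    by (rule sorted_fw[OF contract_sorted[OF so] i f'])
  note fd = fw_defect[OF col i f]
  have eqI: "v = contract n z' w'" if "set v = set w' - {z', bar n z'}" for z'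
    using strict_sorted_unique[OF y(1) contract_sorted[OF x(1)]] that by (simp add: set_contract)
  have sets: "insert s' (W - {p', s'} - {r'}) = insert q' (W - {p'}) - {q', r'}"
    if "s' \<in> W" "s' \<noteq> r'" "s' \<noteq> p'" "q' \<notin> W" for p' q' r' s' :: nat and W
    using that by blast
  have ni: "2 * n - i \<noteq> i" "Suc (2 * n - i) = 2 * n + 1 - i" using i by auto
  consider (a) "z = i" | (b) "z = Suc i" | (c) "z \<noteq> i" "z \<noteq> Suc i" by blast
  then show "\<exists>z'. contractible n w' z' \<and> v = contract n z' w'"
  proof cases
    case a
    \<comment> \<open>In \<open>w\<close> the letter \<open>i\<close> is raised to
      \<open>i + 1\<close>; in the contracted word, where \<open>i\<close> and \<open>bar i\<close>
      are missing, \<open>bar (i + 1)\<close> is raised to \<open>bar i\<close>.\<close>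
    then have A: "i \<in> set w" "2 * n + 1 - i \<in> set w" "Suc i \<notin> set w" "2 * n - i \<in> set w" "x = i"
      using xc pz by auto
    then have Y: "y = 2 * n - i" using yc a unfolding mm using ar by auto
    have D: "defect n w' m = defect n w m - (if m = i then 1 else 0)" if "m \<le> n" for m
      using fd A that by auto
    have "defect n w (Suc i) = 1" using j(3) dz a A by simp
    then have "contractible n w' (Suc i)" unfolding contractible_def
      using col' D d0 d1 i a dz by (auto simp: less_Suc_eq)
    moreover have "v = contract n (Suc i) w'"
    proof (rule eqI)
      have b: "bar n (Suc i) = 2 * n - i" by (simp add: bar_def)
      show "set v = set w' - {Suc i, bar n (Suc i)}"
        unfolding y(2) x(2) A(5) Y b set_contract bz unfolding a ni by (rule sets) (use A i in auto)
    qed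
    ultimately show ?thesis by blast
  next
    case b
    \<comment> \<open>The reverse situation: \<open>bar (i + 1)\<close> is raised in
      \<open>w\<close>, and \<open>i\<close> in the contracted word.\<close>
    then have A: "i \<in> set w" "2 * n + 1 - i \<notin> set w" "Suc i \<in> set w" "2 * n - i \<in> set w" "x = 2 * n - i"
      using xc pz zi' by auto
    then have Y: "y = i" using yc b unfolding mm using ar by auto
    have D: "defect n w' m = defect n w m + (if m = i then 1 else 0)" if "m \<le> n" for m
      using fd A that by auto
    have bb: "2 * n + 1 - Suc i = 2 * n - i" by simp
    have "defect n w i = 0" using j(3) dz b A by simp
    then have "contractible n w' i" unfolding contractible_def
      using col' D d0 d1 i b by auto
    moreover have "v = contract n i w'"
    proof (rule eqI)
      have b': "bar n i = 2 * n + 1 - i" by (simp add: bar_def)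
      show "set v = set w' - {i, bar n i}"
        unfolding y(2) x(2) A(5) Y b' set_contract bz unfolding b ni bb insert_commute[of i] insert_commute[of "Suc i" "2 * n - i"]
        by (rule sets) (use A i in auto)
    qed
    ultimately show ?thesis by blast
  next
    case c
    then have yx: "y = x" using xc yc ar unfolding mm by auto
    have xi: "x = i \<or> x = 2 * n - i" using xc by blast
    have xz: "x \<noteq> z" "Suc x \<noteq> z" "x \<noteq> 2 * n + 1 - z" "Suc x \<noteq> 2 * n + 1 - z"
      using xi c ar ni by auto
    have "v = contract n z w'"
      by (rule eqI) (unfold y(2) x(2) yx set_contract bz, use xz in auto)
    moreover have "contractible n w' z"
    proof -
      have "defect n w' m \<le> 1 \<and> (m < z \<longrightarrow> defect n w' m \<le> 0)" if m: "m \<le> n" for m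
      proof (cases "m = i \<and> x = 2 * n - i")
        case False
        then have "defect n w' m \<le> defect n w m" using fd m xc ni by auto
        then show ?thesis using d1[OF m] d0[of m] by auto
      next
        case True
        then have e: "defect n w' i = defect n w i + 1" "2 * n - i \<in> set w" "2 * n + 1 - i \<notin> set w" "i \<in> set w \<longrightarrow> Suc i \<in> set w"
          using fd m xc ni by auto
        \<comment> \<open>The defect at \<open>i\<close> grows to the value at \<open>i + 1\<close>
          or at \<open>i - 1\<close>. As \<open>z\<close> is neither \<open>i\<close> nor
          \<open>i + 1\<close>, such a neighbour lies below \<open>z\<close> whenever
          \<open>i\<close> does, so the bounds carry over.\<close>
        show ?thesis
        proof (cases "i \<in> set w")
          case iw: True
          then have "defect n w' i = defect n w (Suc i)" using e j(3) by simp
          moreover have "i < z \<longrightarrow> Suc i < z" using c by auto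
          ultimately show ?thesis using True Di d0[of "Suc i"] by auto
        next
          case False
          then have "defect n w' i = defect n w j" using e j(2) by simp
          then show ?thesis using True Di d0[of j] j(1) by auto
        qed
      qed
      moreover have "defect n w' z = 1" using fd dz c zn by auto
      ultimately show ?thesis using col' zn by (auto simp: contractible_def)
    qed
    ultimately show ?thesis by blast
  qed
qed

text \<open>A pair at \<open>n\<close> consists of the two letters on which \<open>f_n\<close>
  depends, whose signs cancel. So \<open>f_n\<close> is undefined on \<open>w\<close> in that case,
  and any other pair is unaffected.\<close>

lemma contractible_sync_top:
  assumes c: "contractible n w z" and n: "1 \<le> n"
  shows "epsw n n (contract n z w) = epsw n n w"
    and "fw n n w = Some w' \<Longrightarrow> fw n n (contract n z w) = Some v \<Longrightarrow> \<exists>z'. contractible n w' z' \<and> v = contract n z' w'"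
proof -
  have col: "column n w" and zn: "z \<le> n" using c by (auto simp: contractible_def)
  note pr = contractible_pair[OF c]
  have bz: "bar n z = 2 * n + 1 - z" by (simp add: bar_def)
  have so: "sorted_wrt (<) w" using columnD(2)[OF col] .
  have mem: "x \<in> set (contract n z w) \<longleftrightarrow> x \<in> set w \<and> x \<noteq> z \<and> x \<noteq> 2 * n + 1 - z" for x
    by (auto simp: set_contract bz)
  have ar: "n \<noteq> 2 * n + 1 - z" "Suc n = 2 * n + 1 - z \<longleftrightarrow> z = n" "Suc n \<noteq> z" using zn by auto
  have pz: "z = n \<Longrightarrow> n \<in> set w \<and> Suc n \<in> set w" using pr unfolding bz by auto
  show "epsw n n (contract n z w) = epsw n n w"
    unfolding sorted_eps_top(1)[OF so n] sorted_eps_top(1)[OF contract_sorted[OF so] n] mem[of n] mem[of "Suc n"]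
    using ar pz by auto
  assume f: "fw n n w = Some w'" and f': "fw n n (contract n z w) = Some v"
  note x = sorted_fw_top[OF so n f]
  note y = sorted_fw_top[OF contract_sorted[OF so] n f']
  have zz: "z \<noteq> n" using x pz by auto
  have "set v = set w' - {z, bar n z}"
    using x y zz ar by (auto simp: set_contract bz)
  then have "v = contract n z w'"
    using strict_sorted_unique[of v "contract n z w'"] contract_sorted x y by (simp add: set_contract)
  moreover have "contractible n w' z"
    using c fw_defect_top[OF col n f] column_fw[OF col n _ f] by (auto simp: contractible_def)
  ultimately show "\<exists>z'. contractible n w' z' \<and> v = contract n z' w'" by blast
qed

lemma contractible_fsync:
  assumes c: "contractible n w z" and i: "1 \<le> i" "i \<le> n"
  shows "fsync n i w (contract n z w)"
proof -
  have col: "column n w" "z \<le> n" using c by (auto simp: contractible_def)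
  have e: "epsw n i (contract n z w) = epsw n i w"
    using contractible_sync_lt(1)[OF c i(1)] contractible_sync_top(1)[OF c] i by (cases "i = n") auto
  have net: "net n i (contract n z w) = net n i w"
    using net_contract[OF columnD(1)[OF col(1)] contractible_pair(2,3,1)[OF c] col(2) i] .
  have phi: "phiw n i (contract n z w) = phiw n i w" using e net by (simp add: phiw_epsw)
  have "rel_option (plactic n) (fw n i w) (fw n i (contract n z w))"
  proof (cases "fw n i w")
    case None
    then have "fw n i (contract n z w) = None" using phi fw_None_iff[of n i] by metis
    then show ?thesis using None by simp
  next
    case (Some w')
    then obtain v where v: "fw n i (contract n z w) = Some v"
      using phi fw_None_iff[of n i w] fw_None_iff[of n i "contract n z w"] by fastforce
    have "\<exists>z'. contractible n w' z' \<and> v = contract n z' w'"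
      using contractible_sync_lt(2)[OF c i(1) _ Some v] contractible_sync_top(2)[OF c, of w' v] i Some v
      by (cases "i = n") auto
    then have "plactic n w' v" using contractible_plac_rel plactic_rel unfolding contract_def by blast
    then show ?thesis using Some v by simp
  qed
  then show ?thesis using e net by (simp add: fsync_def)
qed

lemma plac_rel_cases:
  assumes "plac_rel n u v"
  obtains "knuth n u v" "letters n u" "letters n v" | z where "contractible n u z" "v = contract n z u"
  using assms
proof cases
  case (R1a x y z)
  then show thesis using that(1) knuth_1a[of x y z n] by (auto simp: letter_def bar_def)
next
  case (R1b x y z)
  then show thesis using that(1) knuth_1b[of x y z n] by (auto simp: letter_def bar_def)
next
  case (R2a x y)
  then have e: "bar n (x - 1) = Suc (2 * n - (x - 1))" "bar n x = 2 * n - (x - 1)" "Suc (x - 1) = x"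
    by (auto simp: bar_def)
  then have "knuth n u v" using knuth_2a[of "x - 1" n y "2 * n - (x - 1)"] R2a by simp
  moreover have "letters n u" "letters n v" using R2a by (auto simp: letter_def bar_def)
  ultimately show thesis using that(1) by blast
next
  case (R2b x y)
  then have e: "bar n (x - 1) = Suc (2 * n - (x - 1))" "bar n x = 2 * n - (x - 1)" "Suc (x - 1) = x"
    by (auto simp: bar_def)
  then have "knuth n u v" using knuth_2b[of "x - 1" n y "2 * n - (x - 1)"] R2b by simp
  moreover have "letters n u" "letters n v" using R2b by (auto simp: letter_def bar_def)
  ultimately show thesis using that(1) by blast
next
  case (R3 z)
  then show thesis using that(2)[of z] contractibleI[of n u z] by (simp add: contract_def)
qed

lemma plac_rel_fsync:
  assumes "plac_rel n u v" "1 \<le> i" "i \<le> n"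
  shows "fsync n i u v"
  using assms(1) by (cases rule: plac_rel_cases) (use knuth_fsync contractible_fsync assms(2,3) in blast)+

subsection \<open>Duality and simulations\<close>

text \<open>Barring and reversing a word exchanges e_i and f_i.\<close>

definition star :: "nat \<Rightarrow> nat list \<Rightarrow> nat list" where
  "star n w = rev (map (bar n) w)"

lemma star_simps [simp]: "star n [] = []" "star n (x # w) = star n w @ [bar n x]"
  "star n (u @ v) = star n v @ star n u"
  by (simp_all add: star_def)

lemma letters_star: "letters n w \<Longrightarrow> letters n (star n w)"
  by (induction w) (auto simp: letter_bar)

lemma star_star: "letters n w \<Longrightarrow> star n (star n w) = w"
  by (induction w) (auto simp: bar_bar)

lemma star_word:
  assumes "letters n w" "1 \<le> i"
  shows "net n i (star n w) = - net n i w" "epsw n i (star n w) = phiw n i w"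
    "ew n i w = map_option (star n) (fw n i (star n w))"
proof -
  have "net n i (star n w) = - net n i w \<and> epsw n i (star n w) = phiw n i w \<and>
      ew n i w = map_option (star n) (fw n i (star n w))"
    using assms(1)
  proof (induction w)
    case (Cons x v)
    have x: "letter n x" using Cons.prems by simp
    note ph = phil_bar[OF x assms(2)]
    have IH: "net n i (star n v) = - net n i v" "epsw n i (star n v) = phiw n i v"
      "ew n i v = map_option (star n) (fw n i (star n v))" using Cons by auto
    have phi: "phiw n i (star n v) = epsw n i v" using IH phiw_epsw[of n i] by simp
    have el: "el n i x = map_option (bar n) (fl n i (bar n x))" using fl_bar[OF x assms(2)] .
    have "ew n i (x # v) = map_option (star n) (fw n i (star n v @ [bar n x]))"
    proof (cases "phil n i x \<ge> epsw n i v")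
      case False
      then show ?thesis
        using phi ph IH(3) bar_bar[OF x] phil_cases[of n i x] epsl_cases[of n i x] epsw_nonneg[of n i v]
        by (auto simp: fw_append option.map_comp o_def max_def)
    next
      case True
      then have "fw n i (star n v @ [bar n x]) = map_option (\<lambda>y. star n v @ [y]) (fl n i (bar n x))"
        using phi ph phil_cases[of n i x] epsl_cases[of n i x] phil_epsl[of n i x] fl_None_iff[of n i "bar n x"]
        by (auto simp: fw_append option.map_comp o_def)
      moreover have "star n (star n v) = v" using star_star Cons.prems by simp
      ultimately show ?thesis
        using True el epsl_cases[of n i x] el_None_iff[of n i x] by (auto simp: option.map_comp o_def)
    qed
    then show ?case
      using IH ph phiw_epsw[of n i v] phil_cases[of n i x] epsl_cases[of n i x]
      by (auto simp: epsw_append simp del: ew.simps)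
  qed simp
  then show "net n i (star n w) = - net n i w" "epsw n i (star n w) = phiw n i w"
    "ew n i w = map_option (star n) (fw n i (star n w))" by auto
qed

lemma class_count_star:
  assumes "letters n w" "m \<le> n"
  shows "class_count n (star n w) m = class_count n w m"
  using assms(1)
proof (induction w)
  case (Cons x w)
  have "bar n x \<le> m \<longleftrightarrow> 2 * n - m < x" "2 * n - m < bar n x \<longleftrightarrow> x \<le> m"
    using Cons.prems assms(2) by (auto simp: bar_def letter_def)
  then show ?case using Cons assms(2) by auto
qed simp

lemma column_star:
  assumes "column n w"
  shows "column n (star n w)"
proof -
  have w: "w \<noteq> []" "sorted_wrt (<) w" "letters n w" using assms by (auto simp: column_def)
  have "sorted_wrt (\<lambda>x y. bar n y < bar n x) w"
    by (rule sorted_wrt_mono_rel[OF _ w(2)]) (use w(3) in \<open>force simp: bar_def letter_def\<close>)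
  then have "sorted_wrt (<) (star n w)" by (simp add: star_def sorted_wrt_rev sorted_wrt_map)
  then show ?thesis using letters_star[OF w(3)] w(1) by (simp add: column_def star_def)
qed

lemma contractible_star:
  assumes "contractible n w z"
  shows "contractible n (star n w) z" "contract n z (star n w) = star n (contract n z w)"
proof -
  have c: "column n w" "z \<le> n" using assms by (auto simp: contractible_def)
  have l: "letters n w" using c by (simp add: column_def)
  have "defect n (star n w) m = defect n w m" if "m \<le> n" for m
    using class_count_star[OF l that] by (simp add: defect_class_count)
  then show "contractible n (star n w) z"
    using assms column_star[OF c(1)] by (auto simp: contractible_def)
  have lz: "letter n z" using contractible_pair(1)[OF assms] c(2) by (auto simp: letter_def)
  have "bar n x = z \<longleftrightarrow> x = bar n z" "bar n x = bar n z \<longleftrightarrow> x = z" if "x \<in> set w" for x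
    using lz l that by (auto simp: bar_def letter_def)
  then show "contract n z (star n w) = star n (contract n z w)"
    unfolding contract_def star_def rev_filter[symmetric] filter_map
    by (auto intro!: filter_cong arg_cong[of _ _ "map (bar n)"])
qed

lemma plac_rel_letters: "plac_rel n u v \<Longrightarrow> letters n u \<and> letters n v"
  by (erule plac_rel_cases) (auto simp: contractible_def column_def contract_def)

text \<open>Duality exchanges R1a with R1b and R2a with R2b, and swaps the two sides.\<close>

lemma knuth_star:
  assumes "knuth n u v" "letters n u"
  shows "knuth n (star n v) (star n u)"
  using assms
proof (induction rule: knuth.induct)
  case (knuth_refl a b c)
  then show ?case by (simp add: knuth.knuth_refl)
next
  case (knuth_1a x y z)
  then show ?case using knuth.knuth_1b[of "bar n z" "bar n y" "bar n x" n] by (auto simp: bar_def letter_def)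
next
  case (knuth_1b x y z)
  then show ?case using knuth.knuth_1a[of "bar n z" "bar n y" "bar n x" n] by (auto simp: bar_def letter_def)
next
  case (knuth_2a w y t)
  then have "bar n w = Suc t" "bar n (Suc w) = t" "bar n t = Suc w" "bar n (Suc t) = w" by (auto simp: bar_def)
  then show ?case using knuth.knuth_2b[of w n "bar n y" t] knuth_2a by (auto simp: bar_def)
next
  case (knuth_2b w y t)
  then have "bar n w = Suc t" "bar n (Suc w) = t" "bar n t = Suc w" "bar n (Suc t) = w" by (auto simp: bar_def)
  then show ?case using knuth.knuth_2a[of w n "bar n y" t] knuth_2b by (auto simp: bar_def)
qed

lemma fsync_sym: "fsync n i u v \<Longrightarrow> fsync n i v u"
  unfolding fsync_def by (cases "fw n i u"; cases "fw n i v") (auto intro: plactic_sym)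

lemma plac_rel_star:
  assumes "plac_rel n u v"
  shows "plactic n (star n u) (star n v)"
    and "1 \<le> i \<Longrightarrow> i \<le> n \<Longrightarrow> fsync n i (star n u) (star n v)"
proof -
  have "plactic n (star n u) (star n v) \<and> (1 \<le> i \<and> i \<le> n \<longrightarrow> fsync n i (star n u) (star n v))"
    using assms
  proof (cases rule: plac_rel_cases)
    case 1
    then have "knuth n (star n v) (star n u)" by (intro knuth_star)
    then show ?thesis using knuth_plactic plactic_sym knuth_fsync fsync_sym by blast
  next
    case (2 z)
    then have "contractible n (star n u) z" "star n v = contract n z (star n u)"
      using contractible_star by auto
    then show ?thesis using contractible_plac_rel[of n "star n u" z] contractible_fsync[of n "star n u" z i]
      by (simp add: contract_def plactic_rel)
  qed
  then show "plactic n (star n u) (star n v)" "1 \<le> i \<Longrightarrow> i \<le> n \<Longrightarrow> fsync n i (star n u) (star n v)"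
    by auto
qed

lemma plactic_star:
  assumes "plactic n u v"
  shows "letters n u \<longleftrightarrow> letters n v" "letters n u \<Longrightarrow> plactic n (star n u) (star n v)"
proof -
  have "(letters n u \<longleftrightarrow> letters n v) \<and> (letters n u \<longrightarrow> plactic n (star n u) (star n v))"
    using assms unfolding plactic_def
  proof (induction rule: cong_cl.induct)
    case (base a b)
    then show ?case using plac_rel_letters plac_rel_star(1)[unfolded plactic_def] by blast
  next
    case (refl a)
    then show ?case by (simp add: cong_cl.refl)
  next
    case (sym a b)
    then show ?case by (blast intro: cong_cl.sym)
  next
    case (trans a b c)
    then show ?case by (blast intro: cong_cl.trans)
  next
    case (ctxt a b u v)
    then show ?case using cong_cl.ctxt[of "plac_rel n" "star n a" "star n b" "star n v" "star n u"] by auto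
  qed
  then show "letters n u \<longleftrightarrow> letters n v" "letters n u \<Longrightarrow> plactic n (star n u) (star n v)" by auto
qed

text \<open>\<open>ew\<close> is the conjugate of \<open>fw\<close> under \<open>star\<close>, and
  \<open>star\<close> respects the plactic relations, so no second case analysis is needed for the
  raising operators.\<close>

lemma plac_rel_esync:
  assumes "plac_rel n u v" "1 \<le> i" "i \<le> n"
  shows "rel_option (plactic n) (ew n i u) (ew n i v)"
proof -
  have l: "letters n u" "letters n v" using plac_rel_letters[OF assms(1)] by auto
  have f: "rel_option (plactic n) (fw n i (star n u)) (fw n i (star n v))"
    using plac_rel_star(2)[OF assms] by (simp add: fsync_def)
  have "letters n x" if sx: "fw n i (star n u) = Some x" for x
  proof -
    obtain a y b where h: "star n u = a @ y # b" "x = a @ Suc y # b" "fl n i y = Some (Suc y)"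
      by (rule fw_position[OF sx])
    have "letters n (a @ y # b)" using letters_star[OF l(1)] h(1) by simp
    moreover have "letter n (Suc y)" using fl_bounds[OF h(3) assms(2)] by (auto simp: letter_def)
    ultimately show ?thesis using h(2) by simp
  qed
  then show ?thesis
    unfolding star_word(3)[OF l(1) assms(2)] star_word(3)[OF l(2) assms(2)] option.rel_map
    using f plactic_star(2) by (cases "fw n i (star n u)"; cases "fw n i (star n v)") auto
qed

text \<open>A bisimulation of crystal structures on words: on related words the same operators are
  defined, with related results. It captures what the plactic congruence and an isomorphism of
  components have in common.\<close>

definition csim :: "nat \<Rightarrow> (nat list \<Rightarrow> nat list \<Rightarrow> bool) \<Rightarrow> bool" where
  "csim n R \<longleftrightarrow> (\<forall>u v i. R u v \<longrightarrow> 1 \<le> i \<longrightarrow> i \<le> n \<longrightarrow>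
     rel_option R (fw n i u) (fw n i v) \<and> rel_option R (ew n i u) (ew n i v))"

lemma rel_option_sym: "rel_option R x y \<Longrightarrow> (\<And>a b. R a b \<Longrightarrow> R b a) \<Longrightarrow> rel_option R y x"
  by (cases x; cases y) auto

lemma rel_option_trans:
  "rel_option R x y \<Longrightarrow> rel_option S y z \<Longrightarrow> (\<And>a b c. R a b \<Longrightarrow> S b c \<Longrightarrow> T a c) \<Longrightarrow> rel_option T x z"
  by (cases x; cases y; cases z) auto

lemma rel_option_map:
  "rel_option R x y \<Longrightarrow> (\<And>a b. R a b \<Longrightarrow> S (f a) (g b)) \<Longrightarrow> rel_option S (map_option f x) (map_option g y)"
  by (cases x; cases y) auto

text \<open>The tensor product rule looks only at \<open>phiw\<close> and \<open>epsw\<close> of the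
  factors. Since these agree, the operator acts in the same factor on both sides, which settles the
  step into a context.\<close>

lemma plactic_sync:
  assumes "plactic n u v" "1 \<le> i" "i \<le> n"
  shows "epsw n i u = epsw n i v \<and> net n i u = net n i v \<and>
    rel_option (plactic n) (fw n i u) (fw n i v) \<and> rel_option (plactic n) (ew n i u) (ew n i v)"
  using assms(1) unfolding plactic_def
proof (induction rule: cong_cl.induct)
  case (base a b)
  then show ?case
    using plac_rel_fsync[OF _ assms(2,3), of a b] plac_rel_esync[OF _ assms(2,3), of a b]
    unfolding fsync_def plactic_def by blast
next
  case (refl a)
  then show ?case by (auto intro!: option.rel_refl cong_cl.refl)
next
  case (sym a b)
  then show ?case
    by (auto intro: rel_option_sym[OF _ cong_cl.sym])
next
  case (trans a b c)
  then show ?case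
    by (auto intro: rel_option_trans[OF _ _ cong_cl.trans])
next
  case (ctxt a b u v)
  have phi: "phiw n i a = phiw n i b" using ctxt by (simp add: phiw_epsw)
  have e: "epsw n i (a @ v) = epsw n i (b @ v)" using ctxt by (simp add: epsw_append)
  have e2: "epsw n i (u @ a @ v) = epsw n i (u @ b @ v)" using e by (simp only: epsw_append[of n i u])
  have n2: "net n i (u @ a @ v) = net n i (u @ b @ v)" using ctxt by simp
  have ab: "cong_cl (plac_rel n) (x @ a @ y) (x @ b @ y)" for x y using ctxt(1) by (rule cong_cl.ctxt)
  have cx: "cong_cl (plac_rel n) (x @ a' @ y) (x @ b' @ y)" if "cong_cl (plac_rel n) a' b'" for x y a' b'
    using that by (rule cong_cl.ctxt)
  let ?C = "cong_cl (plac_rel n)"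
  have f1: "rel_option ?C (map_option (\<lambda>u'. u' @ v) X) (map_option (\<lambda>u'. u' @ v) Y)"
    if "rel_option ?C X Y" for X Y
    by (rule rel_option_map[OF that]) (drule cx[of _ _ "[]" v], simp)
  have f2: "rel_option ?C (map_option (\<lambda>v'. u @ v') X) (map_option (\<lambda>v'. u @ v') Y)"
    if "rel_option ?C X Y" for X Y
    by (rule rel_option_map[OF that]) (drule cx[of _ _ u "[]"], simp)
  have f3: "rel_option ?C (map_option (\<lambda>u'. u' @ a @ v) X) (map_option (\<lambda>u'. u' @ b @ v) X)" for X
    using ab[of _ v] by (cases X) simp_all
  have f4: "rel_option ?C (map_option (\<lambda>v'. a @ v') X) (map_option (\<lambda>v'. b @ v') X)" for X
    using ab[of "[]"] by (cases X) simp_all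
  have IH: "rel_option ?C (fw n i a) (fw n i b)" "rel_option ?C (ew n i a) (ew n i b)" using ctxt.IH by auto
  have "rel_option ?C (fw n i (a @ v)) (fw n i (b @ v))"
    unfolding fw_append[of n i a] fw_append[of n i b] phi
    using f1[OF IH(1)] f4 by (cases "epsw n i v < phiw n i b") simp_all
  from f2[OF this] have "rel_option ?C (fw n i (u @ a @ v)) (fw n i (u @ b @ v))"
    unfolding fw_append[of n i u] e using f3 by (cases "epsw n i (b @ v) < phiw n i u") simp_all
  moreover have "rel_option ?C (ew n i (a @ v)) (ew n i (b @ v))"
    unfolding ew_append[of n i a] ew_append[of n i b] phi
    using f1[OF IH(2)] f4 by (cases "epsw n i v \<le> phiw n i b") simp_all
  from f2[OF this] have "rel_option ?C (ew n i (u @ a @ v)) (ew n i (u @ b @ v))"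
    unfolding ew_append[of n i u] e using f3 by (cases "epsw n i (b @ v) \<le> phiw n i u") simp_all
  ultimately show ?case using e2 n2 by blast
qed

lemma plactic_csim: "csim n (plactic n)"
  unfolding csim_def using plactic_sync by blast

subsection \<open>Highest weight words\<close>

declare upt_Suc [simp del]

definition hw :: "nat \<Rightarrow> nat list \<Rightarrow> bool" where
  "hw n u \<longleftrightarrow> (\<forall>i. 1 \<le> i \<and> i \<le> n \<longrightarrow> epsw n i u = 0)"

lemma hw_snoc:
  assumes "hw n (u @ [x])"
  shows "hw n u" "1 \<le> i \<Longrightarrow> i \<le> n \<Longrightarrow> epsl n i x \<le> net n i u"
proof -
  have e: "max (epsw n i u) (epsl n i x - net n i u) = 0" if "1 \<le> i" "i \<le> n" for i
  proof -
    have "epsw n i [x] = epsl n i x" using phil_cases[of n i x] epsl_cases[of n i x] phil_epsl[of n i x] by auto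
    moreover have "epsw n i (u @ [x]) = 0" using assms that by (simp add: hw_def)
    ultimately show ?thesis by (simp only: epsw_append)
  qed
  show "hw n u" unfolding hw_def
  proof (intro allI impI)
    fix i assume "1 \<le> i \<and> i \<le> n"
    then show "epsw n i u = 0" using e[of i] epsw_nonneg[of n i u] by (auto simp: max_def split: if_splits)
  qed
  show "1 \<le> i \<Longrightarrow> i \<le> n \<Longrightarrow> epsl n i x \<le> net n i u" using e[of i] by (auto simp: max_def split: if_splits)
qed

text \<open>Every letter except 1 is the end of an arrow, whose label is exhibited. In a highest
  weight word this label must have positive weight in the prefix, so few letters can follow.\<close>

lemma letter_eps:
  assumes "letter n x"
  obtains "x = 1" | i where "1 \<le> i" "i < n" "x = Suc i" "epsl n i x = 1"
  | i where "1 \<le> i" "i \<le> n" "x = bar n i" "epsl n i x = 1"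
proof -
  have x: "1 \<le> x" "x \<le> 2 * n" using assms by (auto simp: letter_def)
  consider "x = 1" | "1 < x" "x \<le> n" | "x = Suc n" | "Suc n < x"
    by atomize_elim (use x in arith)
  then show thesis
  proof cases
    case 1 then show thesis using that(1) by blast
  next
    case 2
    then show thesis using that(2)[of "x - 1"] epsl_eq[of "x - 1" n x] by auto
  next
    case 3
    then show thesis using that(3)[of n] epsl_top[of n x] x by (auto simp: bar_def)
  next
    case 4
    then show thesis using that(3)[of "2 * n + 1 - x"] epsl_eq[of "2 * n + 1 - x" n x] x by (auto simp: bar_def)
  qed
qed

lemma net_letter: "1 \<le> i \<Longrightarrow> i \<le> n \<Longrightarrow> x \<le> n \<Longrightarrow>
    phil n i x - epsl n i x = (if x = i then 1 else 0) - (if x = Suc i then 1 else 0)"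
  by (cases "i = n") (auto simp: phil_eq epsl_eq phil_top epsl_top)

lemma net_upt:
  assumes "1 \<le> i" "i \<le> n" "1 \<le> a" "a \<le> Suc b" "b \<le> n"
  shows "net n i [a..<Suc b] = (if i = b then 1 else 0) - (if Suc i = a then 1 else 0)"
proof -
  have "b \<le> n \<longrightarrow> net n i [a..<Suc b] = (if i = b then 1 else 0) - (if Suc i = a then 1 else 0)"
    if "a - 1 \<le> b"
    using that
  proof (induction b rule: dec_induct)
    case base
    then show ?case using assms by auto
  next
    case (step b)
    have "[a..<Suc (Suc b)] = [a..<Suc b] @ [Suc b]" using step.hyps assms(3) by (intro upt_Suc_append) auto
    then show ?case using step net_letter[OF assms(1,2), of "Suc b"] by auto
  qed
  then show ?thesis using assms by auto
qed

lemma letters_upt: "1 \<le> a \<Longrightarrow> b \<le> n \<Longrightarrow> letters n [a..<Suc b]"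
  by (auto simp: letter_def)

lemma class_count_upt: "m \<le> n \<Longrightarrow> b \<le> n \<Longrightarrow> class_count n [1..<Suc b] m = int (min b m)"
  by (induction b) (auto simp: upt_Suc_append)

lemma class_count_upt_mono:
  assumes "m \<le> n" "m \<le> b"
  shows "class_count n [1..<Suc b] m \<ge> int m"
proof -
  have "[1..<Suc b] = [1..<Suc m] @ [Suc m..<Suc b]" using assms(2) upt_add_eq_append[of 1 "Suc m" "b - m"] by simp
  then show ?thesis using class_count_upt[OF assms(1,1)] class_count_nonneg[OF assms(1), of "[Suc m..<Suc b]"] by simp
qed

text \<open>The letters \<open>1..i\<close> already exhaust what admissibility allows at
  \<open>i\<close>, so \<open>bar i\<close> is one too many.\<close>

lemma bar_not_appended:
  assumes "defect n ([1..<Suc b] @ s @ [bar n i]) i \<le> 0" "1 \<le> i" "i \<le> n" "i \<le> b"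
  shows False
proof -
  have "2 * n - i < bar n i" using assms(2,3) by (auto simp: bar_def)
  then show False
    using assms class_count_upt_mono[of i n b] class_count_nonneg[OF assms(3), of s] by (simp add: defect_class_count)
qed

text \<open>An admissible column or the empty word: exactly the words of the symbols of
  \<open>acol\<close>.\<close>

definition precol :: "nat \<Rightarrow> nat list \<Rightarrow> bool" where
  "precol n q \<longleftrightarrow> sorted_wrt (<) q \<and> letters n q \<and> (\<forall>m\<le>n. defect n q m \<le> 0)"

lemma precol_snoc: "precol n (q @ [x]) \<Longrightarrow> precol n q \<and> letter n x \<and> (\<forall>y\<in>set q. y < x)"
proof -
  assume h: "precol n (q @ [x])"
  have "defect n q m \<le> 0" if m: "m \<le> n" for m
    using h m class_count_nonneg[OF m, of "[x]"] by (auto simp: precol_def defect_class_count)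
  then show ?thesis using h by (auto simp: precol_def sorted_wrt_append)
qed

lemma admissible_precol: "admissible n q \<longleftrightarrow> q \<noteq> [] \<and> precol n q"
  by (auto simp: admissible_defect column_def precol_def)

text \<open>By induction on the last letter. After \<open>[1..<Suc b]\<close> the only arrow label
  of positive weight can be \<open>b\<close>, and labels above \<open>k\<close> get nothing from
  \<open>u\<close>. So the next letter is \<open>b + 1\<close>, or 1 at the start, or a barred
  letter that admissibility forbids.\<close>

lemma hw_column:
  assumes "k \<le> n" "\<And>i. k < i \<Longrightarrow> i \<le> n \<Longrightarrow> net n i u \<le> 0"
    "hw n (u @ [1..<Suc k] @ s)" "precol n ([1..<Suc k] @ s)"
  shows "\<exists>b. k \<le> b \<and> b \<le> n \<and> [1..<Suc k] @ s = [1..<Suc b]"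
  using assms(3,4)
proof (induction s rule: rev_induct)
  case Nil
  then show ?case using assms(1) by auto
next
  case (snoc x s)
  let ?q = "[1..<Suc k] @ s"
  have h: "hw n ((u @ ?q) @ [x])" using snoc.prems(1) by simp
  have pq: "precol n (?q @ [x])" using snoc.prems(2) by simp
  note pc = precol_snoc[OF pq]
  obtain b where b: "k \<le> b" "b \<le> n" "?q = [1..<Suc b]" using snoc.IH hw_snoc(1)[OF h] pc by auto
  have ne: "net n i (u @ ?q) = net n i u + (if i = b then 1 else 0)" if "1 \<le> i" "i \<le> n" for i
    using net_upt[OF that, of 1 b] b that by (simp del: append_assoc)
  have gt: "b < x" if "1 \<le> b"
  proof -
    have "b \<in> set ?q" unfolding b(3) using that by simp
    then show ?thesis using pc by blast
  qed
  have ib: "i \<le> b" if "1 \<le> i" "i \<le> n" "epsl n i x = 1" for i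
    using hw_snoc(2)[OF h that(1,2)] ne[OF that(1,2)] assms(2)[of i] that b(1) by (cases "i = b"; cases "k < i") auto
  have "letter n x" using pc by simp
  then show ?case
  proof (cases rule: letter_eps)
    case 1
    then have "b = 0" using gt by fastforce
    moreover have "1 \<le> n" using \<open>letter n x\<close> by (auto simp: letter_def)
    moreover have "?q @ [x] = [1..<Suc 1]" using b(3) 1 \<open>b = 0\<close> by (simp add: upt_Suc_append)
    ultimately show ?thesis using b(1) by (intro exI[of _ 1]) auto
  next
    case (2 i)
    then have "i = b" using ib[of i] gt by auto
    then have "?q @ [x] = [1..<Suc (Suc b)]" unfolding b(3) using 2 by (simp add: upt_Suc_append)
    then show ?thesis using b 2 \<open>i = b\<close> by (intro exI[of _ "Suc b"]) auto
  next
    case (3 i)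
    have "defect n ([1..<Suc b] @ [] @ [bar n i]) i \<le> 0"
      using pq 3 unfolding precol_def b(3) by auto
    then show ?thesis using bar_not_appended 3 ib[of i] by blast
  qed
qed

text \<open>A highest weight word of two columns is \<^term>\<open>[1..<Suc k] @ hwcol n k a b c\<close>.\<close>

definition hwcol :: "nat \<Rightarrow> nat \<Rightarrow> nat \<Rightarrow> nat \<Rightarrow> nat \<Rightarrow> nat list" where
  "hwcol n k a b c = [1..<Suc a] @ [Suc k..<Suc b] @ star n [Suc c..<Suc b]"

text \<open>\<open>a\<close> and \<open>c\<close> turn out to be the column lengths of the tableau
  of this word; the barred letters, if any, are \<open>bar b\<close>, ...,
  \<open>bar (c + 1)\<close>.\<close>

definition hwpar :: "nat \<Rightarrow> nat \<Rightarrow> nat \<Rightarrow> nat \<Rightarrow> nat \<Rightarrow> bool" where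
  "hwpar n k a b c \<longleftrightarrow> a \<le> k \<and> k \<le> b \<and> b \<le> n \<and> a \<le> c \<and> c \<le> b"

lemma net_hwcol:
  assumes "hwpar n k a b c" "1 \<le> i" "i \<le> n"
  shows "net n i ([1..<Suc k] @ hwcol n k a b c) = (if i = a then 1 else 0) + (if i = c then 1 else 0)"
proof -
  have "net n i (star n [Suc c..<Suc b]) = - net n i [Suc c..<Suc b]"
    using assms by (intro star_word(1) letters_upt) (auto simp: hwpar_def)
  then show ?thesis
    using assms net_upt[OF assms(2,3), of 1 k] net_upt[OF assms(2,3), of 1 a]
      net_upt[OF assms(2,3), of "Suc k" b] net_upt[OF assms(2,3), of "Suc c" b]
    by (simp add: hwpar_def hwcol_def)
qed

text \<open>By induction on the last letter. By \<open>net_hwcol\<close> only labels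
  \<open>a\<close> and \<open>c\<close> have positive weight, so a new letter other than 1 ends an
  arrow with one of these labels, and it extends one of the three runs of \<open>hwcol\<close> or
  violates admissibility.\<close>

lemma hw_two_columns:
  assumes "k \<le> n" "hw n ([1..<Suc k] @ q)" "precol n q"
  shows "\<exists>a b c. hwpar n k a b c \<and> q = hwcol n k a b c"
  using assms(2,3)
proof (induction q rule: rev_induct)
  case Nil
  show ?case using assms(1) by (intro exI[of _ 0] exI[of _ k]) (auto simp: hwpar_def hwcol_def)
next
  case (snoc x q)
  have h: "hw n (([1..<Suc k] @ q) @ [x])" using snoc.prems(1) by simp
  note pc = precol_snoc[OF snoc.prems(2)]
  obtain a b c where abc: "hwpar n k a b c" and q: "q = hwcol n k a b c"
    using snoc.IH hw_snoc(1)[OF h] pc by blast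
  have par: "a \<le> k" "k \<le> b" "b \<le> n" "a \<le> c" "c \<le> b" using abc by (auto simp: hwpar_def)
  have iac: "i = a \<or> i = c" if "1 \<le> i" "i \<le> n" "epsl n i x = 1" for i
    using hw_snoc(2)[OF h that(1,2)] net_hwcol[OF abc that(1,2)] that(3) q by (auto split: if_splits)
  have gt: "y < x" if "y \<in> set q" for y using pc that by blast
  have cb: "c = b" if "x \<le> n"
  proof (rule ccontr)
    assume "c \<noteq> b"
    then have "bar n b \<in> set q" using par by (auto simp: q hwcol_def star_def)
    then have "bar n b < x" by (rule gt)
    then show False using that par by (auto simp: bar_def)
  qed
  have bx: "b < x" if "k < b" using gt[of b] that by (auto simp: q hwcol_def)
  have "letter n x" using pc by simp
  then show ?case
  proof (cases rule: letter_eps)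
    case 1
    have n1: "1 \<le> n" using \<open>letter n x\<close> by (auto simp: letter_def)
    have c: "c = b" using cb 1 n1 by simp
    have b: "b = k" using bx 1 par by (cases "k < b") auto
    have a: "a = 0"
    proof (rule ccontr)
      assume "a \<noteq> 0"
      then have "1 \<in> set q" by (auto simp: q hwcol_def)
      then show False using gt[of 1] 1 by simp
    qed
    show ?thesis
    \<comment> \<open>The letter 1 opens the first run, except for \<open>k = 0\<close>: there
      \<open>a \<le> k\<close> keeps that run empty, and 1 opens the second one.\<close>
    proof (cases "k = 0")
      case True
      then show ?thesis using a b c 1 n1
        by (intro exI[of _ 0] exI[of _ 1]) (auto simp: q hwcol_def hwpar_def upt_Suc_append)
    next
      case False
      then show ?thesis using a b c 1 par
        by (intro exI[of _ 1] exI[of _ k]) (auto simp: q hwcol_def hwpar_def upt_Suc_append)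
    qed
  next
    case (2 i)
    have c: "c = b" using cb 2 by simp
    show ?thesis
    proof (cases "i = b")
      case True
      have "q @ [x] = hwcol n k a (Suc b) (Suc b)" using c 2 True par by (simp add: q hwcol_def upt_Suc_append)
      moreover have "hwpar n k a (Suc b) (Suc b)" using par 2 True by (auto simp: hwpar_def)
      ultimately show ?thesis by blast
    next
      case False
      then have i: "i = a" using iac[of i] 2 c by auto
      have b: "b = k" using bx 2 par i by (cases "k < b") auto
      have "q @ [x] = hwcol n k (Suc a) k k" using b c 2 i par by (simp add: q hwcol_def upt_Suc_append)
      moreover have "hwpar n k (Suc a) k k" using par 2 b i False by (auto simp: hwpar_def)
      ultimately show ?thesis by blast
    qed
  next
    case (3 i)
    \<comment> \<open>The column already contains \<open>1..a\<close>, so \<open>bar a\<close>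
      cannot be added.\<close>
    have "i \<noteq> a"
    proof
      assume "i = a"
      then have "defect n ([1..<Suc a] @ ([Suc k..<Suc b] @ star n [Suc c..<Suc b]) @ [bar n i]) i \<le> 0"
        using snoc.prems(2) 3 par unfolding precol_def q hwcol_def by auto
      then show False using bar_not_appended[of n a _ i] 3 \<open>i = a\<close> by blast
    qed
    then have i: "i = c" using iac[of i] 3 by auto
    then obtain c' where c': "c = Suc c'" using 3 by (cases c) auto
    have "[Suc c'..<Suc b] = c # [Suc c..<Suc b]" using c' par by (simp add: upt_conv_Cons)
    then have "q @ [x] = hwcol n k a b c'" using 3 i by (simp add: q hwcol_def)
    moreover have "hwpar n k a b c'" using par c' i \<open>i \<noteq> a\<close> by (auto simp: hwpar_def)
    ultimately show ?thesis by blast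
  qed
qed

section \<open>Tableaux of highest weight pairs\<close>

lemma plactic_R1a: "\<lbrakk>1 \<le> x; x \<le> y; y < z; z \<le> n\<rbrakk> \<Longrightarrow> plactic n (u @ [y, z, x] @ v) (u @ [y, x, z] @ v)"
  by (intro plactic_ctxt plactic_rel plac_rel.R1a) (auto simp: letter_def bar_def)

lemma plactic_R1b: "\<lbrakk>1 \<le> x; x < y; y \<le> z; z \<le> n\<rbrakk> \<Longrightarrow> plactic n (u @ [x, z, y] @ v) (u @ [z, x, y] @ v)"
  by (intro plactic_ctxt plactic_rel plac_rel.R1b) (auto simp: letter_def bar_def)

lemma plactic_append: "plactic n u u' \<Longrightarrow> plactic n v v' \<Longrightarrow> plactic n (u @ v) (u' @ v')"
  using plactic_ctxt[of n u u' "[]" v] plactic_ctxt[of n v v' u' "[]"] plactic_trans by simp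

lemma move_left_over_larger:
  assumes "1 \<le> x" "x \<le> k" "k \<le> n"
  shows "plactic n ([x..<Suc k] @ [x]) ([x, x] @ [Suc x..<Suc k])"
  using assms(2,3)
proof (induction k rule: dec_induct)
  case base
  then show ?case by (simp add: upt_conv_Cons)
next
  case (step k)
  have e: "[x..<Suc k] = [x..<k] @ [k]" "[x..<Suc (Suc k)] = [x..<Suc k] @ [Suc k]"
    using step.hyps by (simp_all add: upt_Suc_append)
  have "plactic n ([x..<k] @ [k, Suc k, x] @ []) ([x..<k] @ [k, x, Suc k] @ [])"
    using step assms(1) by (intro plactic_R1a) auto
  then have "plactic n ([x..<Suc (Suc k)] @ [x]) (([x..<Suc k] @ [x]) @ [Suc k])" unfolding e by simp
  from plactic_trans[OF this] have "plactic n ([x..<Suc (Suc k)] @ [x]) (([x, x] @ [Suc x..<Suc k]) @ [Suc k])"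
    using plactic_append[OF step.IH plactic_refl] step.prems by simp
  moreover have "([x, x] @ [Suc x..<Suc k]) @ [Suc k] = [x, x] @ [Suc x..<Suc (Suc k)]"
    using step.hyps by (simp add: upt_Suc_append)
  ultimately show ?case by simp
qed

lemma move_left_over_smaller:
  assumes "x \<le> n" "j < x"
  shows "plactic n ([1..<Suc j] @ [x] @ [Suc j..<Suc x]) ([x] @ [1..<Suc x])"
  using assms(2)
proof (induction j)
  case 0
  then show ?case by simp
next
  case (Suc j)
  have e: "[1..<Suc (Suc j)] = [1..<Suc j] @ [Suc j]" by (simp add: upt_Suc_append)
  have f: "[Suc (Suc j)..<Suc x] = Suc (Suc j) # [Suc (Suc (Suc j))..<Suc x]"
    "[Suc j..<Suc x] = Suc j # Suc (Suc j) # [Suc (Suc (Suc j))..<Suc x]"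
    using Suc.prems by (simp_all add: upt_conv_Cons)
  have "plactic n ([1..<Suc j] @ [Suc j, x, Suc (Suc j)] @ [Suc (Suc (Suc j))..<Suc x])
     ([1..<Suc j] @ [x, Suc j, Suc (Suc j)] @ [Suc (Suc (Suc j))..<Suc x])"
    using Suc.prems assms(1) by (intro plactic_R1b) auto
  then have "plactic n ([1..<Suc (Suc j)] @ [x] @ [Suc (Suc j)..<Suc x]) ([1..<Suc j] @ [x] @ [Suc j..<Suc x])"
    unfolding e f by simp
  from plactic_trans[OF this Suc.IH] show ?case using Suc.prems by simp
qed

text \<open>By induction on \<open>a\<close>. The new letter \<open>x = a + 1\<close> moves left
  over the larger letters until it meets the \<open>x\<close> of the long column; then one of the
  two copies moves left over \<open>1..a\<close> and completes the short column in front.\<close>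

lemma plactic_swap_columns:
  assumes "a \<le> k" "k \<le> n"
  shows "plactic n ([1..<Suc k] @ [1..<Suc a]) ([1..<Suc a] @ [1..<Suc k])"
  using assms(1)
proof (induction a)
  case 0
  then show ?case by simp
next
  case (Suc a)
  let ?x = "Suc a"
  have s: "[1..<Suc k] = [1..<?x] @ [?x..<Suc k]" using Suc.prems upt_add_eq_append[of 1 ?x "Suc k - ?x"] by simp
  have s2: "[?x..<Suc k] = ?x # [Suc ?x..<Suc k]" using Suc.prems by (simp add: upt_conv_Cons)
  have "plactic n ([1..<Suc k] @ [1..<Suc a]) ([1..<Suc a] @ [1..<Suc k])" using Suc by simp
  then have "plactic n (([1..<Suc k] @ [1..<Suc a]) @ [?x]) (([1..<Suc a] @ [1..<Suc k]) @ [?x])"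
    by (rule plactic_append) simp
  also have "(([1..<Suc a] @ [1..<Suc k]) @ [?x]) = ([1..<Suc a] @ [1..<?x]) @ ([?x..<Suc k] @ [?x])"
    unfolding s by simp
  finally have 1: "plactic n (([1..<Suc k] @ [1..<Suc a]) @ [?x]) (([1..<Suc a] @ [1..<?x]) @ ([?x..<Suc k] @ [?x]))" .
  have 2: "plactic n (([1..<Suc a] @ [1..<?x]) @ ([?x..<Suc k] @ [?x])) (([1..<Suc a] @ [1..<?x]) @ ([?x, ?x] @ [Suc ?x..<Suc k]))"
    by (rule plactic_append[OF plactic_refl move_left_over_larger]) (use Suc.prems assms(2) in auto)
  have "plactic n ([1..<Suc a] @ [?x] @ [?x]) ([?x] @ [1..<Suc ?x])"
    using move_left_over_smaller[of ?x n a] Suc.prems assms(2) by (simp add: upt_conv_Cons)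
  then have 3: "plactic n ([1..<Suc a] @ ([1..<Suc a] @ [?x] @ [?x]) @ [Suc ?x..<Suc k])
     ([1..<Suc a] @ ([?x] @ [1..<Suc ?x]) @ [Suc ?x..<Suc k])"
    by (rule plactic_ctxt)
  have 4: "[1..<Suc a] @ ([?x] @ [1..<Suc ?x]) @ [Suc ?x..<Suc k] = [1..<Suc ?x] @ [1..<Suc k]"
    unfolding s s2 by (simp add: upt_Suc_append)
  have "plactic n (([1..<Suc k] @ [1..<Suc a]) @ [?x]) ([1..<Suc ?x] @ [1..<Suc k])"
    using plactic_trans[OF plactic_trans[OF 1 2]] 3 unfolding 4 by simp
  moreover have "[1..<Suc ?x] = [1..<Suc a] @ [?x]" by (simp add: upt_Suc_append)
  ultimately show ?case by simp
qed

text \<open>An instance of R3 at \<open>b\<close>: the defect is 0 below \<open>b\<close>, 1 at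
  \<open>b\<close>, and not positive above.\<close>

lemma plactic_cancel_bar:
  assumes "1 \<le> b" "b \<le> n"
  shows "plactic n ([1..<Suc b] @ [bar n b]) [1..<b]"
proof -
  have bb: "n < bar n b" "bar n b \<le> 2 * n" using assms by (auto simp: bar_def)
  have k: "defect n ([1..<Suc b] @ [bar n b]) m = int (min b m) + (if b \<le> m then 1 else 0) - int m" if "m \<le> n" for m
  proof -
    have "2 * n - m < bar n b \<longleftrightarrow> b \<le> m" using assms that by (auto simp: bar_def)
    then show ?thesis using class_count_upt[OF that assms(2)] bb that by (simp add: defect_class_count)
  qed
  have col: "column n ([1..<Suc b] @ [bar n b])"
    using assms bb by (auto simp: column_def sorted_wrt_append letter_def)
  have "contractible n ([1..<Suc b] @ [bar n b]) b"
    using k assms col by (auto simp: contractible_def)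
  then have "plac_rel n ([1..<Suc b] @ [bar n b]) (filter (\<lambda>x. x \<noteq> b \<and> x \<noteq> bar n b) ([1..<Suc b] @ [bar n b]))"
    by (rule contractible_plac_rel)
  moreover have "filter (\<lambda>x. x \<noteq> b \<and> x \<noteq> bar n b) ([1..<Suc b] @ [bar n b]) = [1..<b]"
    using assms bb by (auto simp: upt_Suc_append)
  ultimately show ?thesis using plactic_rel by metis
qed

lemma plactic_cancel_bars:
  assumes "c \<le> b" "b \<le> n"
  shows "plactic n ([1..<Suc b] @ star n [Suc c..<Suc b]) [1..<Suc c]"
  using assms
proof (induction b rule: dec_induct)
  case base
  then show ?case by simp
next
  case (step b)
  have "[Suc c..<Suc (Suc b)] = [Suc c..<Suc b] @ [Suc b]" using step.hyps by (simp add: upt_Suc_append)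
  then have e: "star n [Suc c..<Suc (Suc b)] = [bar n (Suc b)] @ star n [Suc c..<Suc b]" by simp
  have "plactic n (([1..<Suc (Suc b)] @ [bar n (Suc b)]) @ star n [Suc c..<Suc b]) ([1..<Suc b] @ star n [Suc c..<Suc b])"
    using plactic_cancel_bar[of "Suc b" n] step.prems by (intro plactic_append) (auto)
  then have "plactic n ([1..<Suc (Suc b)] @ star n [Suc c..<Suc (Suc b)]) ([1..<Suc b] @ star n [Suc c..<Suc b])"
    unfolding e by simp
  then show ?case using step plactic_trans by (meson Suc_leD)
qed

text \<open>Swapping \<open>[1..<Suc k]\<close> with \<open>[1..<Suc a]\<close> brings the former
  next to \<open>[Suc k..<Suc b]\<close>. Together they form \<open>[1..<Suc b]\<close>, against
  which the barred letters cancel one by one.\<close>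

lemma plactic_hwcol:
  assumes "hwpar n k a b c"
  shows "plactic n ([1..<Suc k] @ hwcol n k a b c) ([1..<Suc a] @ [1..<Suc c])"
proof -
  have par: "a \<le> k" "k \<le> b" "b \<le> n" "a \<le> c" "c \<le> b" using assms by (auto simp: hwpar_def)
  have e: "[1..<Suc k] @ [Suc k..<Suc b] = [1..<Suc b]"
    using par upt_add_eq_append[of 1 "Suc k" "b - k"] by simp
  let ?s = "star n [Suc c..<Suc b]"
  have "plactic n (([1..<Suc k] @ [1..<Suc a]) @ ([Suc k..<Suc b] @ ?s)) (([1..<Suc a] @ [1..<Suc k]) @ ([Suc k..<Suc b] @ ?s))"
    by (rule plactic_append[OF plactic_swap_columns]) (use par in auto)
  also have "([1..<Suc a] @ [1..<Suc k]) @ ([Suc k..<Suc b] @ ?s) = [1..<Suc a] @ ([1..<Suc b] @ ?s)"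
    unfolding e[symmetric] by simp
  finally have "plactic n ([1..<Suc k] @ hwcol n k a b c) ([1..<Suc a] @ ([1..<Suc b] @ ?s))"
    by (simp add: hwcol_def)
  moreover have "plactic n ([1..<Suc a] @ ([1..<Suc b] @ ?s)) ([1..<Suc a] @ [1..<Suc c])"
    by (rule plactic_append[OF plactic_refl plactic_cancel_bars]) (use par in auto)
  ultimately show ?thesis by (rule plactic_trans)
qed

lemma length_hwcol: "hwpar n k a b c \<Longrightarrow> length (hwcol n k a b c) = a + (b - k) + (b - c)"
  by (simp add: hwcol_def star_def)

lemma precol_upt: "b \<le> n \<Longrightarrow> precol n [1..<Suc b]"
  using class_count_upt[of _ n b] by (auto simp: precol_def defect_class_count letter_def)

lemma cnt_upt: "cnt [1..<Suc b] v = int (min b v)"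
  by (induction b) (auto simp: upt_Suc_append)

lemma prec_upt:
  assumes "1 \<le> a" "a \<le> b" "b \<le> n"
  shows "prec n [1..<Suc b] [1..<Suc a]"
proof -
  have ad: "admissible n [1..<Suc b]" "admissible n [1..<Suc a]"
    using assms precol_upt by (auto simp: admissible_precol)
  show ?thesis
    unfolding prec_defect[OF ad]
    unfolding defect_def cnt_upt using assms by auto
qed

text \<open>For \<open>v = m \<le> k\<close> the first inequality of \<open>prec_defect\<close> says
  that \<open>q\<close> has at least \<open>v\<close> letters up to \<open>v\<close>, so none of
  \<open>1..k\<close> is missing.\<close>

lemma prec_upt_prefix:
  assumes "prec n q [1..<Suc k]" "1 \<le> k" "k \<le> n"
  obtains s where "q = [1..<Suc k] @ s"
proof -
  have ad: "admissible n q" "admissible n [1..<Suc k]" using assms by (auto simp: prec_def)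
  have col: "column n q" using ad by (simp add: admissible_def)
  have so: "sorted_wrt (<) q" using columnD(2)[OF col] .
  have ge: "int v \<le> cnt q v" if "v \<le> k" for v
  proof -
    have "defect n [1..<Suc k] v \<le> cnt q v + int (length [1..<Suc k]) - cnt [1..<Suc k] (2 * n - v) - int v"
      using assms(1) that assms(3) unfolding prec_defect[OF ad] by (meson le_refl le_trans)
    then show ?thesis using that assms unfolding defect_def cnt_upt by simp
  qed
  have q0: "0 \<notin> set q" using columnD(3)[OF col, of 0] by auto
  have le: "cnt q v \<le> int v" for v
    by (induction v) (use cnt_0[OF q0] cnt_step[OF so] in auto)
  have "{1..k} \<subseteq> set q"
  proof
    fix x assume x: "x \<in> {1..k}"
    then obtain v where v: "x = Suc v" "v < k" by (cases x) auto
    then have "int (Suc v) \<le> cnt q (Suc v)" using ge[of "Suc v"] v by simp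
    then show "x \<in> set q" using cnt_step[OF so, of v] le[of v] v by (auto split: if_splits)
  qed
  moreover have "1 \<le> x" if "x \<in> set q" for x using columnD(3)[OF col that] by simp
  ultimately have "set q = set ([1..<Suc k] @ filter (\<lambda>x. k < x) q)" by (auto simp: not_less)
  moreover have "sorted_wrt (<) ([1..<Suc k] @ filter (\<lambda>x. k < x) q)"
    using so by (auto simp: sorted_wrt_append sorted_wrt_filter)
  ultimately show thesis using strict_sorted_unique[OF so] that by blast
qed

subsection \<open>Normal forms\<close>

definition col_of :: "nat list \<Rightarrow> acol" where
  "col_of c = (if c = [] then Eps else Col c)"

lemma pc_col_of [simp]: "pc (col_of c) = c"
  by (simp add: col_of_def)

lemma valid_acolD:
  assumes "valid_acol n a"
  shows "col_of (pc a) = a" "precol n (pc a)" "pc a = [] \<longleftrightarrow> a = Eps"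
proof -
  have "precol n []" by (simp add: precol_def defect_def)
  then show "col_of (pc a) = a" "precol n (pc a)" "pc a = [] \<longleftrightarrow> a = Eps"
    using assms by (cases a; auto simp: col_of_def admissible_precol)+
qed

lemma valid_col_of: "precol n c \<Longrightarrow> valid_acol n (col_of c)"
  by (simp add: col_of_def admissible_precol)

lemma p_simps [simp]: "p [] = []" "p (a # w) = pc a @ p w" "p (u @ v) = p u @ p v"
  by (simp_all add: p_def)

lemma acol_word_simps [simp]: "acol_word n []" "acol_word n (a # w) \<longleftrightarrow> valid_acol n a \<and> acol_word n w"
  "acol_word n (u @ v) \<longleftrightarrow> acol_word n u \<and> acol_word n v"
  by (auto simp: acol_word_def)

definition shape :: "acol list \<Rightarrow> nat list" where
  "shape w = map (\<lambda>a. length (pc a)) w"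

lemma shape_simps [simp]: "shape [] = []" "shape (a # w) = length (pc a) # shape w"
  by (simp_all add: shape_def)

lemma shape_length: "shape u = shape v \<Longrightarrow> length u = length v"
  unfolding shape_def by (metis length_map)

text \<open>The shape tells where to cut the underlying word; entries 0 are the empty
  columns.\<close>

lemma acol_word_eqI:
  assumes "acol_word n u" "acol_word n v" "shape u = shape v" "p u = p v"
  shows "u = v"
  using assms
proof (induction u arbitrary: v)
  case Nil
  then show ?case by (cases v) auto
next
  case (Cons a u)
  then obtain b v' where v: "v = b # v'" by (cases v) auto
  then have "pc a = pc b" "p u = p v'" using Cons.prems by auto
  then show ?case using Cons v valid_acolD(1) by (metis acol_word_simps(2) list.inject shape_simps(2))
qed

text \<open>The edges of the crystal graph, with the regrouping replaced by the conditions that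
  determine it.\<close>

definition step :: "nat \<Rightarrow> nat \<Rightarrow> acol list \<Rightarrow> acol list \<Rightarrow> bool" where
  "step n i w w' \<longleftrightarrow> acol_word n w \<and> acol_word n w' \<and> shape w' = shape w \<and> fw n i (p w) = Some (p w')"

lemma valid_fw:
  assumes "valid_acol n a" "1 \<le> i" "i \<le> n" "fw n i (pc a) = Some c"
  shows "valid_acol n (col_of c)" "length c = length (pc a)"
proof -
  obtain d where a: "a = Col d" using assms(4) by (cases a) auto
  then have "admissible n d" "column n d" using assms(1) by (auto simp: admissible_def)
  then have "admissible n c" using admissible_fw[of n d i c] assms a by simp
  then show "valid_acol n (col_of c)" by (simp add: col_of_def admissible_precol)
  show "length c = length (pc a)" using fw_length[OF assms(4)] .
qed

lemma valid_ew:
  assumes "valid_acol n a" "1 \<le> i" "i \<le> n" "ew n i (pc a) = Some c"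
  shows "valid_acol n (col_of c)" "length c = length (pc a)"
proof -
  have f: "fw n i c = Some (pc a)" using assms(4) by (simp add: fw_ew)
  obtain d where a: "a = Col d" using assms(4) by (cases a) auto
  then have d: "admissible n d" "column n d" using assms(1) by (auto simp: admissible_def)
  have "column n c" using column_fw_inv[of n d i c] d a assms f by simp
  then have "admissible n c" using admissible_fw[of n c i d] assms a d f by simp
  then show "valid_acol n (col_of c)" by (simp add: col_of_def admissible_precol)
  show "length c = length (pc a)" using fw_length[OF f] by simp
qed

lemma step_fw_ex:
  assumes "acol_word n w" "1 \<le> i" "i \<le> n" "fw n i (p w) = Some u"
  obtains w' where "step n i w w'" "p w' = u"
proof -
  have "\<exists>w'. acol_word n w' \<and> shape w' = shape w \<and> p w' = u"
    using assms(1,4)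
  proof (induction w arbitrary: u)
    case (Cons a w)
    show ?case
    proof (cases "phiw n i (pc a) > epsw n i (p w)")
      case True
      then obtain c where c: "fw n i (pc a) = Some c" "u = c @ p w"
        using Cons.prems by (auto simp: fw_append)
      show ?thesis using valid_fw[OF _ assms(2,3) c(1)] Cons.prems c(2)
        by (intro exI[of _ "col_of c # w"]) auto
    next
      case False
      then obtain x where x: "fw n i (p w) = Some x" "u = pc a @ x"
        using Cons.prems by (auto simp: fw_append)
      then obtain w' where "acol_word n w' \<and> shape w' = shape w \<and> p w' = x" using Cons by auto
      then show ?thesis using Cons.prems x(2) by (intro exI[of _ "a # w'"]) auto
    qed
  qed simp
  then show thesis using that assms unfolding step_def by blast
qed

lemma step_ew_ex:
  assumes "acol_word n w" "1 \<le> i" "i \<le> n" "ew n i (p w) = Some u"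
  obtains w' where "step n i w' w" "p w' = u"
proof -
  have "\<exists>w'. acol_word n w' \<and> shape w' = shape w \<and> p w' = u"
    using assms(1,4)
  proof (induction w arbitrary: u)
    case (Cons a w)
    show ?case
    proof (cases "phiw n i (pc a) \<ge> epsw n i (p w)")
      case True
      then obtain c where c: "ew n i (pc a) = Some c" "u = c @ p w"
        using Cons.prems by (auto simp: ew_append)
      show ?thesis using valid_ew[OF _ assms(2,3) c(1)] Cons.prems c(2)
        by (intro exI[of _ "col_of c # w"]) auto
    next
      case False
      then obtain x where x: "ew n i (p w) = Some x" "u = pc a @ x"
        using Cons.prems by (auto simp: ew_append)
      then obtain w' where "acol_word n w' \<and> shape w' = shape w \<and> p w' = x" using Cons by auto
      then show ?thesis using Cons.prems x(2) by (intro exI[of _ "a # w'"]) auto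
    qed
  qed simp
  then obtain w' where w': "acol_word n w'" "shape w' = shape w" "p w' = u" by blast
  then have "step n i w' w" using assms by (simp add: step_def fw_ew)
  then show thesis using that w'(3) by blast
qed

lemma step_det: "step n i u v \<Longrightarrow> step n i u v' \<Longrightarrow> v = v'"
  unfolding step_def by (intro acol_word_eqI[of n]) auto

lemma step_inj:
  assumes "step n i u v" "step n i u' v"
  shows "u = u'"
proof (rule acol_word_eqI)
  show "acol_word n u" "acol_word n u'" "shape u = shape u'" using assms by (auto simp: step_def)
  show "p u = p u'" using assms fw_inj unfolding step_def by blast
qed

lemma regroup_shape:
  "acol_word n w \<Longrightarrow> acol_word n w' \<Longrightarrow> shape w' = shape w \<Longrightarrow> regroup w (p w') = w'"
proof (induction w arbitrary: w')
  case Nil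
  then show ?case by (cases w') auto
next
  case (Cons a w)
  then obtain b v where w': "w' = b # v" by (cases w') auto
  then have IH: "regroup w (p v) = v" using Cons by auto
  have b: "valid_acol n b" "length (pc b) = length (pc a)" "valid_acol n a" using Cons.prems w' by auto
  show ?case
  proof (cases a)
    case Eps
    then show ?thesis using b valid_acolD(3)[OF b(1)] IH w' by simp
  next
    case (Col c)
    then have "pc b \<noteq> []" using b valid_acolD(3)[OF b(3)] by auto
    then obtain d where "b = Col d" by (cases b) auto
    then show ?thesis using Col b IH w' by simp
  qed
qed

lemma edge_step: "edge n i w w' \<longleftrightarrow> 1 \<le> i \<and> i \<le> n \<and> step n i w w'"
proof
  assume e: "edge n i w w'"
  then have h: "1 \<le> i" "i \<le> n" "acol_word n w" "fa n i w = Some w'" by (auto simp: edge_def)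
  then obtain u where u: "fw n i (p w) = Some u" "w' = regroup w u" by (auto simp: fa_def)
  obtain v where v: "step n i w v" "p v = u" by (rule step_fw_ex[OF h(3,1,2) u(1)])
  then have "w' = v" using u(2) regroup_shape[of n w v] by (simp add: step_def)
  then show "1 \<le> i \<and> i \<le> n \<and> step n i w w'" using v h by simp
next
  assume "1 \<le> i \<and> i \<le> n \<and> step n i w w'"
  then show "edge n i w w'" using regroup_shape[of n w w'] by (auto simp: edge_def step_def fa_def)
qed

lemma step_Cons:
  assumes "step n i (a # r) w'"
  shows "(\<exists>a'. w' = a' # r \<and> valid_acol n a' \<and> phiw n i (pc a) > epsw n i (p r) \<and> fw n i (pc a) = Some (pc a'))
    \<or> (\<exists>r'. w' = a # r' \<and> phiw n i (pc a) \<le> epsw n i (p r) \<and> step n i r r')"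
proof -
  obtain b r' where w': "w' = b # r'" using assms by (cases w') (auto simp: step_def)
  have h: "valid_acol n a" "valid_acol n b" "acol_word n r" "acol_word n r'" "length (pc b) = length (pc a)"
    "shape r' = shape r" "fw n i (pc a @ p r) = Some (pc b @ p r')"
    using assms w' by (auto simp: step_def)
  show ?thesis
  proof (cases "phiw n i (pc a) > epsw n i (p r)")
    case True
    then obtain c where c: "fw n i (pc a) = Some c" "pc b @ p r' = c @ p r" using h(7) by (auto simp: fw_append)
    then have "pc b = c" "p r' = p r" using fw_length[OF c(1)] h(5) by auto
    then show ?thesis using acol_word_eqI[OF h(4,3,6)] w' True c(1) h(2) by auto
  next
    case False
    then obtain x where x: "fw n i (p r) = Some x" "pc b @ p r' = pc a @ x" using h(7) by (auto simp: fw_append)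
    then have "pc b = pc a" "p r' = x" using h(5) by auto
    moreover from this have "b = a" using valid_acolD(1) h(1,2) by metis
    ultimately show ?thesis using w' False x(1) h by (auto simp: step_def)
  qed
qed

section \<open>Normal forms under operators and bisimulations\<close>

abbreviation NF :: "nat \<Rightarrow> acol list \<Rightarrow> bool" where
  "NF n w \<equiv> successively (\<lambda>a b. ext_prec n b a) w"

lemma ext_prec_fw:
  assumes "valid_acol n a" "valid_acol n b" "valid_acol n a'" "valid_acol n b'" "1 \<le> i" "i \<le> n"
    and cs: "(phiw n i (pc a) > epsw n i (pc b) \<and> fw n i (pc a) = Some (pc a') \<and> b' = b)
      \<or> (phiw n i (pc a) \<le> epsw n i (pc b) \<and> fw n i (pc b) = Some (pc b') \<and> a' = a)"
  shows "ext_prec n b' a' \<longleftrightarrow> ext_prec n b a"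
proof -
  have "length (pc a') = length (pc a)" "length (pc b') = length (pc b)" using cs fw_length by auto
  then have e: "a' = Eps \<longleftrightarrow> a = Eps" "b' = Eps \<longleftrightarrow> b = Eps"
    using assms(1-4)[THEN valid_acolD(3)] by auto
  show ?thesis
  proof (cases "a = Eps \<or> b = Eps")
    case True
    then show ?thesis using e by (cases a; cases b; cases a'; cases b') auto
  next
    case False
    then obtain x y x' y' where "a = Col x" "b = Col y" "a' = Col x'" "b' = Col y'"
      using e by (metis acol.exhaust)
    then show ?thesis using prec_fw[of n x y i x' y'] assms by auto
  qed
qed

text \<open>Only pairs next to the changed column matter, and for such a pair the tensor product
  rule decides as it does for the whole word: \<open>epsw\<close> of the remaining word bounds that
  of its first column, and equals it if the operator acts in that column.\<close>

lemma step_NF: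
  assumes "1 \<le> i" "i \<le> n" "step n i w w'"
  shows "NF n w' \<longleftrightarrow> NF n w"
  using assms(3)
proof (induction w arbitrary: w')
  case (Cons a r)
  have va: "valid_acol n a" "acol_word n r" using Cons.prems by (auto simp: step_def)
  from step_Cons[OF Cons.prems] show ?case
  proof (elim disjE exE conjE)
    fix a' assume h: "w' = a' # r" "valid_acol n a'" "phiw n i (pc a) > epsw n i (p r)" "fw n i (pc a) = Some (pc a')"
    show ?thesis
    proof (cases r)
      case (Cons b r2)
      have "epsw n i (pc b) \<le> epsw n i (p r)" using Cons by (simp add: epsw_append)
      then have "ext_prec n b a' \<longleftrightarrow> ext_prec n b a"
        using ext_prec_fw[of n a b a' b i] va Cons h assms(1,2) by auto
      then show ?thesis using h Cons by simp
    qed (use h in simp)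
  next
    fix r' assume h: "w' = a # r'" "phiw n i (pc a) \<le> epsw n i (p r)" "step n i r r'"
    note IH = Cons.IH[OF h(3)]
    show ?thesis
    proof (cases r)
      case Nil
      then show ?thesis using h by (auto simp: step_def)
    next
      case (Cons b r2)
      from step_Cons[OF h(3)[unfolded Cons]] show ?thesis
      proof (elim disjE exE conjE)
        fix b' assume b: "r' = b' # r2" "valid_acol n b'" "phiw n i (pc b) > epsw n i (p r2)" "fw n i (pc b) = Some (pc b')"
        have "epsw n i (p r) = epsw n i (pc b)" using Cons b(3) phiw_epsw[of n i "pc b"] by (simp add: epsw_append)
        then have "ext_prec n b' a \<longleftrightarrow> ext_prec n b a"
          using ext_prec_fw[of n a b a b' i] va Cons h b assms(1,2) by auto
        then show ?thesis using h Cons b IH by simp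
      next
        fix r2' assume "r' = b # r2'"
        then show ?thesis using h Cons IH by simp
      qed
    qed
  qed
qed (simp add: step_def)

lemma hw_append: "hw n (u @ v) \<Longrightarrow> hw n u"
  unfolding hw_def using epsw_nonneg by (metis epsw_append max.cobounded1 order_antisym)

text \<open>\<open>f_i\<close> replaces a letter by its numerical successor, so raising lowers the
  sum of the letters. This is the measure for the inductions towards highest weight.\<close>

lemma step_sum_list: "step n i u v \<Longrightarrow> sum_list (p v) = Suc (sum_list (p u))"
  unfolding step_def by (elim conjE fw_position) simp

lemma raise_or_hw:
  assumes "acol_word n w"
  obtains "hw n (p w)" | i w1 where "1 \<le> i" "i \<le> n" "step n i w1 w" "ew n i (p w) = Some (p w1)"
proof (cases "hw n (p w)")
  case False
  then obtain i where i: "1 \<le> i" "i \<le> n" "epsw n i (p w) \<noteq> 0" by (auto simp: hw_def)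
  then obtain u where u: "ew n i (p w) = Some u" using ew_None_iff by (metis not_None_eq)
  obtain w1 where "step n i w1 w" "p w1 = u" by (rule step_ew_ex[OF assms i(1,2) u])
  then show thesis using that(2) i u by blast
qed (use that in blast)

lemma csimD:
  assumes "csim n R" "R u v" "1 \<le> i" "i \<le> n"
  shows "rel_option R (fw n i u) (fw n i v)" "rel_option R (ew n i u) (ew n i v)"
  using assms unfolding csim_def by auto

text \<open>\<open>epsw\<close> is the number of times \<open>e_i\<close> can be applied, which a
  bisimulation preserves.\<close>

lemma csim_eps:
  assumes "csim n R" "1 \<le> i" "i \<le> n" "R u v"
  shows "epsw n i u = epsw n i v"
  using assms(4)
proof (induction "nat (epsw n i u)" arbitrary: u v)
  case 0
  then have "epsw n i u = 0" using epsw_nonneg[of n i u] by simp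
  then have "ew n i u = None" by (simp add: ew_None_iff)
  then have "ew n i v = None" using csimD(2)[OF assms(1) 0(2) assms(2,3)] by simp
  then show ?case using \<open>epsw n i u = 0\<close> by (simp add: ew_None_iff)
next
  case (Suc k)
  have "ew n i u \<noteq> None" using Suc.hyps(2) by (auto simp: ew_None_iff)
  then obtain u' v' where uv: "ew n i u = Some u'" "ew n i v = Some v'" "R u' v'"
    using csimD(2)[OF assms(1) Suc.prems assms(2,3)] by (cases "ew n i v") auto
  have e: "epsw n i u = epsw n i u' + 1" "epsw n i v = epsw n i v' + 1"
    using uv fw_Some(1)[of n i] fw_ew[of n i] by auto
  then have "k = nat (epsw n i u')" using Suc.hyps(2) epsw_nonneg[of n i u'] by simp
  then show ?case using Suc.hyps(1)[OF _ uv(3)] e by simp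
qed

lemma csim_phi:
  assumes "csim n R" "1 \<le> i" "i \<le> n" "R u v"
  shows "phiw n i u = phiw n i v"
  using assms(4)
proof (induction "nat (phiw n i u)" arbitrary: u v)
  case 0
  then have "phiw n i u = 0" using phiw_nonneg[of n i u] by simp
  then have "fw n i u = None" by (simp add: fw_None_iff)
  then have "fw n i v = None" using csimD(1)[OF assms(1) 0(2) assms(2,3)] by simp
  then show ?case using \<open>phiw n i u = 0\<close> by (simp add: fw_None_iff)
next
  case (Suc k)
  have "fw n i u \<noteq> None" using Suc.hyps(2) by (auto simp: fw_None_iff)
  then obtain u' v' where uv: "fw n i u = Some u'" "fw n i v = Some v'" "R u' v'"
    using csimD(1)[OF assms(1) Suc.prems assms(2,3)] by (cases "fw n i v") auto
  have e: "phiw n i u = phiw n i u' + 1" "phiw n i v = phiw n i v' + 1"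
    using fw_Some(1,2)[OF uv(1)] fw_Some(1,2)[OF uv(2)] by (auto simp: phiw_epsw)
  then have "k = nat (phiw n i u')" using Suc.hyps(2) phiw_nonneg[of n i u'] by simp
  then show ?case using Suc.hyps(1)[OF _ uv(3)] e by simp
qed

lemma csim_net:
  assumes "csim n R" "1 \<le> i" "i \<le> n" "R u v"
  shows "net n i u = net n i v"
  using csim_eps[OF assms] csim_phi[OF assms] by (simp add: phiw_epsw)

lemma csim_comp:
  assumes "csim n R" "csim n S"
  shows "csim n (R OO S)"
  unfolding csim_def
proof (intro allI impI)
  fix u v i assume h: "(R OO S) u v" "1 \<le> i" "i \<le> n"
  then obtain x where x: "R u x" "S x v" by auto
  show "rel_option (R OO S) (fw n i u) (fw n i v) \<and> rel_option (R OO S) (ew n i u) (ew n i v)"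
    using csimD[OF assms(1) x(1) h(2,3)] csimD[OF assms(2) x(2) h(2,3)]
    by (auto intro: rel_option_trans)
qed

section \<open>Highest weight normal forms\<close>

definition ycol :: "nat \<Rightarrow> acol" where
  "ycol k = col_of [1..<Suc k]"

lemma pc_ycol [simp]: "pc (ycol k) = [1..<Suc k]"
  by (simp add: ycol_def)

lemma valid_ycol: "k \<le> n \<Longrightarrow> valid_acol n (ycol k)"
  unfolding ycol_def by (intro valid_col_of precol_upt)

lemma ycol_0: "ycol 0 = Eps"
  by (simp add: ycol_def col_of_def)

lemma ycol_pos: "0 < k \<Longrightarrow> ycol k = Col [1..<Suc k]"
  by (simp add: ycol_def col_of_def)

lemma ext_prec_ycol: "a \<le> b \<Longrightarrow> b \<le> n \<Longrightarrow> ext_prec n (ycol b) (ycol a)"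
  using prec_upt[of a b n] by (cases "a = 0") (auto simp: ycol_0 ycol_pos)

text \<open>The column order forces each column to begin with \<open>1..k\<close>, where
  \<open>k\<close> is the length of its predecessor. As \<open>k\<close> is the largest length so
  far, the prefix has no positive weight above \<open>k\<close>, and \<open>hw_column\<close>
  applies.\<close>

lemma hw_NF:
  assumes "acol_word n w" "NF n w" "hw n (p w)"
  shows "\<exists>ks. w = map ycol ks \<and> sorted ks \<and> (\<forall>k\<in>set ks. k \<le> n)"
  using assms
proof (induction w rule: rev_induct)
  case Nil
  show ?case by (intro exI[of _ "[]"]) simp
next
  case (snoc c w)
  have "hw n (p w)" using snoc.prems(3) hw_append by simp
  then obtain ks where ks: "w = map ycol ks" "sorted ks" "\<forall>k\<in>set ks. k \<le> n"
    using snoc by (auto simp: successively_append_iff)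
  \<comment> \<open>For the first column the default 0 makes the condition on its initial letters
    void.\<close>
  define k where "k = (if ks = [] then 0 else last ks)"
  have "k = 0 \<or> k \<in> set ks" by (simp add: k_def)
  then have kn: "k \<le> n" using ks(3) by auto
  have k: "\<forall>j\<in>set ks. j \<le> k" "k \<le> n"
    using ks(2) kn by (auto simp: k_def sorted_iff_nth_mono in_set_conv_nth last_conv_nth)
  have prec: "ks \<noteq> [] \<Longrightarrow> ext_prec n c (ycol k)"
    using snoc.prems(2) ks(1) by (auto simp: successively_append_iff k_def last_map)
  have net0: "net n i (p (map ycol js)) \<le> 0" if "\<forall>j\<in>set js. j \<le> k" "k < i" "i \<le> n" for i js
    using that
  proof (induction js)
    case (Cons j js)
    then show ?case using net_upt[of i n 1 j] by auto
  qed simp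
  have net: "net n i (p w) \<le> 0" if "k < i" "i \<le> n" for i
    using net0[OF k(1) that] ks(1) by simp
  have pcc: "precol n (pc c)" using snoc.prems(1) valid_acolD(2) by simp
  have "\<exists>s. pc c = [1..<Suc k] @ s"
  proof (cases "k = 0")
    case False
    then have "ks \<noteq> []" by (auto simp: k_def)
    then have e: "ext_prec n c (ycol k)" by (rule prec)
    then obtain d where d: "c = Col d" using False by (cases c) (auto simp: ycol_pos)
    then have "prec n d [1..<Suc k]" using e False by (simp add: ycol_pos)
    then show ?thesis using prec_upt_prefix[of n d k] d False k(2) by auto
  qed simp
  then obtain s where s: "pc c = [1..<Suc k] @ s" by blast
  obtain b where b: "k \<le> b" "b \<le> n" "pc c = [1..<Suc b]"
    using hw_column[OF k(2) net, of s] snoc.prems(3) pcc s by auto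
  have "c = ycol b" using valid_acolD(1)[of n c] snoc.prems(1) b(3) by (simp add: ycol_def)
  then show ?case using ks b k(1)
    by (intro exI[of _ "ks @ [b]"]) (auto simp: sorted_append)
qed

lemma net_ycols:
  assumes "1 \<le> i" "i \<le> n" "\<forall>k\<in>set ks. k \<le> n"
  shows "net n i (p (map ycol ks)) = int (count_list ks i)"
  using assms(3)
proof (induction ks)
  case (Cons k ks)
  then show ?case using net_upt[OF assms(1,2), of 1 k] assms(1) by auto
qed simp

lemma sorted_count_eqI:
  "sorted ks \<Longrightarrow> sorted ls \<Longrightarrow> (\<And>i. count_list ks i = count_list ls i) \<Longrightarrow> ks = (ls :: nat list)"
proof (induction ks arbitrary: ls)
  case Nil
  then show ?case by (metis count_list.simps(1) count_list_0_iff list.set_intros(1) neq_Nil_conv)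
next
  case (Cons x ks)
  have "x \<in> set ls" using Cons.prems(3)[of x] count_list_0_iff[of ls x] by auto
  then obtain y ls' where ls: "ls = y # ls'" by (cases ls) auto
  have "y \<in> set (x # ks)" using Cons.prems(3)[of y] ls count_list_0_iff[of "x # ks" y] by auto
  then have xy: "x = y" using \<open>x \<in> set ls\<close> Cons.prems(1,2) ls by force
  have "count_list ks i = count_list ls' i" for i using Cons.prems(3)[of i] ls xy by (auto split: if_splits)
  then show ?case using Cons ls xy by simp
qed

text \<open>The entries 0 are invisible to weights; their multiplicity is supplied by the total
  length.\<close>

lemma sorted_eqI:
  assumes "sorted ks" "sorted ls" "length ks = length ls" "\<And>i. 1 \<le> i \<Longrightarrow> count_list ks i = count_list ls i"
  shows "ks = (ls :: nat list)"
proof -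
  let ?X = "insert 0 (set ks \<union> set ls)"
  have "sum (count_list ks) (?X - {0}) = sum (count_list ls) (?X - {0})"
    by (rule sum.cong) (use assms(4) in auto)
  moreover have "sum (count_list xs) ?X = count_list xs 0 + sum (count_list xs) (?X - {0})" for xs
    by (rule sum.remove) auto
  moreover have "sum (count_list ks) ?X = length ks" "sum (count_list ls) ?X = length ls"
    by (rule sum_count_set; auto)+
  ultimately have "count_list ks 0 = count_list ls 0" using assms(3) by simp
  then have "count_list ks i = count_list ls i" for i using assms(4)[of i] by (cases "i = 0") auto
  then show ?thesis by (rule sorted_count_eqI[OF assms(1,2)])
qed

text \<open>Raising to highest weight, where the normal form is determined by its weight.\<close>

lemma NF_unique:
  assumes "csim n R" "acol_word n w" "acol_word n w'" "NF n w" "NF n w'" "length w = length w'" "R (p w) (p w')"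
  shows "w = w'"
  using assms(2-)
proof (induction "sum_list (p w)" arbitrary: w w' rule: less_induct)
  case less
  show ?case
  proof (cases rule: raise_or_hw[OF less.prems(1)])
    case 1
    have "hw n (p w')" using 1 csim_eps[OF assms(1) _ _ less.prems(6)] by (simp add: hw_def)
    then obtain ls where ls: "w' = map ycol ls" "sorted ls" "\<forall>k\<in>set ls. k \<le> n"
      using hw_NF less.prems by blast
    obtain ks where ks: "w = map ycol ks" "sorted ks" "\<forall>k\<in>set ks. k \<le> n"
      using hw_NF less.prems 1 by blast
    have "count_list ks i = count_list ls i" if "1 \<le> i" for i
    proof (cases "i \<le> n")
      case True
      then show ?thesis
        using csim_net[OF assms(1) that True less.prems(6)] net_ycols[OF that True ks(3)] net_ycols[OF that True ls(3)]
          ks(1) ls(1) by simp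
    next
      case False
      then have "i \<notin> set ks" "i \<notin> set ls" using ks(3) ls(3) by auto
      then show ?thesis by (simp add: count_notin)
    qed
    then have "ks = ls" using sorted_eqI ks ls less.prems(5) by simp
    then show ?thesis using ks ls by simp
  next
    case (2 i w1)
    then obtain u where u: "ew n i (p w') = Some u" "R (p w1) u"
      using csimD(2)[OF assms(1) less.prems(6) 2(1,2)] by (cases "ew n i (p w')") auto
    obtain w1' where w1': "step n i w1' w'" "p w1' = u" by (rule step_ew_ex[OF less.prems(2) 2(1,2) u(1)])
    have "shape w1 = shape w" "shape w1' = shape w'" using 2(3) w1'(1) by (auto simp: step_def)
    then have "length w1 = length w1'" using less.prems(5) shape_length[of w1 w] shape_length[of w1' w'] by simp
    moreover have "NF n w1" "NF n w1'" using step_NF[OF 2(1,2)] 2(3) w1'(1) less.prems(3,4) by auto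
    moreover have "acol_word n w1" "acol_word n w1'" using 2(3) w1'(1) by (auto simp: step_def)
    moreover have "sum_list (p w1) < sum_list (p w)" using step_sum_list[OF 2(3)] by simp
    ultimately have "w1 = w1'" using less.hyps u(2) w1'(2) by blast
    then show ?thesis using step_det 2(3) w1'(1) by blast
  qed
qed

section \<open>Pairs of columns\<close>

lemma length2E:
  assumes "length w = 2"
  obtains a b where "w = [a, b]"
  using assms by (auto simp: length_Suc_conv numeral_2_eq_2)

lemma hw_pair:
  assumes "acol_word n [c1, c2]" "hw n (p [c1, c2])"
  obtains k a b c where "hwpar n k a b c" "c1 = ycol k" "c2 = col_of (hwcol n k a b c)"
    "pc c1 = [1..<Suc k]" "pc c2 = hwcol n k a b c"
proof -
  have v: "valid_acol n c1" "valid_acol n c2" using assms by auto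
  have "hw n (pc c1)" using assms(2) hw_append by simp
  then obtain k where k: "k \<le> n" "pc c1 = [1..<Suc k]"
    using hw_column[of 0 n "[]" "pc c1"] valid_acolD(2)[OF v(1)] by auto
  obtain a b c where "hwpar n k a b c" "pc c2 = hwcol n k a b c"
    using hw_two_columns[OF k(1), of "pc c2"] assms(2) k(2) valid_acolD(2)[OF v(2)] by auto
  then show thesis using that[of k a b c] k valid_acolD(1)[OF v(1)] valid_acolD(1)[OF v(2)]
    unfolding ycol_def by metis
qed

lemma two_point_eq:
  fixes a c a' c' :: nat
  assumes "\<And>i. 1 \<le> i \<Longrightarrow> i \<le> n \<Longrightarrow>
      (if i = a then 1 else 0) + (if i = c then 1 else 0) = ((if i = a' then 1 else 0) + (if i = c' then 1 else 0) :: int)"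
    and "a \<le> c" "a' \<le> c'" "c \<le> n" "c' \<le> n"
  shows "a = a' \<and> c = c'"
proof -
  have "sorted [a, c]" "sorted [a', c']" using assms by auto
  moreover have "count_list [a, c] i = count_list [a', c'] i" if "1 \<le> i" for i
    using assms(1)[OF that] assms(2-5) by (cases "i \<le> n") (auto split: if_splits)
  ultimately have "[a, c] = [a', c']" by (intro sorted_eqI) auto
  then show ?thesis by simp
qed

text \<open>After raising both pairs to highest weight, the weight gives \<open>a\<close> and
  \<open>c\<close>, the first column length gives \<open>k\<close>, and the second then gives
  \<open>b\<close>. This is the injectivity of insertion on pairs of fixed shape.\<close>

lemma pair_unique:
  assumes "csim n R" "acol_word n w" "acol_word n w'" "length w = 2" "shape w = shape w'" "R (p w) (p w')"
  shows "w = w'"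
  using assms(2-)
proof (induction "sum_list (p w)" arbitrary: w w' rule: less_induct)
  case less
  show ?case
  proof (cases rule: raise_or_hw[OF less.prems(1)])
    case 1
    have h': "hw n (p w')" using 1 csim_eps[OF assms(1) _ _ less.prems(5)] by (simp add: hw_def)
    obtain c1 c2 where w: "w = [c1, c2]" using less.prems(3) by (rule length2E)
    have "length w' = 2" using shape_length[OF less.prems(4)] less.prems(3) by simp
    then obtain d1 d2 where w': "w' = [d1, d2]" by (rule length2E)
    obtain k a b c where 2: "hwpar n k a b c" "c1 = ycol k" "c2 = col_of (hwcol n k a b c)"
      "pc c1 = [1..<Suc k]" "pc c2 = hwcol n k a b c"
      by (rule hw_pair[OF less.prems(1)[unfolded w] 1[unfolded w]])
    obtain l a' b' c' where 3: "hwpar n l a' b' c'" "d1 = ycol l" "d2 = col_of (hwcol n l a' b' c')"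
      "pc d1 = [1..<Suc l]" "pc d2 = hwcol n l a' b' c'"
      by (rule hw_pair[OF less.prems(2)[unfolded w'] h'[unfolded w']])
    have kl: "k = l" using less.prems(4) w w' 2 3 by simp
    have "a = a' \<and> c = c'"
    proof (rule two_point_eq)
      fix i assume i: "1 \<le> i" "i \<le> n"
      show "(if i = a then 1 else 0) + (if i = c then 1 else 0) = ((if i = a' then 1 else 0) + (if i = c' then 1 else 0) :: int)"
        using csim_net[OF assms(1) i less.prems(5)] net_hwcol[OF 2(1) i] net_hwcol[OF 3(1) i] 2(4,5) 3(4,5) w w'
        by simp
    qed (use 2(1) 3(1) in \<open>auto simp: hwpar_def\<close>)
    moreover have "b = b'"
      using less.prems(4) length_hwcol[OF 2(1)] length_hwcol[OF 3(1)] 2 3 w w' kl calculation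
      by (auto simp: hwpar_def)
    ultimately show ?thesis using 2 3 w w' kl by simp
  next
    case (2 i w1)
    then obtain u where u: "ew n i (p w') = Some u" "R (p w1) u"
      using csimD(2)[OF assms(1) less.prems(5) 2(1,2)] by (cases "ew n i (p w')") auto
    obtain w1' where w1': "step n i w1' w'" "p w1' = u" by (rule step_ew_ex[OF less.prems(2) 2(1,2) u(1)])
    have sh: "shape w1 = shape w" "shape w1' = shape w'" using 2(3) w1'(1) by (auto simp: step_def)
    then have "length w1 = 2" "shape w1 = shape w1'" using less.prems(3,4) shape_length[of w1 w] by auto
    moreover have "acol_word n w1" "acol_word n w1'" using 2(3) w1'(1) by (auto simp: step_def)
    moreover have "sum_list (p w1) < sum_list (p w)" using step_sum_list[OF 2(3)] by simp
    ultimately have "w1 = w1'" using less.hyps u(2) w1'(2) by blast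
    then show ?thesis using step_det 2(3) w1'(1) by blast
  qed
qed

subsection \<open>Insertion and the main theorem\<close>

abbreviation len :: "acol \<Rightarrow> nat" where
  "len a \<equiv> length (pc a)"

text \<open>At highest weight the tableau is the pair of columns of lengths \<open>a\<close> and
  \<open>c\<close>, and the estimates follow from the bounds in \<open>hwpar\<close>. Lowering
  carries everything back: it preserves lengths, plactic congruence and normality.\<close>

lemma pair_reduction:
  assumes "acol_word n w" "w = [c1, c2]"
  shows "\<exists>d1 d2. acol_word n [d1, d2] \<and> NF n [d1, d2] \<and> plactic n (p [d1, d2]) (p w) \<and>
    len d1 \<le> len c1 \<and> len d1 + len d2 \<le> len c1 + len c2 \<and>
    (\<not> NF n w \<longrightarrow> len d1 \<noteq> len c1 \<or> len d1 + len d2 \<noteq> len c1 + len c2)"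
  using assms
proof (induction "sum_list (p w)" arbitrary: w c1 c2 rule: less_induct)
  case less
  show ?case
  proof (cases rule: raise_or_hw[OF less.prems(1)])
    case 1
    obtain k a b c where h: "hwpar n k a b c" "c1 = ycol k" "c2 = col_of (hwcol n k a b c)"
      "pc c1 = [1..<Suc k]" "pc c2 = hwcol n k a b c"
      by (rule hw_pair[OF less.prems(1)[unfolded less.prems(2)] 1[unfolded less.prems(2)]])
    have par: "a \<le> k" "k \<le> b" "b \<le> n" "a \<le> c" "c \<le> b" using h(1) by (auto simp: hwpar_def)
    have l: "len c1 = k" "len c2 = a + (b - k) + (b - c)" "len (ycol a) = a" "len (ycol c) = c"
      using h(4,5) length_hwcol[OF h(1)] by simp_all
    \<comment> \<open>If neither length drops, then \<open>b = c\<close>. No bars occur, the second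
      column is \<open>[1..<Suc b]\<close>, and the pair was normal from the start.\<close>
    have nf: "NF n w" if "a = k" "a + c = k + (a + (b - k) + (b - c))"
    proof -
      have "b = c" using that par by simp
      then have "hwcol n k a b c = [1..<Suc b]"
        using that(1) par upt_add_eq_append[of 1 "Suc k" "b - k"] by (simp add: hwcol_def)
      then have "c2 = ycol b" using h(3) by (simp add: ycol_def)
      then show ?thesis using less.prems(2) h(2) ext_prec_ycol[of k b n] par by simp
    qed
    have "plactic n (p [ycol a, ycol c]) (p w)"
      using plactic_sym[OF plactic_hwcol[OF h(1)]] h(4,5) less.prems(2) by simp
    moreover have "acol_word n [ycol a, ycol c]" using valid_ycol par by simp
    moreover have "NF n [ycol a, ycol c]" using ext_prec_ycol par by simp
    moreover have "len (ycol a) \<le> len c1" "len (ycol a) + len (ycol c) \<le> len c1 + len c2"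
      unfolding l using par by auto
    moreover have "\<not> NF n w \<longrightarrow> len (ycol a) \<noteq> len c1 \<or> len (ycol a) + len (ycol c) \<noteq> len c1 + len c2"
      unfolding l using nf by blast
    ultimately show ?thesis by blast
  next
    case (2 i w1)
    have w1: "acol_word n w1" "shape w1 = shape w" using 2(3) by (auto simp: step_def)
    then obtain e1 e2 where e: "w1 = [e1, e2]" "len e1 = len c1" "len e2 = len c2"
      using less.prems(2) by (auto simp: shape_def Cons_eq_map_conv)
    have lt: "sum_list (p w1) < sum_list (p w)" using step_sum_list[OF 2(3)] by simp
    obtain d1 d2 where d: "acol_word n [d1, d2]" "NF n [d1, d2]" "plactic n (p [d1, d2]) (p w1)"
      "len d1 \<le> len e1" "len d1 + len d2 \<le> len e1 + len e2"
      "\<not> NF n w1 \<longrightarrow> len d1 \<noteq> len e1 \<or> len d1 + len d2 \<noteq> len e1 + len e2"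
      using less.hyps[OF lt w1(1) e(1)] by blast
    have f: "fw n i (p w1) = Some (p w)" using 2(3) by (simp add: step_def)
    then obtain y where y: "fw n i (p [d1, d2]) = Some y" "plactic n y (p w)"
      using plactic_sync[OF d(3) 2(1,2)] by (cases "fw n i (p [d1, d2])") auto
    obtain t where t: "step n i [d1, d2] t" "p t = y" by (rule step_fw_ex[OF d(1) 2(1,2) y(1)])
    then have "acol_word n t" "shape t = shape [d1, d2]" by (auto simp: step_def)
    then obtain t1 t2 where tt: "t = [t1, t2]" "len t1 = len d1" "len t2 = len d2"
      by (auto simp: shape_def Cons_eq_map_conv map_eq_Cons_conv)
    have "NF n t" "NF n w1 \<longleftrightarrow> NF n w" using step_NF[OF 2(1,2)] t(1) d(2) 2(3) by auto
    then show ?thesis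
      using \<open>acol_word n t\<close> tt t(2) y(2) d e by (intro exI[of _ t1] exI[of _ t2]) auto
  qed
qed

section \<open>Tableau words and column insertion\<close>

lemma p_map_Col: "p (map Col cs) = concat cs"
  by (induction cs) auto

lemma NF_replicate_Eps: "NF n w \<Longrightarrow> NF n (replicate k Eps @ w)"
proof (induction k)
  case (Suc k)
  then show ?case by (simp add: successively_Cons)
qed simp

lemma acol_word_replicate_Eps: "acol_word n (replicate k Eps)"
  by (induction k) auto

lemma p_replicate_Eps: "p (replicate k Eps) = []"
  by (induction k) auto

text \<open>Tableaux of the same word may have different numbers of columns. Padding both on the
  left with empty columns makes the lengths equal and keeps normality, since every column is allowed
  to follow \<open>Eps\<close>.\<close>

lemma NF_unique_p:
  assumes "acol_word n w" "acol_word n w'" "NF n w" "NF n w'" "plactic n (p w) (p w')"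
  shows "p w = p w'"
proof -
  let ?v = "replicate (length w') Eps @ w" and ?v' = "replicate (length w) Eps @ w'"
  have "?v = ?v'"
    by (rule NF_unique[OF plactic_csim])
      (use assms NF_replicate_Eps in \<open>auto simp: acol_word_replicate_Eps p_replicate_Eps\<close>)
  then have "p ?v = p ?v'" by simp
  then show ?thesis by (simp add: p_replicate_Eps)
qed

lemma is_tabword_NF:
  "is_tabword n t \<longleftrightarrow> (\<exists>cs. t = p (map Col cs) \<and> acol_word n (map Col cs) \<and> NF n (map Col cs))"
  unfolding is_tabword_def p_map_Col acol_word_def by (auto simp: successively_conv_nth)

lemma tabword_eq:
  assumes "acol_word n [d1, d2]" "NF n [d1, d2]" "plactic n (p [d1, d2]) w"
  shows "tabword n w = p [d1, d2]"
  unfolding tabword_def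
proof (rule the_equality)
  \<comment> \<open>A tableau word consists of genuine columns, so the empty ones, which stand in
    front, are dropped.\<close>
  have "\<exists>cs. p [d1, d2] = p (map Col cs) \<and> acol_word n (map Col cs) \<and> NF n (map Col cs)"
  proof (cases d1)
    case (Col c)
    then obtain d where "d2 = Col d" using assms(2) by (cases d2) auto
    then show ?thesis using assms Col by (intro exI[of _ "[c, d]"]) auto
  next
    case Eps
    show ?thesis
    proof (cases d2)
      case Eps
      then show ?thesis using \<open>d1 = Eps\<close> by (intro exI[of _ "[]"]) auto
    next
      case (Col d)
      then show ?thesis using Eps assms by (intro exI[of _ "[d]"]) auto
    qed
  qed
  then show "is_tabword n (p [d1, d2]) \<and> plactic n (p [d1, d2]) w" using assms(3) is_tabword_NF by blast
next
  fix t assume t: "is_tabword n t \<and> plactic n t w"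
  then obtain cs where "t = p (map Col cs)" "acol_word n (map Col cs)" "NF n (map Col cs)"
    using is_tabword_NF by blast
  then show "t = p [d1, d2]"
    using NF_unique_p[of n "map Col cs" "[d1, d2]"] assms t plactic_trans plactic_sym by blast
qed

lemma ins_cols_eq:
  assumes "acol_word n [d1, d2]" "NF n [d1, d2]" "plactic n (p [d1, d2]) (p [c1, c2])"
  shows "ins_cols n c1 c2 = (d1, d2)"
proof -
  let ?t = "p [d1, d2]"
  have t: "tabword n (p [c1, c2]) = ?t" using tabword_eq assms by blast
  have uniq: "xy = (d1, d2)" if "acol_word n [fst xy, snd xy]" "NF n [fst xy, snd xy]" "p [fst xy, snd xy] = ?t" for xy
  proof -
    have "[fst xy, snd xy] = [d1, d2]"
      by (rule NF_unique[OF plactic_csim that(1) assms(1) that(2) assms(2)]) (use that(3) in simp_all)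
    then show ?thesis by (cases xy) simp
  qed
  show ?thesis
    unfolding ins_cols_def Let_def t
  proof (rule the_equality)
    show "(\<exists>e1 e2. (d1, d2) = (Col e1, Col e2) \<and> admissible n e1 \<and> admissible n e2 \<and> prec n e2 e1 \<and> ?t = e1 @ e2)
      \<or> (\<exists>d. (d1, d2) = (Eps, Col d) \<and> admissible n d \<and> ?t = d) \<or> ((d1, d2) = (Eps, Eps) \<and> ?t = [])"
      using assms(1,2) by (cases d1; cases d2) auto
  next
    fix xy assume "(\<exists>e1 e2. xy = (Col e1, Col e2) \<and> admissible n e1 \<and> admissible n e2 \<and> prec n e2 e1 \<and> ?t = e1 @ e2)
      \<or> (\<exists>d. xy = (Eps, Col d) \<and> admissible n d \<and> ?t = d) \<or> (xy = (Eps, Eps) \<and> ?t = [])"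
    then show "xy = (d1, d2)" by (intro uniq) auto
  qed
qed

section \<open>Termination of rewriting\<close>

fun cost :: "acol list \<Rightarrow> nat" where
  "cost [] = 0"
| "cost (a # w) = Suc (length w) * len a + cost w"

lemma cost_append_less: "length x = length y \<Longrightarrow> cost x < cost y \<Longrightarrow> cost (u @ x) < cost (u @ y)"
  by (induction u) auto

text \<open>Each column is weighted by the number of columns from it to the end. So the cost falls
  when letters disappear and when letters move from the first to the second column; \<open>e\<close>
  makes this visible, as a multiple of the total length plus the first length.\<close>

lemma cost_pair:
  assumes "len d1 \<le> len c1" "len d1 + len d2 \<le> len c1 + len c2"
    "len d1 \<noteq> len c1 \<or> len d1 + len d2 \<noteq> len c1 + len c2"
  shows "cost ([d1, d2] @ v) < cost ([c1, c2] @ v)"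
proof -
  have e: "cost ([a, b] @ v) = Suc (length v) * (len a + len b) + len a + cost v" for a b
    by (simp add: algebra_simps)
  have le: "Suc (length v) * (len d1 + len d2) \<le> Suc (length v) * (len c1 + len c2)"
    using assms(2) by (intro mult_le_mono) auto
  show ?thesis
  proof (cases "len d1 = len c1")
    case False
    then show ?thesis using le assms(1) unfolding e by linarith
  next
    case True
    then have "len d1 + len d2 < len c1 + len c2" using assms by simp
    then have "Suc (length v) * (len d1 + len d2) < Suc (length v) * (len c1 + len c2)"
      by (intro mult_less_mono2) auto
    then show ?thesis using assms(1) unfolding e by linarith
  qed
qed

lemma not_successively:
  "\<not> successively P w \<Longrightarrow> \<exists>u a b v. w = u @ [a, b] @ v \<and> \<not> P a b"
proof (induction w rule: induct_list012)
  case (3 x y zs)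
  show ?case
  proof (cases "P x y")
    case True
    then obtain u a b v where "y # zs = u @ [a, b] @ v" "\<not> P a b" using 3 by auto
    then show ?thesis by (intro exI[of _ "x # u"] exI[of _ a] exI[of _ b] exI[of _ v]) simp
  next
    case False
    then show ?thesis by (intro exI[of _ "[]"] exI[of _ x] exI[of _ y] exI[of _ zs]) simp
  qed
qed auto

lemma NF_exists:
  assumes "acol_word n w"
  shows "\<exists>w'. acol_word n w' \<and> NF n w' \<and> length w' = length w \<and> plN_cong n w w' \<and> plactic n (p w) (p w')"
  using assms
proof (induction "cost w" arbitrary: w rule: less_induct)
  case less
  show ?case
  proof (cases "NF n w")
    case True
    then show ?thesis using less.prems by (intro exI[of _ w]) (simp add: plN_cong_def cong_cl.refl)
  next
    case False
    then obtain u c1 c2 v where w: "w = u @ [c1, c2] @ v" "\<not> ext_prec n c2 c1"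
      using not_successively by blast
    have val: "acol_word n [c1, c2]" "acol_word n u" "acol_word n v" using less.prems w by auto
    obtain d1 d2 where d: "acol_word n [d1, d2]" "NF n [d1, d2]" "plactic n (p [d1, d2]) (p [c1, c2])"
      "len d1 \<le> len c1" "len d1 + len d2 \<le> len c1 + len c2"
      "len d1 \<noteq> len c1 \<or> len d1 + len d2 \<noteq> len c1 + len c2"
      using pair_reduction[OF val(1) HOL.refl] w(2) by auto
    let ?w = "u @ [d1, d2] @ v"
    have ins: "ins_cols n c1 c2 = (d1, d2)" using ins_cols_eq[OF d(1-3)] .
    have "plN_rel n [c1, c2] [d1, d2]"
      using plN_rel.intros[of n c1 c2] val(1) w(2) ins by simp
    then have c: "plN_cong n w ?w" unfolding plN_cong_def w(1) by (intro cong_cl.ctxt cong_cl.base)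
    have "cost ?w < cost w" unfolding w(1) by (intro cost_append_less cost_pair d) simp
    moreover have "acol_word n ?w" using val d(1) by simp
    ultimately obtain w' where w': "acol_word n w'" "NF n w'" "length w' = length ?w" "plN_cong n ?w w'"
      "plactic n (p ?w) (p w')" using less.hyps by blast
    have "plactic n (p w) (p ?w)"
      using plactic_ctxt[OF plactic_sym[OF d(3)], of "p u" "p v"] by (simp add: w(1))
    then show ?thesis
      using w' c plactic_trans unfolding plN_cong_def w(1) by (intro exI[of _ w']) (auto intro: cong_cl.trans)
  qed
qed

section \<open>Isomorphisms of components\<close>

lemma adj_step: "adj n u v \<longleftrightarrow> (\<exists>i. 1 \<le> i \<and> i \<le> n \<and> (step n i u v \<or> step n i v u))"
  by (auto simp: adj_def edge_step)

lemma Bcomp_valid: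
  assumes "v \<in> Bcomp n w" "acol_word n w"
  shows "acol_word n v \<and> shape v = shape w"
  using assms(1) unfolding Bcomp_def mem_Collect_eq
  by (induction rule: rtranclp_induct) (use assms(2) in \<open>auto simp: adj_step step_def\<close>)

lemma Bcomp_self: "w \<in> Bcomp n w"
  by (simp add: Bcomp_def)

lemma Bcomp_step:
  assumes "u \<in> Bcomp n w" "1 \<le> i" "i \<le> n" "step n i u v \<or> step n i v u"
  shows "v \<in> Bcomp n w"
  using assms unfolding Bcomp_def mem_Collect_eq
  by (meson adj_step rtranclp.rtrancl_into_rtrancl)

definition tab :: "nat \<Rightarrow> acol list \<Rightarrow> acol list" where
  "tab n w = (SOME t. acol_word n t \<and> NF n t \<and> length t = 2 \<and> plactic n (p t) (p w))"

lemma tab_props: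
  assumes "acol_word n w" "length w = 2"
  shows "acol_word n (tab n w)" "NF n (tab n w)" "length (tab n w) = 2" "plactic n (p (tab n w)) (p w)"
proof -
  obtain c1 c2 where w: "w = [c1, c2]" using assms(2) by (rule length2E)
  obtain d1 d2 where "acol_word n [d1, d2]" "NF n [d1, d2]" "plactic n (p [d1, d2]) (p w)"
    using pair_reduction[OF assms(1) w] by blast
  then have "\<exists>t. acol_word n t \<and> NF n t \<and> length t = 2 \<and> plactic n (p t) (p w)"
    by (intro exI[of _ "[d1, d2]"]) simp
  then show "acol_word n (tab n w)" "NF n (tab n w)" "length (tab n w) = 2" "plactic n (p (tab n w)) (p w)"
    unfolding tab_def by (metis (mono_tags, lifting) someI_ex)+
qed

lemma tab_eqI:
  assumes "acol_word n w" "length w = 2" "acol_word n t" "NF n t" "length t = 2" "plactic n (p t) (p w)"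
  shows "tab n w = t"
proof (rule NF_unique[OF plactic_csim tab_props(1)[OF assms(1,2)] assms(3) tab_props(2)[OF assms(1,2)] assms(4)])
  show "length (tab n w) = length t" using tab_props(3)[OF assms(1,2)] assms(5) by simp
  show "plactic n (p (tab n w)) (p t)"
    using tab_props(4)[OF assms(1,2)] assms(6) plactic_trans plactic_sym by blast
qed

text \<open>The shape is constant on a component, so this gives injectivity there.\<close>

lemma tab_inj:
  assumes "acol_word n u" "acol_word n v" "length u = 2" "shape u = shape v" "tab n u = tab n v"
  shows "u = v"
proof (rule pair_unique[OF plactic_csim assms(1-4)])
  have "length v = 2" using assms(3,4) shape_length by metis
  then show "plactic n (p u) (p v)"
    using tab_props(4)[OF assms(1,3)] tab_props(4)[of n v] assms(2,5) plactic_trans plactic_sym by metis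
qed

lemma tab_step:
  assumes "1 \<le> i" "i \<le> n" "step n i u v" "length u = 2"
  shows "step n i (tab n u) (tab n v)"
proof -
  have uv: "acol_word n u" "acol_word n v" "length v = 2" "fw n i (p u) = Some (p v)"
    using assms shape_length[of v u] by (auto simp: step_def)
  note tu = tab_props[OF uv(1) assms(4)]
  obtain y where y: "fw n i (p (tab n u)) = Some y" "plactic n y (p v)"
    using plactic_sync[OF tu(4) assms(1,2)] uv(4) by (cases "fw n i (p (tab n u))") auto
  obtain t where t: "step n i (tab n u) t" "p t = y" by (rule step_fw_ex[OF tu(1) assms(1,2) y(1)])
  have "tab n v = t"
  proof (rule tab_eqI[OF uv(2,3)])
    show "acol_word n t" "length t = 2" using t(1) tu(3) shape_length[of t "tab n u"] by (auto simp: step_def)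
    show "NF n t" using step_NF[OF assms(1,2) t(1)] tu(2) by simp
    show "plactic n (p t) (p v)" using y(2) t(2) by simp
  qed
  then show ?thesis using t(1) by simp
qed

text \<open>Steps at the tableau come from steps at the pair. This gives surjectivity onto the
  component of the tableau, and the reflection of edges.\<close>

lemma tab_step_lift:
  assumes "1 \<le> i" "i \<le> n" "acol_word n u" "length u = 2"
  shows "step n i (tab n u) t \<Longrightarrow> \<exists>v. step n i u v \<and> tab n v = t"
    and "step n i t (tab n u) \<Longrightarrow> \<exists>v. step n i v u \<and> tab n v = t"
proof -
  note tu = tab_props[OF assms(3,4)]
  note sy = plactic_sync[OF tu(4) assms(1,2)]
  show "\<exists>v. step n i u v \<and> tab n v = t" if t: "step n i (tab n u) t"
  proof -
    have "fw n i (p (tab n u)) = Some (p t)" using t by (simp add: step_def)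
    then obtain y where "fw n i (p u) = Some y" using sy by (cases "fw n i (p u)") auto
    then obtain v where v: "step n i u v" by (rule step_fw_ex[OF assms(3,1,2)])
    then show ?thesis using step_det[OF tab_step[OF assms(1,2) v assms(4)] t] by blast
  qed
  show "\<exists>v. step n i v u \<and> tab n v = t" if t: "step n i t (tab n u)"
  proof -
    have "ew n i (p (tab n u)) = Some (p t)" using t by (simp add: step_def fw_ew)
    then obtain y where "ew n i (p u) = Some y" using sy by (cases "ew n i (p u)") auto
    then obtain v where v: "step n i v u" by (rule step_ew_ex[OF assms(3,1,2)])
    then have "length v = 2" using shape_length[of u v] assms(4) by (simp add: step_def)
    then show ?thesis using step_inj[OF tab_step[OF assms(1,2) v] t] v by blast
  qed
qed

lemma tab_iso:
  assumes w: "acol_word n w" "length w = 2"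
  shows "crystal_iso_at n w (tab n w)"
  unfolding crystal_iso_at_def
proof (intro exI[of _ "tab n"] conjI ballI allI HOL.refl)
  have val: "acol_word n u" "shape u = shape w" "length u = 2" if "u \<in> Bcomp n w" for u
    using Bcomp_valid[OF that w(1)] shape_length[of u w] w(2) by auto
  have inj: "inj_on (tab n) (Bcomp n w)"
    using tab_inj val by (intro inj_onI) metis
  have "tab n ` Bcomp n w = Bcomp n (tab n w)"
  proof (intro equalityI subsetI)
    fix t assume "t \<in> tab n ` Bcomp n w"
    then obtain u where u: "u \<in> Bcomp n w" "t = tab n u" by blast
    have "(adj n)\<^sup>*\<^sup>* w u" using u(1) by (simp add: Bcomp_def)
    then have "u \<in> Bcomp n w \<and> tab n u \<in> Bcomp n (tab n w)"
    proof (induction rule: rtranclp_induct)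
      case base
      then show ?case by (simp add: Bcomp_self)
    next
      case (step y z)
      then obtain i where i: "1 \<le> i" "i \<le> n" "step n i y z \<or> step n i z y" by (auto simp: adj_step)
      have z: "z \<in> Bcomp n w" using Bcomp_step i step.IH by blast
      have "step n i (tab n y) (tab n z) \<or> step n i (tab n z) (tab n y)"
        using tab_step i val(3) z step.IH by blast
      then show ?case using z Bcomp_step i step.IH by blast
    qed
    then show "t \<in> Bcomp n (tab n w)" using u(2) by simp
  next
    fix t assume "t \<in> Bcomp n (tab n w)"
    then have "(adj n)\<^sup>*\<^sup>* (tab n w) t" by (simp add: Bcomp_def)
    then show "t \<in> tab n ` Bcomp n w"
    proof (induction rule: rtranclp_induct)
      case base
      then show ?case using Bcomp_self by blast
    next
      case (step y z)
      then obtain i where i: "1 \<le> i" "i \<le> n" "step n i y z \<or> step n i z y" by (auto simp: adj_step)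
      obtain u where u: "u \<in> Bcomp n w" "y = tab n u" using step.IH by blast
      obtain v where v: "step n i u v \<or> step n i v u" "tab n v = z"
        using i(3) tab_step_lift[OF i(1,2) val(1,3)[OF u(1)], of z] u(2) by blast
      then have "v \<in> Bcomp n w" using Bcomp_step u(1) i by blast
      then show ?case using v(2) by blast
    qed
  qed
  then show "bij_betw (tab n) (Bcomp n w) (Bcomp n (tab n w))" using inj by (simp add: bij_betw_def)
  fix u v i assume uv: "u \<in> Bcomp n w" "v \<in> Bcomp n w"
  show "edge n i u v \<longleftrightarrow> edge n i (tab n u) (tab n v)"
  proof
    assume "edge n i u v"
    then show "edge n i (tab n u) (tab n v)" using tab_step val(3)[OF uv(1)] by (auto simp: edge_step)
  next
    assume "edge n i (tab n u) (tab n v)"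
    then have e: "1 \<le> i" "i \<le> n" "step n i (tab n u) (tab n v)" by (auto simp: edge_step)
    obtain v' where v': "step n i u v'" "tab n v' = tab n v"
      using tab_step_lift(1)[OF e(1,2) val(1,3)[OF uv(1)] e(3)] by blast
    have "v' \<in> Bcomp n w" using Bcomp_step uv(1) e(1,2) v'(1) by blast
    then have "v' = v" using inj v'(2) uv(2) by (auto dest: inj_onD)
    then show "edge n i u v" using v'(1) e by (simp add: edge_step)
  qed
qed

lemma plN_rel_sim_eps:
  assumes "plN_rel n a b"
  shows "sim_eps n a b"
  using assms
proof cases
  case (1 c1 c2)
  let ?w = "[c1, c2]"
  have w: "acol_word n ?w" "length ?w = 2" using 1 by auto
  obtain d1 d2 where d: "tab n ?w = [d1, d2]" using tab_props(3)[OF w] by (rule length2E)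
  then have "ins_cols n c1 c2 = (d1, d2)" using ins_cols_eq[of n d1 d2 c1 c2] tab_props[OF w] by simp
  then have "b = tab n ?w" using 1 d by simp
  then show ?thesis using 1(1) tab_iso[OF w] tab_props[OF w] w by (simp add: sim_eps_def)
qed

text \<open>A component is closed under all operators, so its edges record where each operator is
  defined. That an undefined operator stays undefined on the other side uses the surjectivity of the
  isomorphism.\<close>

lemma crystal_iso_csim:
  assumes "crystal_iso_at n w1 w2" "acol_word n w1" "acol_word n w2"
  obtains R where "csim n R" "R (p w1) (p w2)"
proof -
  obtain \<phi> where bij: "bij_betw \<phi> (Bcomp n w1) (Bcomp n w2)" and w: "\<phi> w1 = w2"
    and ed: "\<And>u v i. u \<in> Bcomp n w1 \<Longrightarrow> v \<in> Bcomp n w1 \<Longrightarrow> edge n i u v \<longleftrightarrow> edge n i (\<phi> u) (\<phi> v)"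
    using assms(1) unfolding crystal_iso_at_def by blast
  define R where "R x y \<longleftrightarrow> (\<exists>u\<in>Bcomp n w1. x = p u \<and> y = p (\<phi> u))" for x y
  have img: "\<phi> u \<in> Bcomp n w2" if "u \<in> Bcomp n w1" for u using bij that by (auto simp: bij_betw_def)
  have pre: "\<exists>u\<in>Bcomp n w1. \<phi> u = v" if "v \<in> Bcomp n w2" for v
  proof -
    have "v \<in> \<phi> ` Bcomp n w1" using that by (simp add: bij_betw_imp_surj_on[OF bij])
    then show ?thesis by blast
  qed
  have "csim n R"
    unfolding csim_def
  proof (intro allI impI)
    fix x y i assume "R x y" and i: "1 \<le> i" "i \<le> n"
    then obtain u where u: "u \<in> Bcomp n w1" "x = p u" "y = p (\<phi> u)" by (auto simp: R_def)
    have val: "acol_word n u" "acol_word n (\<phi> u)"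
      using Bcomp_valid[OF u(1) assms(2)] Bcomp_valid[OF img[OF u(1)] assms(3)] by auto
    have fwd: "step n i (\<phi> u) (\<phi> v)" if "step n i u v" for v
      using ed[OF u(1), of v i] Bcomp_step[OF u(1) i, of v] that i by (simp add: edge_step)
    have fwd': "step n i (\<phi> v) (\<phi> u)" if "step n i v u" for v
      using ed[OF _ u(1), of v i] Bcomp_step[OF u(1) i, of v] that i by (simp add: edge_step)
    have f: "rel_option R (fw n i x) (fw n i y)"
    proof (cases "fw n i x")
      case (Some x')
      then obtain v where v: "step n i u v" "p v = x'" using step_fw_ex[OF val(1) i] u(2) by blast
      have "fw n i y = Some (p (\<phi> v))" using fwd[OF v(1)] u(3) by (simp add: step_def)
      moreover have "R x' (p (\<phi> v))" using Bcomp_step[OF u(1) i] v by (auto simp: R_def)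
      ultimately show ?thesis using Some by simp
    next
      case None
      have "fw n i y = None"
      proof (rule ccontr)
        assume "fw n i y \<noteq> None"
        then obtain y' where "fw n i (p (\<phi> u)) = Some y'" using u(3) by auto
        then obtain v where v: "step n i (\<phi> u) v" by (rule step_fw_ex[OF val(2) i])
        then have "v \<in> Bcomp n w2" using Bcomp_step[OF img[OF u(1)] i] by blast
        then obtain v' where v': "v' \<in> Bcomp n w1" "\<phi> v' = v" using pre by blast
        then have "step n i u v'" using ed[OF u(1) v'(1), of i] v i by (simp add: edge_step)
        then show False using None u(2) by (simp add: step_def)
      qed
      then show ?thesis using None by simp
    qed
    have e: "rel_option R (ew n i x) (ew n i y)"
    proof (cases "ew n i x")
      case (Some x')
      then obtain v where v: "step n i v u" "p v = x'" using step_ew_ex[OF val(1) i] u(2) by blast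
      have "ew n i y = Some (p (\<phi> v))" using fwd'[OF v(1)] u(3) by (simp add: step_def fw_ew)
      moreover have "R x' (p (\<phi> v))" using Bcomp_step[OF u(1) i] v by (auto simp: R_def)
      ultimately show ?thesis using Some by simp
    next
      case None
      have "ew n i y = None"
      proof (rule ccontr)
        assume "ew n i y \<noteq> None"
        then obtain y' where "ew n i (p (\<phi> u)) = Some y'" using u(3) by auto
        then obtain v where v: "step n i v (\<phi> u)" by (rule step_ew_ex[OF val(2) i])
        then have "v \<in> Bcomp n w2" using Bcomp_step[OF img[OF u(1)] i] by blast
        then obtain v' where v': "v' \<in> Bcomp n w1" "\<phi> v' = v" using pre by blast
        then have "step n i v' u" using ed[OF v'(1) u(1), of i] v i by (simp add: edge_step)
        then show False using None u(2) by (simp add: step_def fw_ew)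
      qed
      then show ?thesis using None by simp
    qed
    show "rel_option R (fw n i x) (fw n i y) \<and> rel_option R (ew n i x) (ew n i y)" using f e ..
  qed
  moreover have "R (p w1) (p w2)" using Bcomp_self w by (auto simp: R_def)
  ultimately show thesis by (rule that)
qed

text \<open>The normal forms \<open>a'\<close> and \<open>b'\<close> are linked through
  \<open>a\<close> and \<open>b\<close> by plactic congruence, the isomorphism, and plactic
  congruence again. The composition is a bisimulation and the lengths agree, so
  \<open>a' = b'\<close>.\<close>

lemma sim_eps_plN_cong:
  assumes "sim_eps n a b"
  shows "plN_cong n a b"
proof -
  have h: "acol_word n a" "acol_word n b" "length a = length b" "crystal_iso_at n a b"
    using assms by (auto simp: sim_eps_def)
  obtain a' where a': "acol_word n a'" "NF n a'" "length a' = length a" "plN_cong n a a'" "plactic n (p a) (p a')"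
    using NF_exists[OF h(1)] by blast
  obtain b' where b': "acol_word n b'" "NF n b'" "length b' = length b" "plN_cong n b b'" "plactic n (p b) (p b')"
    using NF_exists[OF h(2)] by blast
  obtain R where R: "csim n R" "R (p a) (p b)" by (rule crystal_iso_csim[OF h(4,1,2)])
  have "csim n (plactic n OO R OO plactic n)" by (intro csim_comp plactic_csim R)
  moreover have "(plactic n OO R OO plactic n) (p a') (p b')"
    using plactic_sym[OF a'(5)] R(2) b'(5) by blast
  ultimately have "a' = b'" using NF_unique a' b' h(3) by metis
  then show ?thesis using a'(4) b'(4) unfolding plN_cong_def by (blast intro: cong_cl.trans cong_cl.sym)
qed

lemma cong_cl_mono:
  assumes "cong_cl R u v" "\<And>a b. R a b \<Longrightarrow> cong_cl S a b"
  shows "cong_cl S u v"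
  using assms(1)
  by (induction rule: cong_cl.induct) (blast intro: assms(2) cong_cl.refl cong_cl.sym cong_cl.trans cong_cl.ctxt)+

theorem theorem3p6:
  fixes n :: nat and w1 w2 :: "acol list"
  assumes "1 \<le> n" and "acol_word n w1" and "acol_word n w2"
  shows "eps_cong n w1 w2 \<longleftrightarrow> plN_cong n w1 w2"
proof
  assume "eps_cong n w1 w2"
  then show "plN_cong n w1 w2"
    unfolding eps_cong_def plN_cong_def
    by (rule cong_cl_mono) (rule sim_eps_plN_cong[unfolded plN_cong_def])
next
  assume "plN_cong n w1 w2"
  then show "eps_cong n w1 w2"
    unfolding eps_cong_def plN_cong_def
    by (rule cong_cl_mono) (intro cong_cl.base plN_rel_sim_eps)
qed

end
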